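(* Let $\alpha>1$ and $\nu>0$, and let $G=(V,E)$ be distributed as $\mathrm{Poi}_{\alpha,\nu}(n)$. Let $L_1$ be a largest connected component of $G$ and $|L_1|$ its number of vertices. There is a constant $C>0$ such that, asymptotically almost surely (i.e. with probability tending to $1$ as $n\to\infty$), $$ n^{\frac{1}{2\alpha}}(\log n)^{-C}\le |L_1|\le n^{\frac{1}{2\alpha}}(\log n)^{C}. $$
   Context: The random hyperbolic graph $\mathrm{Poi}_{\alpha,\nu}(n)$: fix $\alpha>1$, $\nu>0$, and for $n\in\mathbb N$ put $R=2\log(n/\nu)$ ($\log$ is the natural logarithm). Points of the hyperbolic plane are given in polar coordinates $(r,\theta)$ (native representation), and the hyperbolic distance $d_h$ between $u=(r_u,\theta_u)$ and $u'=(r_{u'},\theta_{u'})$ is defined by $\cosh d_h(u,u')=\cosh r_u\cosh r_{u'}-\sinh r_u\sinh r_{u'}\cos(\theta_u-\theta_{u'})$. The vertex set $V$ is a Poisson point process on $\{(r,\theta):0\le r<R,\ 0\le\theta<2\pi\}$ with intensity (with respect to $dr\,d\theta$) $\nu e^{R/2}\cdot\frac{1}{2\pi}\cdot\frac{\alpha\sinh(\alpha r)}{\cosh(\alpha R)-1}$; so the expected number of vertices is $n$. Two distinct vertices $u,u'$ are joined by an edge iff $d_h(u,u')\le R$. *)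

theory Defs
  imports "HOL-Probability.Probability"
begin

text \<open>Random hyperbolic graph Poi_{alpha,nu}(n). Points are pairs (r, theta) in native
  polar coordinates.\<close>

definition hrg_R :: "real \<Rightarrow> nat \<Rightarrow> real" where
  "hrg_R \<nu> n = 2 * ln (real n / \<nu>)"

definition hyp_dist :: "real \<times> real \<Rightarrow> real \<times> real \<Rightarrow> real" where
  "hyp_dist u v = arcosh (cosh (fst u) * cosh (fst v)
       - sinh (fst u) * sinh (fst v) * cos (snd u - snd v))"

text \<open>Normalised point density: intensity of the Poisson process divided by its
  total mass n (note nu * exp(R/2) = n).\<close>
definition hrg_density :: "real \<Rightarrow> real \<Rightarrow> nat \<Rightarrow> real \<times> real \<Rightarrow> real" where
  "hrg_density \<alpha> \<nu> n p =
     (if 0 \<le> fst p \<and> fst p < hrg_R \<nu> n \<and> 0 \<le> snd p \<and> snd p < 2 * pi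
      then (1 / (2 * pi)) * (\<alpha> * sinh (\<alpha> * fst p) / (cosh (\<alpha> * hrg_R \<nu> n) - 1))
      else 0)"

definition hrg_point_dist :: "real \<Rightarrow> real \<Rightarrow> nat \<Rightarrow> (real \<times> real) measure" where
  "hrg_point_dist \<alpha> \<nu> n = density lborel (\<lambda>p. ennreal (hrg_density \<alpha> \<nu> n p))"

definition hrg_config_space :: "real \<Rightarrow> real \<Rightarrow> nat \<Rightarrow> nat \<Rightarrow> (nat \<Rightarrow> real \<times> real) measure" where
  "hrg_config_space \<alpha> \<nu> n k = PiM {..<k} (\<lambda>_. hrg_point_dist \<alpha> \<nu> n)"

text \<open>Probability of an event E k x (k = number of points, x = the points) under the
  Poisson point process with intensity n * hrg_density: the number of points is
  Poisson(n) and, given k points, they are i.i.d. with the normalised density.\<close>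
definition poi_prob :: "real \<Rightarrow> real \<Rightarrow> nat \<Rightarrow> (nat \<Rightarrow> (nat \<Rightarrow> real \<times> real) \<Rightarrow> bool) \<Rightarrow> real" where
  "poi_prob \<alpha> \<nu> n E =
     (\<Sum>k. (real n ^ k / fact k * exp (- real n)) *
        measure (hrg_config_space \<alpha> \<nu> n k)
          {x \<in> space (hrg_config_space \<alpha> \<nu> n k). E k x})"

definition hrg_adj :: "real \<Rightarrow> nat \<Rightarrow> nat \<Rightarrow> (nat \<Rightarrow> real \<times> real) \<Rightarrow> nat \<Rightarrow> nat \<Rightarrow> bool" where
  "hrg_adj \<nu> n k x i j \<longleftrightarrow> i < k \<and> j < k \<and> i \<noteq> j \<and> hyp_dist (x i) (x j) \<le> hrg_R \<nu> n"

definition component_of :: "nat \<Rightarrow> (nat \<Rightarrow> nat \<Rightarrow> bool) \<Rightarrow> nat \<Rightarrow> nat set" where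
  "component_of k adj v = {u. u < k \<and> adj\<^sup>*\<^sup>* v u}"

definition largest_component_size :: "nat \<Rightarrow> (nat \<Rightarrow> nat \<Rightarrow> bool) \<Rightarrow> nat" where
  "largest_component_size k adj =
     (if k = 0 then 0 else Max ((\<lambda>v. card (component_of k adj v)) ` {..<k}))"

end

(*
  Fold the circle at angle pi onto an interval of length of order n and give a point of radius r
  the weight w = exp ((R - r) / 2).  Adjacent points then satisfy |X - X'| <= w w', and points with
  weight at least t have density at most a constant times t^(-2 alpha).

  Upper bound.  Put H = (log n)^a.  A location x is a cut for the points lighter than H if no point
  has w^2 >= |X - x|; as alpha > 1 the intensity of such points is bounded uniformly in x, so cuts
  have positive density and light paths have polylogarithmic length.  Joining two heavy points that
  are linked by a light path only costs a polylogarithmic factor in the relation |X - X'| <= w w',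
  and the resulting graph on heavy points is a subcritical site percolation for large a: the
  expected offspring weight of a point of weight w is w times a polylogarithmic multiple of
  H^(2 - 2 alpha).  An exponential moment at scale 1 / max w shows that every heavy cluster has
  total weight at most n^(1/(2 alpha)) up to logarithms, which bounds the number of vertices.

  Lower bound.  Some point has radius about R - (log n) / alpha, and it is adjacent to every point of
  radius at most R - 2 in a sector of angle exp (- r / 2), that is, to about n^(1/(2 alpha)) points.
*)

theory Submission
  imports Defs "HOL-Real_Asymp.Real_Asymp"
begin

text \<open>Without a threshold the branching bound on clusters has a factor of order \<nu>, which
  need not be below 1. Light points are therefore not explored but confined by cuts; the factor
  \<open>H powr (2 - 2 * \<alpha>)\<close> makes the exploration of heavy points subcritical. Light
  and heavy points share one sample, so nothing is conditioned on: each property fails on an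
  explicit event of small probability, and the rest is deterministic. Clusters of points are
  replaced by clusters of boxes (unit cell times dyadic weight band): disjoint boxes are occupied
  independently, which leaves a finite Bernoulli site percolation, and the number of points per cell
  is bounded separately. The mean offspring weight is proportional to the weight of the parent, so
  an exponent linear in the weight closes the recursion for the exponential moment. Folding only
  brings points closer and at most doubles the density, so it removes the periodic boundary at the
  price of a constant. In the lower bound every box of a fixed partition is required to be occupied,
  so the central point may lie anywhere.\<close>

section \<open>Exponential moments in site percolation\<close>

text \<open>The seed is a set and \<open>E\<close> need not be symmetric: in the induction an
  explored vertex is deleted and its neighbours join the seeds. Seeds outside \<open>S\<close> are
  ignored.\<close>

inductive_set cluster :: "('b \<Rightarrow> 'b \<Rightarrow> bool) \<Rightarrow> 'b set \<Rightarrow> 'b set \<Rightarrow> 'b set"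
  for E S A where
    base: "a \<in> A \<Longrightarrow> a \<in> S \<Longrightarrow> a \<in> cluster E S A"
  | step: "b \<in> cluster E S A \<Longrightarrow> E b b' \<Longrightarrow> b' \<in> S \<Longrightarrow> b' \<in> cluster E S A"

lemma cluster_subset: "cluster E S A \<subseteq> S"
proof
  fix x assume "x \<in> cluster E S A"
  then show "x \<in> S" by cases auto
qed

lemma cluster_empty: "A \<inter> S = {} \<Longrightarrow> cluster E S A = {}"
proof (rule equals0I)
  fix x assume "A \<inter> S = {}" "x \<in> cluster E S A"
  from this(2,1) show False by induction auto
qed

lemma cluster_restrict_seed: "cluster E S A = cluster E S (A \<inter> S)"
proof (intro equalityI subsetI)
  fix x assume "x \<in> cluster E S A"
  then show "x \<in> cluster E S (A \<inter> S)"
    by induction (auto intro: cluster.intros)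
next
  fix x assume "x \<in> cluster E S (A \<inter> S)"
  then show "x \<in> cluster E S A"
    by induction (auto intro: cluster.intros)
qed

text \<open>A path through \<open>b\<close> can be restarted after its last visit to
  \<open>b\<close>, at a neighbour of \<open>b\<close>. The right side may be larger, since it
  contains \<open>b\<close> even if \<open>b\<close> is not reached.\<close>

lemma cluster_insert:
  assumes "b \<notin> S"
  shows "cluster E (insert b S) A \<subseteq> insert b (cluster E S ((A - {b}) \<union> {b'. E b b'}))"
proof
  fix x assume "x \<in> cluster E (insert b S) A"
  then show "x \<in> insert b (cluster E S ((A - {b}) \<union> {b'. E b b'}))"
  proof induction
    case (base a)
    then show ?case by (auto intro: cluster.base)
  next
    case (step c c')
    then show ?case by (auto intro: cluster.base cluster.step)
  qed
qed

text \<open>The probability that \<open>S\<close> is exactly the set of open sites of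
  \<open>V\<close>. Expectations become finite sums over \<open>Pow V\<close>, so the percolation
  bound needs no probability space.\<close>

definition bernoulli_weight :: "('b \<Rightarrow> real) \<Rightarrow> 'b set \<Rightarrow> 'b set \<Rightarrow> real" where
  "bernoulli_weight q V S = prod q S * prod (\<lambda>b. 1 - q b) (V - S)"

lemma bernoulli_weight_nonneg:
  assumes "\<And>b. b \<in> V \<Longrightarrow> 0 \<le> q b \<and> q b \<le> 1" "S \<subseteq> V"
  shows "0 \<le> bernoulli_weight q V S"
  unfolding bernoulli_weight_def using assms by (intro mult_nonneg_nonneg prod_nonneg) auto

lemma sum_bernoulli_weight: "finite V \<Longrightarrow> (\<Sum>S\<in>Pow V. bernoulli_weight q V S) = 1"
  using prod_add[of V q "\<lambda>b. 1 - q b"] by (simp add: bernoulli_weight_def)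

text \<open>Conditioning on the state of \<open>b\<close>.\<close>

lemma sum_bernoulli_split:
  assumes "finite V" "b \<in> V"
  shows "(\<Sum>S\<in>Pow V. bernoulli_weight q V S * f S)
    = (1 - q b) * (\<Sum>S\<in>Pow (V - {b}). bernoulli_weight q (V - {b}) S * f S)
     + q b * (\<Sum>S\<in>Pow (V - {b}). bernoulli_weight q (V - {b}) S * f (insert b S))"
proof -
  define U where "U = V - {b}"
  have V: "V = insert b U" "b \<notin> U" "finite U" using assms by (auto simp: U_def)
  have "(\<Sum>S\<in>Pow V. bernoulli_weight q V S * f S)
     = (\<Sum>S\<in>Pow U. bernoulli_weight q V S * f S)
      + (\<Sum>S\<in>insert b ` Pow U. bernoulli_weight q V S * f S)"
    unfolding V(1) Pow_insert using V by (intro sum.union_disjoint) auto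
  also have "(\<Sum>S\<in>insert b ` Pow U. bernoulli_weight q V S * f S)
     = (\<Sum>S\<in>Pow U. bernoulli_weight q V (insert b S) * f (insert b S))"
    using V by (intro sum.reindex[unfolded comp_def]) (auto simp: inj_on_def)
  also have "\<dots> = (\<Sum>S\<in>Pow U. q b * (bernoulli_weight q U S * f (insert b S)))"
  proof (intro sum.cong refl)
    fix S assume S: "S \<in> Pow U"
    then have "finite S" "b \<notin> S" "V - insert b S = U - S"
      using V finite_subset[of S U] by auto
    then show "bernoulli_weight q V (insert b S) * f (insert b S)
        = q b * (bernoulli_weight q U S * f (insert b S))"
      by (simp add: bernoulli_weight_def)
  qed
  also have "(\<Sum>S\<in>Pow U. bernoulli_weight q V S * f S)
     = (\<Sum>S\<in>Pow U. (1 - q b) * (bernoulli_weight q U S * f S))"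
  proof (intro sum.cong refl)
    fix S assume S: "S \<in> Pow U"
    then have "V - S = insert b (U - S)" "b \<notin> U - S" "finite (U - S)"
      using V by auto
    then show "bernoulli_weight q V S * f S = (1 - q b) * (bernoulli_weight q U S * f S)"
      by (simp add: bernoulli_weight_def)
  qed
  finally show ?thesis by (simp add: sum_distrib_left U_def)
qed

text \<open>The hypothesis is a Kotecky--Preiss type condition: it says that the exponential moment of
  the total progeny of the dominating branching process is at most \<open>exp (a b)\<close>.\<close>

lemma percolation_exponential_moment:
  fixes q m a :: "'b \<Rightarrow> real"
  assumes "finite V"
    and q: "\<And>b. b \<in> V \<Longrightarrow> 0 \<le> q b \<and> q b \<le> 1"
    and a0: "\<And>b. b \<in> V \<Longrightarrow> 0 \<le> a b" and m: "\<And>b. b \<in> V \<Longrightarrow> 0 \<le> m b"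
    and a: "\<And>b. b \<in> V \<Longrightarrow> m b + (\<Sum>b'\<in>{b'\<in>V. E b b'}. q b' * (exp (a b') - 1)) \<le> a b"
  shows "(\<Sum>S\<in>Pow V. bernoulli_weight q V S * exp (sum m (cluster E S A)))
     \<le> (\<Prod>b\<in>A \<inter> V. 1 + q b * (exp (a b) - 1))"
  using assms
proof (induction "card V" arbitrary: V A rule: less_induct)
  case less
  note fin = less.prems(1) and q = less.prems(2) and a0 = less.prems(3)
    and m = less.prems(4) and a = less.prems(5)
  have g1: "1 \<le> 1 + q b * (exp (a b) - 1)" if "b \<in> V" for b
    using q[OF that] a0[OF that] by simp
  show ?case
  proof (cases "A \<inter> V = {}")
    case True
    have "cluster E S A = {}" if "S \<in> Pow V" for S
      using cluster_empty[of A S E] that True by auto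
    then have "(\<Sum>S\<in>Pow V. bernoulli_weight q V S * exp (sum m (cluster E S A))) = 1"
      using sum_bernoulli_weight[OF fin, of q] by simp
    then show ?thesis using True by simp
  next
    case False
    then obtain b where b: "b \<in> A" "b \<in> V" by auto
    define U where "U = V - {b}"
    have fU: "finite U" using fin by (simp add: U_def)
    have cU: "card U < card V" unfolding U_def by (rule card_Diff1_less[OF fin b(2)])
    \<comment> \<open>The condition passes to fewer vertices because all summands are
      nonnegative.\<close>
    have aU: "m c + (\<Sum>b'\<in>{b'\<in>U. E c b'}. q b' * (exp (a b') - 1)) \<le> a c" if "c \<in> U" for c
    proof -
      have "(\<Sum>b'\<in>{b'\<in>U. E c b'}. q b' * (exp (a b') - 1))
         \<le> (\<Sum>b'\<in>{b'\<in>V. E c b'}. q b' * (exp (a b') - 1))"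
        using fin q a0 by (intro sum_mono2) (auto simp: U_def)
      then show ?thesis using a[of c] that by (auto simp: U_def)
    qed
    have IH: "(\<Sum>S\<in>Pow U. bernoulli_weight q U S * exp (sum m (cluster E S B)))
     \<le> (\<Prod>b\<in>B \<inter> U. 1 + q b * (exp (a b) - 1))" for B
      using less.hyps[OF cU fU, of B] q a0 m aU by (auto simp: U_def)
    define P where "P = (\<Prod>b\<in>(A - {b}) \<inter> U. 1 + q b * (exp (a b) - 1))"
    define N where "N = {b'. E b b'}"
    have P0: "0 \<le> P" unfolding P_def
      using g1 by (intro prod_nonneg) (fastforce simp: U_def)
    \<comment> \<open>\<open>b\<close> closed: it can be struck from the seeds.\<close>
    have closed: "(\<Sum>S\<in>Pow U. bernoulli_weight q U S * exp (sum m (cluster E S A))) \<le> P"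
    proof -
      have "cluster E S A = cluster E S (A - {b})" if "S \<in> Pow U" for S
      proof -
        have "A \<inter> S = (A - {b}) \<inter> S" using that by (auto simp: U_def)
        then show ?thesis by (metis cluster_restrict_seed)
      qed
      then show ?thesis using IH[of "A - {b}"] by (simp add: P_def)
    qed
    \<comment> \<open>\<open>b\<close> open: it contributes \<open>exp (m b)\<close>, and its
      neighbours become seeds.\<close>
    have "(\<Sum>S\<in>Pow U. bernoulli_weight q U S * exp (sum m (cluster E (insert b S) A)))
       \<le> (\<Sum>S\<in>Pow U. exp (m b) * (bernoulli_weight q U S * exp (sum m (cluster E S ((A - {b}) \<union> N)))))"
    proof (intro sum_mono)
      fix S assume S: "S \<in> Pow U"
      let ?C = "cluster E S ((A - {b}) \<union> N)"
      have C: "?C \<subseteq> U" using S cluster_subset by fast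
      then have fC: "finite ?C" and bC: "b \<notin> ?C" using fU finite_subset by (auto simp: U_def)
      have "b \<notin> S" using S by (auto simp: U_def)
      then have "sum m (cluster E (insert b S) A) \<le> sum m (insert b ?C)"
        using cluster_insert[of b S E A] C b fC m
        by (intro sum_mono2) (auto simp: N_def U_def)
      also have "\<dots> = m b + sum m ?C" using fC bC by simp
      finally have "exp (sum m (cluster E (insert b S) A)) \<le> exp (m b) * exp (sum m ?C)"
        by (simp add: exp_add[symmetric])
      moreover have "0 \<le> bernoulli_weight q U S"
        using S q by (intro bernoulli_weight_nonneg) (auto simp: U_def)
      ultimately show "bernoulli_weight q U S * exp (sum m (cluster E (insert b S) A))
         \<le> exp (m b) * (bernoulli_weight q U S * exp (sum m ?C))"
        by (metis mult.left_commute mult_left_mono)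
    qed
    also have "\<dots> \<le> exp (m b) * (\<Prod>b\<in>((A - {b}) \<union> N) \<inter> U. 1 + q b * (exp (a b) - 1))"
      unfolding sum_distrib_left[symmetric] using IH by simp
    also have "\<dots> \<le> exp (m b) * (P * exp (\<Sum>b'\<in>{b'\<in>V. E b b'}. q b' * (exp (a b') - 1)))"
    proof -
      \<comment> \<open>The neighbours that are not yet seeds are split off. All factors are at
        least 1, so the split-off set may be enlarged to all neighbours; 1 + x <= exp x then
        produces the sum of the hypothesis.\<close>
      have "(\<Prod>b\<in>((A - {b}) \<union> N) \<inter> U. 1 + q b * (exp (a b) - 1))
         = P * (\<Prod>b\<in>(N - (A - {b})) \<inter> U. 1 + q b * (exp (a b) - 1))"
        unfolding P_def using fU
        by (subst prod.union_disjoint[symmetric]) (auto intro!: prod.cong)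
      also have "\<dots> \<le> P * (\<Prod>b\<in>N \<inter> V. 1 + q b * (exp (a b) - 1))"
        using fin g1 P0 by (intro mult_left_mono prod_mono2) (fastforce simp: U_def)+
      also have "\<dots> \<le> P * (\<Prod>b\<in>N \<inter> V. exp (q b * (exp (a b) - 1)))"
        using g1 P0 by (intro mult_left_mono prod_mono) (fastforce)+
      also have "(\<Prod>b\<in>N \<inter> V. exp (q b * (exp (a b) - 1)))
          = exp (\<Sum>b'\<in>{b'\<in>V. E b b'}. q b' * (exp (a b') - 1))"
        using fin by (subst exp_sum) (auto simp: N_def intro!: prod.cong)
      finally show ?thesis by simp
    qed
    also have "\<dots> \<le> P * exp (a b)"
      using a[OF b(2)] P0 by (simp add: exp_add[symmetric] mult.left_commute mult_left_mono)
    finally have opened: "(\<Sum>S\<in>Pow U. bernoulli_weight q U S * exp (sum m (cluster E (insert b S) A)))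
        \<le> P * exp (a b)" .
    have "(\<Sum>S\<in>Pow V. bernoulli_weight q V S * exp (sum m (cluster E S A)))
       \<le> (1 - q b) * P + q b * (P * exp (a b))"
      unfolding sum_bernoulli_split[OF fin b(2), of q "\<lambda>S. exp (sum m (cluster E S A))"]
      using q[OF b(2)] closed opened unfolding U_def
      by (intro add_mono mult_left_mono) auto
    \<comment> \<open>Averaging over the state of \<open>b\<close> gives exactly the missing factor
      of the seed \<open>b\<close>.\<close>
    also have "\<dots> = (1 + q b * (exp (a b) - 1)) * P" by (simp add: algebra_simps)
    also have "\<dots> = (\<Prod>b\<in>insert b ((A - {b}) \<inter> U). 1 + q b * (exp (a b) - 1))"
      unfolding P_def using fU by (subst prod.insert) (auto simp: U_def)
    also have "insert b ((A - {b}) \<inter> U) = A \<inter> V" using b by (auto simp: U_def)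
    finally show ?thesis .
  qed
qed

section \<open>Poisson samples\<close>

locale poisson_sample = prob_space D for D :: "'a measure" +
  fixes c :: real
  assumes c_pos: "0 < c"
begin

text \<open>One space for all numbers of points: an infinite i.i.d. sequence of which only the first
  \<open>fst \<omega>\<close> entries count. Events can then be combined without fixing the number
  of points; \<open>prob_sample_space\<close> leads back to the series over that number.\<close>

definition sample_space :: "(nat \<times> (nat \<Rightarrow> 'a)) measure" ("\<Omega>") where
  "\<Omega> = measure_pmf (poisson_pmf c) \<Otimes>\<^sub>M PiM UNIV (\<lambda>_::nat. D)"

definition occupied :: "'a set \<Rightarrow> nat \<times> (nat \<Rightarrow> 'a) \<Rightarrow> bool" where
  "occupied B \<omega> \<longleftrightarrow> (\<exists>i<fst \<omega>. snd \<omega> i \<in> B)"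

definition count_in :: "'a set \<Rightarrow> nat \<times> (nat \<Rightarrow> 'a) \<Rightarrow> nat" where
  "count_in B \<omega> = card {i. i < fst \<omega> \<and> snd \<omega> i \<in> B}"

sublocale seq: product_prob_space "\<lambda>_. D" "UNIV :: nat set"
  by unfold_locales

sublocale sample: pair_prob_space "measure_pmf (poisson_pmf c)" "PiM UNIV (\<lambda>_::nat. D)"
  by unfold_locales

sublocale Om: prob_space \<Omega>
  unfolding sample_space_def by unfold_locales

lemma sets_sample_space [measurable_cong]:
  "sets \<Omega> = sets (count_space UNIV \<Otimes>\<^sub>M PiM UNIV (\<lambda>_::nat. D))"
  unfolding sample_space_def by (intro sets_pair_measure_cong) auto

lemma sample_measurable:
  assumes "\<And>k. f k \<in> measurable (PiM UNIV (\<lambda>_::nat. D)) N"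
  shows "(\<lambda>\<omega>. f (fst \<omega>) (snd \<omega>)) \<in> measurable \<Omega> N"
proof -
  have "(\<lambda>\<omega>. f (fst \<omega>) (snd \<omega>)) \<in> measurable (count_space UNIV \<Otimes>\<^sub>M PiM UNIV (\<lambda>_::nat. D)) N"
    using assms by (intro measurable_pair_measure_countable1) auto
  then show ?thesis using measurable_cong_sets[OF sets_sample_space refl] by blast
qed

lemma measurable_occupied [measurable]:
  assumes [measurable]: "B \<in> sets D"
  shows "Measurable.pred \<Omega> (occupied B)"
proof -
  have "Measurable.pred (PiM UNIV (\<lambda>_::nat. D)) (\<lambda>x. \<exists>i<k. x i \<in> B)" for k
    by measurable
  from sample_measurable[OF this] show ?thesis
    by (simp add: occupied_def[abs_def] comp_def split_def)
qed

lemma measurable_count_in [measurable]: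
  assumes [measurable]: "B \<in> sets D"
  shows "count_in B \<in> measurable \<Omega> (count_space UNIV)"
proof -
  have "(\<lambda>x. card {i. i < k \<and> x i \<in> B}) \<in> measurable (PiM UNIV (\<lambda>_::nat. D)) (count_space UNIV)" for k
    by measurable
  from sample_measurable[OF this] show ?thesis
    by (simp add: count_in_def[abs_def] comp_def split_def)
qed

lemma nn_integral_prefix_product:
  assumes [measurable]: "g \<in> borel_measurable D"
  shows "(\<integral>\<^sup>+x. (\<Prod>i<k. g (x i)) \<partial>PiM UNIV (\<lambda>_::nat. D)) = (\<integral>\<^sup>+p. g p \<partial>D) ^ k"
proof -
  have "(\<integral>\<^sup>+x. (\<Prod>i<k. g (x i)) \<partial>PiM {..<k} (\<lambda>_. D))
     = (\<integral>\<^sup>+x. (\<Prod>i<k. g (x i)) \<partial>distr (PiM UNIV (\<lambda>_. D)) (PiM {..<k} (\<lambda>_. D)) (\<lambda>x. restrict x {..<k}))"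
    using seq.distr_PiM_restrict_finite[of "{..<k}"] by simp
  also have "\<dots> = (\<integral>\<^sup>+x. (\<Prod>i<k. g (restrict x {..<k} i)) \<partial>PiM UNIV (\<lambda>_. D))"
    by (rule nn_integral_distr) (auto intro!: measurable_restrict_subset)
  also have "\<dots> = (\<integral>\<^sup>+x. (\<Prod>i<k. g (x i)) \<partial>PiM UNIV (\<lambda>_. D))"
    by (intro nn_integral_cong prod.cong) auto
  finally show ?thesis
    by (subst (asm) seq.product_nn_integral_prod) auto
qed

text \<open>Given \<open>k\<close> points the mean is \<open>t ^ k\<close>, and the Poisson weights
  sum to an exponential series. Two choices of \<open>g\<close> are used: the indicator of a
  complement for void probabilities, and 1 plus an indicator for the tails of counts.\<close>

lemma laplace_functional:
  assumes [measurable]: "g \<in> borel_measurable D"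
    and t: "(\<integral>\<^sup>+p. g p \<partial>D) = ennreal t" "0 \<le> t"
  shows "(\<integral>\<^sup>+\<omega>. (\<Prod>i<fst \<omega>. g (snd \<omega> i)) \<partial>\<Omega>) = ennreal (exp (c * (t - 1)))"
proof -
  have meas: "(\<lambda>\<omega>. (\<Prod>i<fst \<omega>. g (snd \<omega> i))) \<in> borel_measurable \<Omega>"
    by (rule sample_measurable) measurable
  have "(\<integral>\<^sup>+\<omega>. (\<Prod>i<fst \<omega>. g (snd \<omega> i)) \<partial>\<Omega>)
     = (\<integral>\<^sup>+k. (\<integral>\<^sup>+x. (\<Prod>i<k. g (x i)) \<partial>PiM UNIV (\<lambda>_::nat. D)) \<partial>measure_pmf (poisson_pmf c))"
    unfolding sample_space_def
    by (subst seq.P.nn_integral_fst[symmetric]) (use meas in \<open>simp_all add: sample_space_def\<close>)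
  also have "\<dots> = (\<integral>\<^sup>+k. ennreal (t ^ k) \<partial>measure_pmf (poisson_pmf c))"
    by (simp add: nn_integral_prefix_product t ennreal_power)
  also have "\<dots> = (\<integral>\<^sup>+k. ennreal (exp (-c) * ((c * t) ^ k /\<^sub>R fact k)) \<partial>count_space UNIV)"
    unfolding nn_integral_measure_pmf using c_pos t(2)
    by (intro nn_integral_cong)
      (simp add: ennreal_mult'[symmetric] power_mult_distrib divide_inverse mult_ac)
  also have "\<dots> = (\<Sum>k. ennreal (exp (-c) * ((c * t) ^ k /\<^sub>R fact k)))"
    by (rule nn_integral_count_space_nat)
  also have "\<dots> = ennreal (exp (-c) * exp (c * t))"
    using c_pos t(2) by (intro suminf_ennreal_eq sums_mult exp_converges) auto
  finally show ?thesis
    by (simp add: exp_add[symmetric] algebra_simps)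
qed

lemma prob_not_occupied:
  assumes [measurable]: "B \<in> sets D"
  shows "Om.prob {\<omega>\<in>space \<Omega>. \<not> occupied B \<omega>} = exp (- c * prob B)"
proof -
  let ?g = "indicator (space D - B) :: 'a \<Rightarrow> ennreal"
  have "(\<integral>\<^sup>+p. ?g p \<partial>D) = ennreal (1 - prob B)"
    by (simp add: emeasure_eq_measure prob_compl)
  from laplace_functional[OF _ this]
  have L: "(\<integral>\<^sup>+\<omega>. (\<Prod>i<fst \<omega>. ?g (snd \<omega> i)) \<partial>\<Omega>) = ennreal (exp (- c * prob B))"
    by simp
  have "(\<integral>\<^sup>+\<omega>. (\<Prod>i<fst \<omega>. ?g (snd \<omega> i)) \<partial>\<Omega>)
    = (\<integral>\<^sup>+\<omega>. indicator {\<omega>\<in>space \<Omega>. \<not> occupied B \<omega>} \<omega> \<partial>\<Omega>)"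
  proof (intro nn_integral_cong)
    fix \<omega> assume w: "\<omega> \<in> space \<Omega>"
    then have "snd \<omega> i \<in> space D" for i
      by (auto simp: sample_space_def space_pair_measure space_PiM PiE_def Pi_def)
    then show "(\<Prod>i<fst \<omega>. ?g (snd \<omega> i)) = indicator {\<omega>\<in>space \<Omega>. \<not> occupied B \<omega>} \<omega>"
      using w by (auto simp: occupied_def indicator_def)
  qed
  also have "\<dots> = ennreal (Om.prob {\<omega>\<in>space \<Omega>. \<not> occupied B \<omega>})"
    by (simp add: Om.emeasure_eq_measure)
  finally show ?thesis using L by simp
qed

lemma prob_occupied:
  assumes [measurable]: "B \<in> sets D"
  shows "Om.prob {\<omega>\<in>space \<Omega>. occupied B \<omega>} = 1 - exp (- c * prob B)"
proof -
  have "{\<omega>\<in>space \<Omega>. occupied B \<omega>} = space \<Omega> - {\<omega>\<in>space \<Omega>. \<not> occupied B \<omega>}" by auto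
  then show ?thesis using Om.prob_compl[of "{\<omega>\<in>space \<Omega>. \<not> occupied B \<omega>}"]
    by (simp add: prob_not_occupied)
qed

lemma prob_occupied_le:
  assumes "B \<in> sets D"
  shows "Om.prob {\<omega>\<in>space \<Omega>. occupied B \<omega>} \<le> c * prob B"
  using prob_occupied[OF assms] exp_ge_add_one_self[of "- c * prob B"] by simp

text \<open>Markov's inequality for \<open>2 ^ count_in B \<omega>\<close>, whose mean is
  \<open>exp (c * prob B)\<close>.\<close>

lemma prob_count_in_ge:
  assumes [measurable]: "B \<in> sets D"
  shows "Om.prob {\<omega>\<in>space \<Omega>. k \<le> count_in B \<omega>} \<le> exp (c * prob B) / 2 ^ k"
proof -
  let ?g = "\<lambda>p. 1 + indicator B p :: ennreal"
  have "(\<integral>\<^sup>+p. ?g p \<partial>D) = ennreal (1 + prob B)"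
    by (simp add: nn_integral_add emeasure_eq_measure prob_space)
  from laplace_functional[OF _ this]
  have L: "(\<integral>\<^sup>+\<omega>. (\<Prod>i<fst \<omega>. ?g (snd \<omega> i)) \<partial>\<Omega>) = ennreal (exp (c * prob B))"
    by simp
  have eq: "(\<Prod>i<fst \<omega>. ?g (snd \<omega> i)) = 2 ^ count_in B \<omega>" for \<omega> :: "nat \<times> (nat \<Rightarrow> 'a)"
  proof -
    have "(\<Prod>i<fst \<omega>. ?g (snd \<omega> i)) = (\<Prod>i<fst \<omega>. if snd \<omega> i \<in> B then 2 else 1)"
      by (intro prod.cong) (auto simp: one_add_one)
    also have "\<dots> = (\<Prod>i\<in>{..<fst \<omega>} \<inter> {i. snd \<omega> i \<in> B}. 2)"
      by (simp add: prod.If_cases)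
    also have "{..<fst \<omega>} \<inter> {i. snd \<omega> i \<in> B} = {i. i < fst \<omega> \<and> snd \<omega> i \<in> B}" by auto
    finally show ?thesis by (simp add: count_in_def)
  qed
  have "ennreal (2 ^ k * Om.prob {\<omega>\<in>space \<Omega>. k \<le> count_in B \<omega>})
     = (\<integral>\<^sup>+\<omega>. 2 ^ k * indicator {\<omega>\<in>space \<Omega>. k \<le> count_in B \<omega>} \<omega> \<partial>\<Omega>)"
    by (subst nn_integral_cmult_indicator)
      (auto simp: Om.emeasure_eq_measure ennreal_mult' ennreal_power[symmetric])
  also have "\<dots> \<le> (\<integral>\<^sup>+\<omega>. (\<Prod>i<fst \<omega>. ?g (snd \<omega> i)) \<partial>\<Omega>)"
    unfolding eq by (intro nn_integral_mono)
      (auto simp: indicator_def intro!: power_increasing)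
  finally show ?thesis unfolding L
    by (simp add: field_simps)
qed

section \<open>Independence over disjoint regions\<close>

lemma occupation_pattern_event:
  assumes "finite S" "finite T"
    and "\<And>b. b \<in> S \<union> T \<Longrightarrow> B b \<in> sets D"
  shows "{\<omega>\<in>space \<Omega>. (\<forall>b\<in>S. occupied (B b) \<omega>) \<and> (\<forall>b\<in>T. \<not> occupied (B b) \<omega>)} \<in> Om.events"
proof -
  have "{\<omega>\<in>space \<Omega>. occupied (B b) \<omega>} \<in> Om.events" if "b \<in> S \<union> T" for b
    using measurable_occupied[OF assms(3)[OF that]] by (simp add: pred_def)
  then show ?thesis using assms
    by (intro sets.sets_Collect_conj sets.sets_Collect_finite_All sets.sets_Collect_neg) auto
qed

text \<open>Independence follows from void probabilities alone: for no occupied set the event says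
  that a disjoint union is empty, and occupied sets are then added one at a time by
  inclusion-exclusion.\<close>

lemma prob_occupation_pattern:
  assumes "finite S" "finite T" "S \<inter> T = {}"
    and [measurable]: "\<And>b. b \<in> S \<union> T \<Longrightarrow> B b \<in> sets D"
    and disj: "disjoint_family_on B (S \<union> T)"
  shows "Om.prob {\<omega>\<in>space \<Omega>. (\<forall>b\<in>S. occupied (B b) \<omega>) \<and> (\<forall>b\<in>T. \<not> occupied (B b) \<omega>)}
    = (\<Prod>b\<in>S. 1 - exp (- c * prob (B b))) * (\<Prod>b\<in>T. exp (- c * prob (B b)))"
  using assms
proof (induction S arbitrary: T)
  case empty
  have "occupied (\<Union>b\<in>T. B b) \<omega> \<longleftrightarrow> (\<exists>b\<in>T. occupied (B b) \<omega>)" for \<omega>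
    by (auto simp: occupied_def)
  moreover have "prob (\<Union>b\<in>T. B b) = (\<Sum>b\<in>T. prob (B b))"
    using empty by (intro finite_measure_finite_Union) auto
  moreover have "(\<Union>b\<in>T. B b) \<in> sets D"
    using empty by (intro sets.finite_UN) auto
  ultimately show ?case
    using prob_not_occupied[of "\<Union>b\<in>T. B b"] empty
    by (simp add: sum_distrib_left exp_sum sum_negf[symmetric])
next
  case (insert b S)
  let ?ev = "\<lambda>S T. {\<omega>\<in>space \<Omega>. (\<forall>b\<in>S. occupied (B b) \<omega>) \<and> (\<forall>b\<in>T. \<not> occupied (B b) \<omega>)}"
  have b: "b \<notin> T" "insert b S \<union> T = S \<union> insert b T" using insert by auto
  have meas: "?ev S' T' \<in> Om.events" if "S' \<subseteq> insert b S \<union> T" "T' \<subseteq> insert b S \<union> T" for S' T'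
  proof -
    have "finite S'" "finite T'" using that insert by (meson finite.insertI finite_UnI finite_subset)+
    moreover have "B c \<in> sets D" if "c \<in> S' \<union> T'" for c
      using that \<open>S' \<subseteq> _\<close> \<open>T' \<subseteq> _\<close> by (intro insert.prems(3)) blast
    ultimately show ?thesis by (rule occupation_pattern_event)
  qed
  \<comment> \<open>The wanted probability is a difference of two known ones: \<open>b\<close> left
    free, and \<open>b\<close> required to be empty.\<close>
  have "?ev S T = ?ev (insert b S) T \<union> ?ev S (insert b T)" by auto
  then have "Om.prob (?ev S T) = Om.prob (?ev (insert b S) T) + Om.prob (?ev S (insert b T))"
    by (simp only:) (intro Om.finite_measure_Union meas; auto)
  moreover have "Om.prob (?ev S T)
     = (\<Prod>b\<in>S. 1 - exp (- c * prob (B b))) * (\<Prod>b\<in>T. exp (- c * prob (B b)))"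
    using insert by (intro insert.IH) (auto simp: disjoint_family_on_def)
  moreover have "Om.prob (?ev S (insert b T))
     = (\<Prod>b\<in>S. 1 - exp (- c * prob (B b))) * (\<Prod>b\<in>insert b T. exp (- c * prob (B b)))"
    using insert b by (intro insert.IH) auto
  ultimately show ?case using insert b by (simp add: algebra_simps)
qed

text \<open>Chernoff's bound for the percolation of occupied boxes. Since 1 - exp (- x) <= x, the
  hypothesis can be stated with mean numbers of points in place of occupation probabilities.\<close>

lemma prob_cluster_sum_ge:
  fixes m a :: "'b \<Rightarrow> real" and B :: "'b \<Rightarrow> 'a set"
  assumes fin: "finite V" and B: "\<And>b. b \<in> V \<Longrightarrow> B b \<in> sets D"
    and disj: "disjoint_family_on B V"
    and a0: "\<And>b. b \<in> V \<Longrightarrow> 0 \<le> a b" and m: "\<And>b. b \<in> V \<Longrightarrow> 0 \<le> m b"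
    and a: "\<And>b. b \<in> V \<Longrightarrow> m b + (\<Sum>b'\<in>{b'\<in>V. E b b'}. c * prob (B b') * (exp (a b') - 1)) \<le> a b"
    and b0: "b0 \<in> V"
  shows "Om.prob {\<omega>\<in>space \<Omega>. s \<le> sum m (cluster E {b\<in>V. occupied (B b) \<omega>} {b0})} \<le> exp (a b0 - s)"
    and "{\<omega>\<in>space \<Omega>. s \<le> sum m (cluster E {b\<in>V. occupied (B b) \<omega>} {b0})} \<in> Om.events"
proof -
  define q where "q = (\<lambda>b. 1 - exp (- c * prob (B b)))"
  have q: "0 \<le> q b \<and> q b \<le> 1" for b using c_pos by (auto simp: q_def)
  have q_le: "q b \<le> c * prob (B b)" for b
    using exp_ge_add_one_self[of "- c * prob (B b)"] by (simp add: q_def)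
  let ?occ = "\<lambda>\<omega>. {b\<in>V. occupied (B b) \<omega>}"
  have ev_eq: "{\<omega>\<in>space \<Omega>. ?occ \<omega> = S}
      = {\<omega>\<in>space \<Omega>. (\<forall>b\<in>S. occupied (B b) \<omega>) \<and> (\<forall>b\<in>V - S. \<not> occupied (B b) \<omega>)}"
    if "S \<in> Pow V" for S using that by auto
  have ev_meas: "{\<omega>\<in>space \<Omega>. ?occ \<omega> = S} \<in> Om.events" if S: "S \<in> Pow V" for S
    unfolding ev_eq[OF S] using S fin B finite_subset[of S V]
    by (intro occupation_pattern_event) auto
  have ev_prob: "Om.prob {\<omega>\<in>space \<Omega>. ?occ \<omega> = S} = bernoulli_weight q V S" if S: "S \<in> Pow V" for S
  proof -
    have V: "S \<union> (V - S) = V" using S by auto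
    show ?thesis unfolding ev_eq[OF S]
      using S fin B disj finite_subset[of S V] V
      by (subst prob_occupation_pattern) (auto simp: bernoulli_weight_def q_def)
  qed
  \<comment> \<open>Only finitely many occupation patterns exist, so the event is a finite disjoint
    union of pattern events.\<close>
  let ?T = "{S \<in> Pow V. s \<le> sum m (cluster E S {b0})}"
  have ev: "{\<omega>\<in>space \<Omega>. s \<le> sum m (cluster E (?occ \<omega>) {b0})}
     = (\<Union>S\<in>?T. {\<omega>\<in>space \<Omega>. ?occ \<omega> = S})" by auto
  show "{\<omega>\<in>space \<Omega>. s \<le> sum m (cluster E (?occ \<omega>) {b0})} \<in> Om.events"
    unfolding ev using fin ev_meas by (intro sets.finite_UN) auto
  have w0: "0 \<le> bernoulli_weight q V S" if "S \<in> Pow V" for S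
    using that q by (intro bernoulli_weight_nonneg) auto
  have "Om.prob {\<omega>\<in>space \<Omega>. s \<le> sum m (cluster E (?occ \<omega>) {b0})}
     = (\<Sum>S\<in>?T. bernoulli_weight q V S)"
  proof -
    have "Om.prob (\<Union>S\<in>?T. {\<omega>\<in>space \<Omega>. ?occ \<omega> = S}) = (\<Sum>S\<in>?T. Om.prob {\<omega>\<in>space \<Omega>. ?occ \<omega> = S})"
      using fin ev_meas
      by (intro Om.finite_measure_finite_Union) (auto simp: disjoint_family_on_def image_subset_iff)
    also have "\<dots> = (\<Sum>S\<in>?T. bernoulli_weight q V S)"
      by (intro sum.cong) (auto simp: ev_prob)
    finally show ?thesis unfolding ev .
  qed
  also have "\<dots> \<le> (\<Sum>S\<in>?T. bernoulli_weight q V S * exp (sum m (cluster E S {b0}) - s))"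
  proof (intro sum_mono)
    fix S assume "S \<in> ?T"
    then have "1 \<le> exp (sum m (cluster E S {b0}) - s)" "0 \<le> bernoulli_weight q V S"
      using w0 by auto
    then show "bernoulli_weight q V S \<le> bernoulli_weight q V S * exp (sum m (cluster E S {b0}) - s)"
      by (metis mult_left_mono mult.right_neutral)
  qed
  also have "\<dots> \<le> (\<Sum>S\<in>Pow V. bernoulli_weight q V S * exp (sum m (cluster E S {b0}) - s))"
    using fin w0 by (intro sum_mono2) auto
  also have "\<dots> = exp (- s) * (\<Sum>S\<in>Pow V. bernoulli_weight q V S * exp (sum m (cluster E S {b0})))"
    by (simp add: sum_distrib_left exp_diff exp_minus divide_inverse mult_ac)
  also have "\<dots> \<le> exp (- s) * (\<Prod>b\<in>{b0} \<inter> V. 1 + q b * (exp (a b) - 1))"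
  proof (intro mult_left_mono percolation_exponential_moment)
    fix b assume b: "b \<in> V"
    have "(\<Sum>b'\<in>{b'\<in>V. E b b'}. q b' * (exp (a b') - 1))
       \<le> (\<Sum>b'\<in>{b'\<in>V. E b b'}. c * prob (B b') * (exp (a b') - 1))"
      using q_le a0 by (intro sum_mono mult_right_mono) auto
    then show "m b + (\<Sum>b'\<in>{b'\<in>V. E b b'}. q b' * (exp (a b') - 1)) \<le> a b"
      using a[OF b] by linarith
  qed (use fin q a0 m in auto)
  also have "(\<Prod>b\<in>{b0} \<inter> V. 1 + q b * (exp (a b) - 1)) \<le> exp (a b0)"
  proof -
    have "q b0 * (exp (a b0) - 1) \<le> 1 * (exp (a b0) - 1)"
      using q[of b0] a0[OF b0] by (intro mult_right_mono) auto
    then show ?thesis using b0 by simp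
  qed
  finally show "Om.prob {\<omega>\<in>space \<Omega>. s \<le> sum m (cluster E (?occ \<omega>) {b0})} \<le> exp (a b0 - s)"
    by (simp add: exp_add[symmetric] exp_diff mult_left_mono exp_minus field_simps)
qed

section \<open>Return to the series over the number of points\<close>

lemma emeasure_sample_space:
  assumes [measurable]: "\<And>k. Measurable.pred (PiM UNIV (\<lambda>_::nat. D)) (Q k)"
  shows "emeasure \<Omega> {\<omega>\<in>space \<Omega>. Q (fst \<omega>) (snd \<omega>)}
    = (\<Sum>k. ennreal (pmf (poisson_pmf c) k) * emeasure (PiM UNIV (\<lambda>_::nat. D)) {x\<in>space (PiM UNIV (\<lambda>_::nat. D)). Q k x})"
proof -
  let ?A = "{\<omega>\<in>space \<Omega>. Q (fst \<omega>) (snd \<omega>)}"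
  have A: "?A \<in> sets \<Omega>" using sample_measurable[OF assms] by (simp add: pred_def)
  have "emeasure \<Omega> ?A = (\<integral>\<^sup>+k. emeasure (PiM UNIV (\<lambda>_::nat. D)) (Pair k -` ?A) \<partial>measure_pmf (poisson_pmf c))"
    using A unfolding sample_space_def by (rule seq.P.emeasure_pair_measure_alt)
  also have "\<dots> = (\<integral>\<^sup>+k. emeasure (PiM UNIV (\<lambda>_::nat. D)) {x\<in>space (PiM UNIV (\<lambda>_::nat. D)). Q k x} \<partial>measure_pmf (poisson_pmf c))"
    by (intro nn_integral_cong arg_cong2[where f=emeasure])
      (auto simp: sample_space_def space_pair_measure)
  finally show ?thesis
    by (simp add: nn_integral_measure_pmf nn_integral_count_space_nat)
qed

text \<open>By \<open>local\<close> the event for \<open>k\<close> points depends on the first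
  \<open>k\<close> entries only, so it is the preimage under restriction of an event of the finite
  product. The right side is the series by which \<open>poi_prob\<close> is defined.\<close>

lemma prob_sample_space:
  assumes meas: "\<And>k. {x\<in>space (PiM {..<k} (\<lambda>_. D)). Q k x} \<in> sets (PiM {..<k} (\<lambda>_. D))"
    and local: "\<And>k x. Q k (restrict x {..<k}) \<longleftrightarrow> Q k x"
  shows "Om.prob {\<omega>\<in>space \<Omega>. Q (fst \<omega>) (snd \<omega>)}
    = (\<Sum>k. (c ^ k / fact k * exp (- c)) * measure (PiM {..<k} (\<lambda>_. D)) {x\<in>space (PiM {..<k} (\<lambda>_. D)). Q k x})"
    and "{\<omega>\<in>space \<Omega>. Q (fst \<omega>) (snd \<omega>)} \<in> Om.events"
proof -
  let ?P = "PiM UNIV (\<lambda>_::nat. D)"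
  let ?p = "\<lambda>k. measure (PiM {..<k} (\<lambda>_. D)) {x\<in>space (PiM {..<k} (\<lambda>_. D)). Q k x}"
  have rm: "(\<lambda>x. restrict x {..<k}) \<in> measurable ?P (PiM {..<k} (\<lambda>_. D))" for k
    by (auto intro!: measurable_restrict_subset)
  have vim: "(\<lambda>x. restrict x {..<k}) -` {x\<in>space (PiM {..<k} (\<lambda>_. D)). Q k x} \<inter> space ?P
     = {x\<in>space ?P. Q k x}" for k
    using measurable_space[OF rm[of k]] local by auto
  have pm: "Measurable.pred ?P (Q k)" for k
    using measurable_sets[OF rm[of k] meas[of k]] unfolding vim by (simp add: pred_def)
  from sample_measurable[OF this] show "{\<omega>\<in>space \<Omega>. Q (fst \<omega>) (snd \<omega>)} \<in> Om.events"
    by (simp add: pred_def)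
  have fin: "prob_space (PiM {..<k} (\<lambda>_. D))" for k
    by (intro prob_space_PiM) unfold_locales
  have eq: "emeasure ?P {x\<in>space ?P. Q k x} = ennreal (?p k)" for k
  proof -
    have "ennreal (?p k) = emeasure (distr ?P (PiM {..<k} (\<lambda>_. D)) (\<lambda>x. restrict x {..<k}))
      {x\<in>space (PiM {..<k} (\<lambda>_. D)). Q k x}"
      using seq.distr_PiM_restrict_finite[of "{..<k}"] fin[of k]
      by (simp add: finite_measure.emeasure_eq_measure prob_space_def)
    also have "\<dots> = emeasure ?P {x\<in>space ?P. Q k x}"
      by (subst emeasure_distr[OF rm meas]) (simp only: vim)
    finally show ?thesis by simp
  qed
  let ?t = "\<lambda>k. (c ^ k / fact k * exp (- c)) * ?p k"
  have t0: "0 \<le> ?t k" for k using c_pos by simp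
  have "summable (\<lambda>k. c ^ k /\<^sub>R fact k * exp (- c))"
    using exp_converges[of c] by (intro summable_mult2) (auto simp: sums_iff)
  then have sm: "summable ?t"
  proof (rule summable_comparison_test_ev[rotated], intro always_eventually allI)
    fix k
    have "?p k \<le> 1" using fin by (rule prob_space.prob_le_1)
    then have "?t k \<le> (c ^ k / fact k * exp (- c)) * 1"
      using c_pos by (intro mult_left_mono) auto
    then show "norm (?t k) \<le> c ^ k /\<^sub>R fact k * exp (- c)"
      using t0[of k] by (simp add: divide_inverse mult_ac)
  qed
  have "ennreal (Om.prob {\<omega>\<in>space \<Omega>. Q (fst \<omega>) (snd \<omega>)}) = (\<Sum>k. ennreal (?t k))"
    using emeasure_sample_space[OF pm] c_pos
    by (simp add: eq Om.emeasure_eq_measure ennreal_mult'[symmetric])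
  also have "\<dots> = ennreal (suminf ?t)"
    using t0 sm by (rule suminf_ennreal2)
  finally show "Om.prob {\<omega>\<in>space \<Omega>. Q (fst \<omega>) (snd \<omega>)} = suminf ?t"
    using t0 sm by (simp add: suminf_nonneg)
qed

end

section \<open>Components of weighted graphs on a line\<close>

lemma card_nat_near:
  fixes y r :: real
  assumes "0 \<le> r"
  shows "finite {c::nat. \<bar>real c - y\<bar> \<le> r}" "real (card {c::nat. \<bar>real c - y\<bar> \<le> r}) \<le> 2 * r + 1"
proof -
  let ?S = "{c::nat. \<bar>real c - y\<bar> \<le> r}" and ?I = "{\<lceil>y - r\<rceil>..\<lfloor>y + r\<rfloor>}"
  have sub: "int ` ?S \<subseteq> ?I"
    by (auto simp: abs_le_iff le_floor_iff ceiling_le_iff)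
  have fin: "finite (int ` ?S)" using sub by (rule finite_subset) simp
  show "finite ?S" using fin by (rule finite_imageD) simp
  have "card ?S = card (int ` ?S)" by (simp add: card_image)
  also have "\<dots> \<le> card ?I" using sub by (intro card_mono) auto
  finally have "card ?S \<le> nat (\<lfloor>y + r\<rfloor> - \<lceil>y - r\<rceil> + 1)" by simp
  moreover have "\<lceil>y - r\<rceil> \<le> \<lfloor>y + r\<rfloor> + 1" using assms by linarith
  ultimately have "real (card ?S) \<le> real_of_int (\<lfloor>y + r\<rfloor> - \<lceil>y - r\<rceil> + 1)" by linarith
  also have "\<dots> \<le> 2 * r + 1" by linarith
  finally show "real (card ?S) \<le> 2 * r + 1" .
qed

lemma rtranclp_crossing:
  fixes X :: "'b \<Rightarrow> real"
  assumes "R\<^sup>*\<^sup>* u v" "X u < x" "x \<le> X v"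
  shows "\<exists>p q. R p q \<and> X p < x \<and> x \<le> X q"
  using assms
proof induction
  case (step y z)
  then show ?case by (cases "x \<le> X y") force+
qed simp

text \<open>A site is a pair of a unit cell and a dyadic weight level. This is the relation |X - X'|
  <= w w' after rounding; \<open>r\<close> collects H^2 and all rounding losses.\<close>

definition near_site :: "real \<Rightarrow> nat \<times> nat \<Rightarrow> nat \<times> nat \<Rightarrow> bool" where
  "near_site r b b' \<longleftrightarrow> \<bar>real (fst b) - real (fst b')\<bar> \<le> r * 2 ^ snd b * 2 ^ snd b'"

text \<open>The carrier is left polymorphic: it is the space of points in the probabilistic part and
  the set of vertex indices in the deterministic part.\<close>

definition site :: "('a \<Rightarrow> real) \<Rightarrow> ('a \<Rightarrow> real) \<Rightarrow> real \<Rightarrow> nat \<times> nat \<Rightarrow> 'a set" where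
  "site X w H b = {p. real (fst b) \<le> X p \<and> X p < real (fst b) + 1 \<and>
      H * 2 ^ snd b \<le> w p \<and> w p < H * 2 ^ Suc (snd b)}"

lemma dyadic_level:
  fixes H w :: real
  assumes "H \<le> w" "w < H * 2 ^ J" "0 < H"
  shows "\<exists>j<J. H * 2 ^ j \<le> w \<and> w < H * 2 ^ Suc j"
proof -
  define j where "j = (LEAST j. w < H * 2 ^ Suc j)"
  have J: "J \<noteq> 0" using assms by (cases J) auto
  then have ex: "w < H * 2 ^ Suc (J - 1)" using assms by simp
  have 1: "w < H * 2 ^ Suc j" unfolding j_def using ex by (rule LeastI)
  have 2: "j \<le> J - 1" unfolding j_def using ex by (rule Least_le)
  have "H * 2 ^ j \<le> w"
  proof (cases j)
    case (Suc i)
    then have "i < (LEAST j. w < H * 2 ^ Suc j)" by (simp add: j_def[symmetric] del: power_Suc)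
    then have "\<not> w < H * 2 ^ Suc i" by (rule not_less_Least)
    then show ?thesis using Suc by simp
  qed (use assms in simp)
  then show ?thesis using 1 2 J by (intro exI[of _ j]) auto
qed

lemma site_exists:
  assumes "0 \<le> X p" "X p < real K" "H \<le> w p" "w p < H * 2 ^ J" "0 < H"
  shows "\<exists>b\<in>{..<K} \<times> {..<J}. p \<in> site X w H b"
proof -
  obtain j where j: "j < J" "H * 2 ^ j \<le> w p" "w p < H * 2 ^ Suc j"
    using dyadic_level assms(3-5) by blast
  have "real (nat \<lfloor>X p\<rfloor>) \<le> X p" "X p < real (nat \<lfloor>X p\<rfloor>) + 1" "nat \<lfloor>X p\<rfloor> < K"
    using assms(1,2) by linarith+
  then show ?thesis using j by (intro bexI[of _ "(nat \<lfloor>X p\<rfloor>, j)"]) (auto simp: site_def)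
qed

text \<open>The deterministic properties of a good sample. Among any \<open>M\<close> consecutive
  candidates 3 H^2 i one is a cut for light vertices; no cell is crowded; every cluster of occupied
  sites has total weight at most \<open>s\<close>. The constant 37 is computed in
  \<open>near_site_of_points\<close>.\<close>

locale weighted_graph =
  fixes X w :: "nat \<Rightarrow> real" and k :: nat and adj :: "nat \<Rightarrow> nat \<Rightarrow> bool"
    and H :: real and M K J m :: nat and s :: real
  assumes range: "\<And>i. i < k \<Longrightarrow> 0 \<le> X i \<and> X i < real K \<and> 1 \<le> w i \<and> w i < H * 2 ^ J"
    and adj: "\<And>i j. adj i j \<Longrightarrow> i < k \<and> j < k \<and> \<bar>X i - X j\<bar> \<le> w i * w j"
    and adj_sym: "\<And>i j. adj i j \<Longrightarrow> adj j i"
    and H1: "1 \<le> H" and M1: "1 \<le> M" and s: "H \<le> s"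
    and cut: "\<And>i0. i0 < K \<Longrightarrow> \<exists>i\<in>{i0..<i0 + M}. \<forall>v<k.
        \<not> (\<bar>X v - 3 * H\<^sup>2 * real i\<bar> \<le> H\<^sup>2 \<and> \<bar>X v - 3 * H\<^sup>2 * real i\<bar> \<le> (w v)\<^sup>2)"
    and cells: "\<And>c. c < K \<Longrightarrow> card {v. v < k \<and> real c \<le> X v \<and> X v < real c + 1} \<le> m"
    and heavy: "\<And>b0. b0 \<in> {..<K} \<times> {..<J} \<Longrightarrow>
        (\<Sum>b\<in>cluster (near_site (37 * M * H\<^sup>2))
           {b\<in>{..<K} \<times> {..<J}. \<exists>v<k. v \<in> site X w H b} {b0}. H * 2 ^ snd b) \<le> s"
begin

section \<open>Paths through light vertices\<close>

definition light_adj :: "nat \<Rightarrow> nat \<Rightarrow> bool" where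
  "light_adj i j \<longleftrightarrow> adj i j \<and> w i < H \<and> w j < H"

lemma light_adj_sym: "light_adj i j \<Longrightarrow> light_adj j i"
  using adj_sym by (auto simp: light_adj_def)

lemma light_path_vertex: "light_adj\<^sup>*\<^sup>* u v \<Longrightarrow> u < k \<Longrightarrow> v < k"
  by (induction rule: rtranclp_induct) (use adj in \<open>auto simp: light_adj_def\<close>)

text \<open>A light edge is no longer than H^2, so both ends lie within H^2 of \<open>x\<close>. By
  the cut property each end is farther from \<open>x\<close> than its squared weight, so the edge is
  longer than w^2 + w'^2 >= w w'.\<close>

lemma no_light_crossing:
  assumes "light_adj p q" "X p < x" "x \<le> X q"
    and cutx: "\<And>v. v < k \<Longrightarrow> \<not> (\<bar>X v - x\<bar> \<le> H\<^sup>2 \<and> \<bar>X v - x\<bar> \<le> (w v)\<^sup>2)"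
  shows False
proof -
  have a: "p < k" "q < k" "\<bar>X p - X q\<bar> \<le> w p * w q" "w p < H" "w q < H"
    using assms(1) adj by (auto simp: light_adj_def)
  have w1: "1 \<le> w p" "1 \<le> w q" using range a by auto
  have "w p * w q \<le> H * H" using a w1 H1 by (intro mult_mono) auto
  then have "\<bar>X p - x\<bar> \<le> H\<^sup>2" "\<bar>X q - x\<bar> \<le> H\<^sup>2"
    using a(3) assms(2,3) by (auto simp: power2_eq_square)
  then have "(w p)\<^sup>2 < x - X p" "(w q)\<^sup>2 < X q - x"
    using cutx[of p] cutx[of q] a assms(2,3) by auto
  then have "(w p)\<^sup>2 + (w q)\<^sup>2 < w p * w q" using a(3) assms(2,3) by linarith
  moreover have "0 \<le> (w p - w q)\<^sup>2" "0 \<le> w p * w q" using w1 by auto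
  ultimately show False by (simp add: power2_diff)
qed

lemma light_path_length:
  assumes "light_adj\<^sup>*\<^sup>* u v" "u < k"
  shows "X v - X u \<le> 6 * M * H\<^sup>2"
proof (rule ccontr)
  assume neg: "\<not> ?thesis"
  have v: "v < k" using assms by (rule light_path_vertex)
  have H0: "0 < H\<^sup>2" "1 \<le> H\<^sup>2" using H1 by (auto simp: one_le_power)
  define t where "t = X u / (3 * H\<^sup>2)"
  define i0 where "i0 = nat \<lfloor>t\<rfloor> + 1"
  have t0: "0 \<le> t" using range[of u] assms H0 by (auto simp: t_def)
  then have i0: "t < real i0" "real i0 \<le> t + 1"
    by (auto simp: i0_def) linarith+
  have Xu: "X u = 3 * H\<^sup>2 * t" using H0 by (simp add: t_def)
  \<comment> \<open>\<open>i0\<close> is the first candidate to the right of \<open>X u\<close>.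
    Rounding up to it costs one extra spacing 3 H^2, which the factor 6 absorbs.\<close>
  have "6 * M * H\<^sup>2 \<ge> 3 * H\<^sup>2 * (real M + 1)"
  proof -
    have "H\<^sup>2 * 1 \<le> H\<^sup>2 * real M" using M1 H0 by (intro mult_left_mono) auto
    then show ?thesis by (simp add: algebra_simps)
  qed
  then have Xv: "3 * H\<^sup>2 * (t + real M + 1) < X v" using neg Xu by (simp add: algebra_simps)
  have in_range: "X u < 3 * H\<^sup>2 * real i \<and> 3 * H\<^sup>2 * real i \<le> X v"
    if i: "i0 \<le> i" "i < i0 + M" for i
  proof -
    have "3 * H\<^sup>2 * t < 3 * H\<^sup>2 * real i" using i i0 H0 by (intro mult_strict_left_mono) auto
    moreover have "3 * H\<^sup>2 * real i \<le> 3 * H\<^sup>2 * (t + real M + 1)"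
      using i i0 H0 by (intro mult_left_mono) auto
    ultimately show ?thesis using Xu Xv by auto
  qed
  \<comment> \<open>\<open>cut\<close> speaks only of starting indices below \<open>K\<close>; as 3
    H^2 >= 1, the index is at most its position, hence at most \<open>X v < K\<close>.\<close>
  have "i0 < K"
  proof -
    have "1 * real i0 \<le> (3 * H\<^sup>2) * real i0" using H0 by (intro mult_right_mono) auto
    then have "real i0 \<le> X v" using in_range[of i0] M1 by auto
    then show ?thesis using range[OF v] by linarith
  qed
  from cut[OF this] obtain i where i: "i0 \<le> i" "i < i0 + M"
    and c: "\<And>v. v < k \<Longrightarrow> \<not> (\<bar>X v - 3 * H\<^sup>2 * real i\<bar> \<le> H\<^sup>2 \<and> \<bar>X v - 3 * H\<^sup>2 * real i\<bar> \<le> (w v)\<^sup>2)"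
    by auto
  obtain p q where "light_adj p q" "X p < 3 * H\<^sup>2 * real i" "3 * H\<^sup>2 * real i \<le> X q"
    using rtranclp_crossing[OF assms(1)] in_range[OF i] by blast
  from no_light_crossing[OF this c] show False by blast
qed

lemma light_path_dist:
  assumes "light_adj\<^sup>*\<^sup>* u v" "u < k"
  shows "\<bar>X v - X u\<bar> \<le> 6 * M * H\<^sup>2"
proof -
  have "light_adj\<^sup>*\<^sup>* v u"
    using assms(1) by (induction rule: rtranclp_induct) (auto intro: light_adj_sym converse_rtranclp_into_rtranclp)
  then show ?thesis
    using light_path_length[OF assms] light_path_length[of v u] light_path_vertex[OF assms] by auto
qed

lemma card_near:
  assumes "1 \<le> r"
  shows "real (card {v. v < k \<and> \<bar>X v - y\<bar> \<le> r}) \<le> 5 * r * m"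
proof -
  let ?C = "{c::nat. \<bar>real c - y\<bar> \<le> r + 1} \<inter> {..<K}"
  let ?cell = "\<lambda>c. {v. v < k \<and> real c \<le> X v \<and> X v < real c + 1}"
  have fC: "finite ?C" by simp
  have "{v. v < k \<and> \<bar>X v - y\<bar> \<le> r} \<subseteq> (\<Union>c\<in>?C. ?cell c)"
  proof safe
    fix v assume v: "v < k" "\<bar>X v - y\<bar> \<le> r"
    obtain c where c: "real c \<le> X v" "X v < real c + 1" "c < K"
    proof
      show "real (nat \<lfloor>X v\<rfloor>) \<le> X v" "X v < real (nat \<lfloor>X v\<rfloor>) + 1" "nat \<lfloor>X v\<rfloor> < K"
        using range[OF v(1)] by linarith+
    qed
    have "\<bar>real c - y\<bar> \<le> r + 1" using v(2) c(1,2) by (simp only: abs_le_iff) linarith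
    then have "c \<in> ?C" using c(3) by simp
    moreover have "v \<in> ?cell c" using c v(1) by simp
    ultimately show "v \<in> (\<Union>c\<in>?C. ?cell c)" by (rule UN_I)
  qed
  then have "card {v. v < k \<and> \<bar>X v - y\<bar> \<le> r} \<le> card (\<Union>c\<in>?C. ?cell c)"
    using fC by (intro card_mono) auto
  also have "\<dots> \<le> (\<Sum>c\<in>?C. card (?cell c))" by (rule card_UN_le[OF fC])
  also have "\<dots> \<le> (\<Sum>c\<in>?C. m)" using cells by (intro sum_mono) auto
  finally have "card {v. v < k \<and> \<bar>X v - y\<bar> \<le> r} \<le> card ?C * m" by simp
  then have "real (card {v. v < k \<and> \<bar>X v - y\<bar> \<le> r}) \<le> real (card ?C * m)"
    by (rule of_nat_mono)
  also have "\<dots> = real (card ?C) * real m" by simp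
  \<comment> \<open>The left end of a cell that meets the interval is within r + 1 of
    \<open>y\<close>; since r >= 1, the count 2 r + 3 is at most 5 r.\<close>
  also have "\<dots> \<le> (2 * (r + 1) + 1) * real m"
  proof (intro mult_right_mono)
    have "card ?C \<le> card {c::nat. \<bar>real c - y\<bar> \<le> r + 1}"
      using card_nat_near(1)[of "r + 1" y] assms by (intro card_mono) auto
    then show "real (card ?C) \<le> 2 * (r + 1) + 1"
      using card_nat_near(2)[of "r + 1" y] assms by linarith
  qed simp
  also have "\<dots> \<le> 5 * r * m" using assms by (intro mult_right_mono) auto
  finally show ?thesis .
qed

section \<open>Clusters of heavy vertices\<close>

abbreviation "sites \<equiv> {..<K} \<times> {..<J}"
abbreviation "occ \<equiv> {b\<in>sites. \<exists>v<k. v \<in> site X w H b}"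
abbreviation "heavy_cluster b0 \<equiv> cluster (near_site (37 * M * H\<^sup>2)) occ {b0}"

lemma heavy_site: "v < k \<Longrightarrow> H \<le> w v \<Longrightarrow> \<exists>b\<in>occ. v \<in> site X w H b"
  using site_exists[of X v K H w J] range[of v] H1 by fastforce

text \<open>Rounding both weights down costs a factor 4, which turns 9 into 36; rounding the
  positions costs at most 1, and this is absorbed by the 37th copy of a quantity that is at least
  1.\<close>

lemma near_site_of_points:
  assumes "v \<in> site X w H b" "v' \<in> site X w H b'" "\<bar>X v - X v'\<bar> \<le> 9 * M * (w v * w v')"
  shows "near_site (37 * M * H\<^sup>2) b b'"
proof -
  have w0: "0 \<le> w v" "0 \<le> w v'" using assms H1
    by (auto simp: site_def intro: order_trans[rotated])
  have "w v * w v' \<le> (H * 2 ^ Suc (snd b)) * (H * 2 ^ Suc (snd b'))"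
    using assms w0 H1 by (intro mult_mono) (auto simp: site_def)
  then have "9 * M * (w v * w v') \<le> 9 * M * ((H * 2 ^ Suc (snd b)) * (H * 2 ^ Suc (snd b')))"
    by (intro mult_left_mono) auto
  also have "\<dots> = 36 * (M * H\<^sup>2 * 2 ^ snd b * 2 ^ snd b')" by (simp add: power2_eq_square)
  finally have "\<bar>X v - X v'\<bar> \<le> 36 * (M * H\<^sup>2 * 2 ^ snd b * 2 ^ snd b')" using assms by linarith
  moreover have "\<bar>real (fst b) - real (fst b')\<bar> \<le> \<bar>X v - X v'\<bar> + 1"
    using assms(1,2) by (auto simp: site_def)
  moreover have "1 \<le> M * H\<^sup>2 * 2 ^ snd b * 2 ^ snd b'"
    using M1 H1 by (intro mult_ge1_I) (auto simp: one_le_power)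
  ultimately show ?thesis by (simp add: near_site_def)
qed

text \<open>The invariant along a path: \<open>h\<close> is the last heavy vertex visited and its
  site lies in the cluster; since then the path has made a light excursion that starts at a
  neighbour \<open>y\<close> of \<open>h\<close>.\<close>

lemma heavy_reach:
  assumes "h0 < k" "H \<le> w h0" "b0 \<in> occ" "h0 \<in> site X w H b0" "adj\<^sup>*\<^sup>* h0 u"
  shows "\<exists>h b. h < k \<and> b \<in> heavy_cluster b0 \<and> h \<in> site X w H b \<and> H \<le> w h \<and>
     (u = h \<or> (\<exists>y. adj h y \<and> w y < H \<and> light_adj\<^sup>*\<^sup>* y u \<and> w u < H))"
  using assms(5)
proof induction
  case base
  then show ?case using assms(1-4)
    by (intro exI[of _ h0] exI[of _ b0]) (auto intro!: cluster.base)
next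
  case (step u z)
  then obtain h b where h: "h < k" "b \<in> heavy_cluster b0" "h \<in> site X w H b" "H \<le> w h"
    and u: "u = h \<or> (\<exists>y. adj h y \<and> w y < H \<and> light_adj\<^sup>*\<^sup>* y u \<and> w u < H)" by blast
  have uz: "u < k" "z < k" "\<bar>X u - X z\<bar> \<le> w u * w z" using adj[OF step(2)] by auto
  show ?case
  proof (cases "w z < H")
    case True
    show ?thesis
    proof (cases "u = h")
      case True
      then show ?thesis using h step \<open>w z < H\<close> by blast
    next
      case False
      then obtain y where y: "adj h y" "w y < H" "light_adj\<^sup>*\<^sup>* y u" "w u < H" using u by blast
      then have "light_adj\<^sup>*\<^sup>* y z"
        using step(2) True by (auto simp: light_adj_def intro: rtranclp.rtrancl_into_rtrancl)
      then show ?thesis using y h True by blast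
    qed
  next
    case False
    then have z: "H \<le> w z" by simp
    have ww: "H * H \<le> w h * w z" "H * w z \<le> w h * w z" "w h * H \<le> w h * w z" "0 \<le> w h * w z"
      using z h H1 by (auto intro!: mult_mono)
    \<comment> \<open>First edge, light path and last edge contribute 1 + 6 + 1 multiples of M w w',
      because both heavy weights are at least H.\<close>
    have "\<bar>X h - X z\<bar> \<le> 8 * M * (w h * w z)"
    proof (cases "u = h")
      case True
      have "1 * (w h * w z) \<le> 8 * real M * (w h * w z)" using M1 ww by (intro mult_right_mono) auto
      then show ?thesis using True uz by auto
    next
      case False
      then obtain y where y: "adj h y" "w y < H" "light_adj\<^sup>*\<^sup>* y u" "w u < H" using u by blast
      have yk: "y < k" "\<bar>X h - X y\<bar> \<le> w h * w y" using adj[OF y(1)] by auto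
      have "w h * w y \<le> w h * H" using y h H1 by (intro mult_left_mono) auto
      moreover have "w u * w z \<le> H * w z" using y z H1 by (intro mult_right_mono) auto
      moreover have "\<bar>X u - X y\<bar> \<le> 6 * M * H\<^sup>2" using y yk by (intro light_path_dist)
      moreover have "6 * M * H\<^sup>2 \<le> 6 * M * (w h * w z)" unfolding power2_eq_square
        using ww by (intro mult_left_mono) auto
      moreover have "1 * (w h * w z) \<le> real M * (w h * w z)" using M1 ww by (intro mult_right_mono) auto
      ultimately show ?thesis using yk uz ww by linarith
    qed
    also have "\<dots> \<le> 9 * M * (w h * w z)" using ww by (intro mult_right_mono) auto
    finally have d: "\<bar>X h - X z\<bar> \<le> 9 * M * (w h * w z)" .
    obtain b' where b': "b' \<in> occ" "z \<in> site X w H b'" using heavy_site uz z by blast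
    have "b' \<in> heavy_cluster b0"
      using h(2) near_site_of_points[OF h(3) b'(2) d] b'(1) by (rule cluster.step)
    then show ?thesis using b' uz z by blast
  qed
qed

text \<open>Every vertex of the component ends a light excursion from a heavy vertex in some site of
  the cluster. The first edge, the light path and the position in the cell give the radius (2 + 6 +
  1) M H^2 2^j. By \<open>card_near\<close> each site accounts for at most 45 m M H times its weight
  H 2^j.\<close>

lemma heavy_component:
  assumes "h0 < k" "H \<le> w h0"
  shows "real (card {u. u < k \<and> adj\<^sup>*\<^sup>* h0 u}) \<le> 45 * m * M * H * s"
proof -
  obtain b0 where b0: "b0 \<in> occ" "h0 \<in> site X w H b0" using heavy_site assms by blast
  let ?C = "heavy_cluster b0" and ?r = "\<lambda>b. 9 * M * H\<^sup>2 * 2 ^ snd b"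
  have fC: "finite ?C" using cluster_subset by (rule finite_subset) auto
  have near1: "1 \<le> M * H\<^sup>2 * 2 ^ j" for j
    using M1 H1 by (intro mult_ge1_I) (auto simp: one_le_power)
  have "{u. u < k \<and> adj\<^sup>*\<^sup>* h0 u} \<subseteq> (\<Union>b\<in>?C. {u. u < k \<and> \<bar>X u - real (fst b)\<bar> \<le> ?r b})"
  proof safe
    fix u assume u: "u < k" "adj\<^sup>*\<^sup>* h0 u"
    obtain h b where h: "h < k" "b \<in> ?C" "h \<in> site X w H b" "H \<le> w h"
      and hu: "u = h \<or> (\<exists>y. adj h y \<and> w y < H \<and> light_adj\<^sup>*\<^sup>* y u \<and> w u < H)"
      using heavy_reach[OF assms b0 u(2)] by blast
    have hb: "\<bar>X h - real (fst b)\<bar> \<le> 1" "w h \<le> H * 2 ^ Suc (snd b)" using h(3) by (auto simp: site_def)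
    have MH: "0 \<le> M * H\<^sup>2" by simp
    have "\<bar>X u - X h\<bar> \<le> 8 * (M * H\<^sup>2 * 2 ^ snd b)"
    proof (cases "u = h")
      case True
      then show ?thesis by auto
    next
      case False
      then obtain y where y: "adj h y" "w y < H" "light_adj\<^sup>*\<^sup>* y u" "w u < H" using hu by blast
      have yk: "y < k" "\<bar>X h - X y\<bar> \<le> w h * w y" using adj[OF y(1)] by auto
      have "w h * w y \<le> (H * 2 ^ Suc (snd b)) * H" using y h H1 hb range[OF yk(1)]
        by (intro mult_mono) auto
      also have "\<dots> = 2 * (1 * H\<^sup>2 * 2 ^ snd b)" by (simp add: power2_eq_square)
      also have "\<dots> \<le> 2 * (M * H\<^sup>2 * 2 ^ snd b)" using M1 by (intro mult_left_mono mult_right_mono) auto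
      finally have "w h * w y \<le> 2 * (M * H\<^sup>2 * 2 ^ snd b)" .
      moreover have "\<bar>X u - X y\<bar> \<le> 6 * (M * H\<^sup>2 * 1)" using light_path_dist[OF y(3) yk(1)] by simp
      moreover have "6 * (M * H\<^sup>2 * 1) \<le> 6 * (M * H\<^sup>2 * 2 ^ snd b)"
        using MH by (intro mult_left_mono) auto
      ultimately show ?thesis using yk by linarith
    qed
    then have "\<bar>X u - real (fst b)\<bar> \<le> ?r b" using hb near1[of "snd b"] by simp
    then show "u \<in> (\<Union>b\<in>?C. {u. u < k \<and> \<bar>X u - real (fst b)\<bar> \<le> ?r b})" using h u by blast
  qed
  then have "card {u. u < k \<and> adj\<^sup>*\<^sup>* h0 u} \<le> card (\<Union>b\<in>?C. {u. u < k \<and> \<bar>X u - real (fst b)\<bar> \<le> ?r b})"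
    using fC by (intro card_mono) auto
  also have "\<dots> \<le> (\<Sum>b\<in>?C. card {u. u < k \<and> \<bar>X u - real (fst b)\<bar> \<le> ?r b})"
    by (rule card_UN_le[OF fC])
  finally have "real (card {u. u < k \<and> adj\<^sup>*\<^sup>* h0 u})
      \<le> real (\<Sum>b\<in>?C. card {u. u < k \<and> \<bar>X u - real (fst b)\<bar> \<le> ?r b})"
    by (rule of_nat_mono)
  also have "\<dots> = (\<Sum>b\<in>?C. real (card {u. u < k \<and> \<bar>X u - real (fst b)\<bar> \<le> ?r b}))"
    by (rule of_nat_sum)
  also have "\<dots> \<le> (\<Sum>b\<in>?C. 5 * ?r b * m)"
  proof (intro sum_mono card_near)
    fix b
    show "1 \<le> ?r b" using near1[of "snd b"] by simp
  qed
  also have "\<dots> = 45 * m * M * H * (\<Sum>b\<in>?C. H * 2 ^ snd b)"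
    by (simp add: sum_distrib_left power2_eq_square mult_ac)
  also have "\<dots> \<le> 45 * m * M * H * s"
    using heavy[of b0] b0 H1 by (intro mult_left_mono) auto
  finally show ?thesis .
qed

text \<open>By symmetry a component with a heavy vertex can be explored from that vertex. A
  component without one is spanned by light paths and lies within 6 M H^2 of \<open>v\<close>;
  \<open>H \<le> s\<close> brings that case under the same bound.\<close>

lemma component_bound: "real (card (component_of k adj v)) \<le> 45 * m * M * H * s"
proof (cases "\<exists>h\<in>component_of k adj v. H \<le> w h")
  case True
  then obtain h where h: "h < k" "adj\<^sup>*\<^sup>* v h" "H \<le> w h" by (auto simp: component_of_def)
  have "adj\<^sup>*\<^sup>* h v"
    using h(2) by (induction rule: rtranclp_induct) (auto intro: adj_sym converse_rtranclp_into_rtranclp)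
  then have "component_of k adj v \<subseteq> {u. u < k \<and> adj\<^sup>*\<^sup>* h u}" by (auto simp: component_of_def)
  then have "card (component_of k adj v) \<le> card {u. u < k \<and> adj\<^sup>*\<^sup>* h u}"
    by (intro card_mono) auto
  then show ?thesis using heavy_component[OF h(1,3)] by linarith
next
  case False
  have light: "light_adj\<^sup>*\<^sup>* v u \<and> w u < H" if "v < k" "adj\<^sup>*\<^sup>* v u" for u
    using that(2)
  proof induction
    case base
    then show ?case using that False by (auto simp: component_of_def)
  next
    case (step y z)
    have "z < k" "adj\<^sup>*\<^sup>* v z" using adj[OF step(2)] step by auto
    then have "w z < H" using False by (auto simp: component_of_def)
    then show ?case using step
      by (auto simp: light_adj_def intro: rtranclp.rtrancl_into_rtrancl)
  qed
  show ?thesis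
  proof (cases "v < k")
    case True
    have "component_of k adj v \<subseteq> {u. u < k \<and> \<bar>X u - X v\<bar> \<le> 6 * M * H\<^sup>2}"
      using light[OF True] light_path_dist True by (auto simp: component_of_def)
    then have "card (component_of k adj v) \<le> card {u. u < k \<and> \<bar>X u - X v\<bar> \<le> 6 * M * H\<^sup>2}"
      by (intro card_mono) auto
    moreover have "1 \<le> 6 * real M * H\<^sup>2"
      using M1 H1 by (intro mult_ge1_I) (auto simp: one_le_power)
    then have "real (card {u. u < k \<and> \<bar>X u - X v\<bar> \<le> 6 * M * H\<^sup>2}) \<le> 5 * (6 * M * H\<^sup>2) * m"
      by (intro card_near) simp
    moreover have "5 * (6 * M * H\<^sup>2) * m = 30 * m * M * H * H" by (simp add: power2_eq_square)
    moreover have "30 * m * M * H * H \<le> 45 * m * M * H * s"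
      using s H1 by (intro mult_mono) auto
    ultimately show ?thesis by linarith
  next
    case False
    then have "component_of k adj v = {}"
    proof -
      have "u = v" if "adj\<^sup>*\<^sup>* v u" for u
        using that False by (induction rule: rtranclp_induct) (auto dest: adj)
      then show ?thesis using False by (auto simp: component_of_def)
    qed
    moreover have "0 \<le> 45 * m * M * H * s" using H1 s by auto
    ultimately show ?thesis by simp
  qed
qed

end

section \<open>Poisson points with power-law weights\<close>

text \<open>The hyperbolic plane is reduced to an upper bound on the intensity: at most \<kappa>
  t^(-2 \<alpha>) points of weight at least t per unit of length.\<close>

locale poisson_weighted = poisson_sample D c for D :: "'a measure" and c +
  fixes X w :: "'a \<Rightarrow> real" and K :: nat and \<alpha> \<kappa> :: real
  assumes measX [measurable]: "X \<in> borel_measurable D"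
    and measw [measurable]: "w \<in> borel_measurable D"
    and space_D: "space D = UNIV"
    and alpha: "1 < \<alpha>" and kappa: "0 \<le> \<kappa>"
    and support: "prob {p. \<not> (0 \<le> X p \<and> X p < real K \<and> 1 \<le> w p)} = 0"
    and intensity: "\<And>a b t. a \<le> b \<Longrightarrow> 1 \<le> t \<Longrightarrow>
      c * prob {p. a \<le> X p \<and> X p < b \<and> t \<le> w p} \<le> \<kappa> * (b - a) * t powr (- 2 * \<alpha>)"
begin

abbreviation outside :: "'a set" where "outside \<equiv> {p. \<not> (0 \<le> X p \<and> X p < real K \<and> 1 \<le> w p)}"

lemma sets_D_Collect: "Measurable.pred D P \<Longrightarrow> {p. P p} \<in> sets D"
  using space_D by (simp add: pred_def)

lemma outside_sets [measurable]: "outside \<in> sets D"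
  by (rule sets_D_Collect) measurable

lemma prob_le_outside:
  assumes "A \<subseteq> outside \<union> B" "B \<in> sets D"
  shows "prob A \<le> prob B"
proof -
  have "prob A \<le> prob (outside \<union> B)"
    using assms by (intro finite_measure_mono sets.Un outside_sets)
  also have "\<dots> \<le> prob outside + prob B" 
    using assms by (intro measure_subadditive outside_sets) auto
  finally show ?thesis using support by simp
qed

lemma intensity_cell: "c * prob {p. a \<le> X p \<and> X p < a + 1} \<le> \<kappa>"
proof -
  have "prob {p. a \<le> X p \<and> X p < a + 1} \<le> prob {p. a \<le> X p \<and> X p < a + 1 \<and> 1 \<le> w p}"
    by (rule prob_le_outside) (auto intro: sets_D_Collect)
  then have "c * prob {p. a \<le> X p \<and> X p < a + 1} \<le> c * prob {p. a \<le> X p \<and> X p < a + 1 \<and> 1 \<le> w p}"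
    using c_pos by simp
  also have "\<dots> \<le> \<kappa>" using intensity[of a "a + 1" 1] by simp
  finally show ?thesis .
qed

text \<open>The ratio of consecutive dyadic levels: squared weights grow like 4^j while densities
  decay like 4^(- \<alpha> j). That it is below 1 is the condition \<alpha> > 1.\<close>

lemma ratio: "0 < 4 powr (1 - \<alpha>)" "4 powr (1 - \<alpha>) < 1"
  using alpha powr_less_cancel_iff[of 4 "1 - \<alpha>" 0] by auto

lemma powr_dyadic: "((2::real) ^ j) powr (2 - 2 * \<alpha>) = (4 powr (1 - \<alpha>)) ^ j"
proof -
  have "((2::real) ^ j) powr (2 - 2 * \<alpha>) = (2 powr (2 - 2 * \<alpha>)) ^ j"
    by (simp add: powr_realpow[symmetric] powr_powr mult_ac)
  also have "(2::real) powr (2 - 2 * \<alpha>) = (2 powr 2) powr (1 - \<alpha>)"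
    unfolding powr_powr by (simp add: algebra_simps)
  also have "(2::real) powr 2 = 4" by simp
  finally show ?thesis .
qed

section \<open>Cuts have positive density\<close>

definition barrier :: "real \<Rightarrow> real \<Rightarrow> 'a set" where
  "barrier L x = {p. \<bar>X p - x\<bar> \<le> L \<and> \<bar>X p - x\<bar> \<le> (w p)\<^sup>2}"

lemma barrier_sets [measurable]: "barrier L x \<in> sets D"
  unfolding barrier_def by (rule sets_D_Collect) measurable

text \<open>The sum of the geometric series in \<open>intensity_barrier\<close>; it depends neither
  on \<open>L\<close> nor on \<open>x\<close>.\<close>

definition barrier_rate :: real where
  "barrier_rate = 8 * \<kappa> / (1 - 4 powr (1 - \<alpha>))"

text \<open>A point of the barrier with weight between 2^j and 2^(j+1) lies within 4^(j+1) of
  \<open>x\<close>. That interval has length 8 * 4^j, so level j contributes at most 8 \<kappa>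
  4^((1 - \<alpha>) j).\<close>

lemma intensity_barrier: "c * prob (barrier L x) \<le> barrier_rate"
proof -
  define A where "A = (\<lambda>j::nat. {p. x - 4 ^ Suc j \<le> X p \<and> X p < x + 4 ^ Suc j \<and> 2 ^ j \<le> w p})"
  have A [measurable]: "A j \<in> sets D" for j unfolding A_def by (rule sets_D_Collect) measurable
  have Ale: "c * prob (A j) \<le> 8 * \<kappa> * (4 powr (1 - \<alpha>)) ^ j" for j
  proof -
    have "c * prob (A j) \<le> \<kappa> * ((x + 4 ^ Suc j) - (x - 4 ^ Suc j)) * (2 ^ j) powr (- 2 * \<alpha>)"
      unfolding A_def by (intro intensity) auto
    also have "(x + 4 ^ Suc j) - (x - 4 ^ Suc j) = 8 * (2 ^ j) powr 2"
    proof -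
      have "(2 ^ j :: real) powr 2 = 2 ^ j * 2 ^ j" by (simp add: power2_eq_square)
      also have "\<dots> = 4 ^ j" by (simp add: power_mult_distrib[symmetric])
      finally show ?thesis by simp
    qed
    also have "\<kappa> * (8 * (2 ^ j) powr 2) * (2 ^ j) powr (- 2 * \<alpha>) = 8 * \<kappa> * (2 ^ j) powr (2 - 2 * \<alpha>)"
      using powr_add[of "2 ^ j" 2 "- 2 * \<alpha>"] by simp
    finally show ?thesis by (simp add: powr_dyadic)
  qed
  have sm: "summable (\<lambda>j. 8 * \<kappa> * (4 powr (1 - \<alpha>)) ^ j)"
    using ratio by (intro summable_mult summable_geometric) auto
  have smA: "summable (\<lambda>j. prob (A j))"
  proof (rule summable_comparison_test'[OF summable_divide[OF sm, of c], of 0])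
    fix j
    show "norm (prob (A j)) \<le> (8 * \<kappa> * (4 powr (1 - \<alpha>)) ^ j) / c"
      using Ale[of j] c_pos by (simp add: field_simps)
  qed
  have "barrier L x \<subseteq> outside \<union> (\<Union>j. A j)"
  proof
    fix p assume p: "p \<in> barrier L x"
    show "p \<in> outside \<union> (\<Union>j. A j)"
    proof (cases "1 \<le> w p")
      case w: True
      obtain J where "w p < 2 ^ J" using real_arch_pow[of 2 "w p"] by auto
      then obtain j where j: "2 ^ j \<le> w p" "w p < 2 ^ Suc j"
        using dyadic_level[of 1 "w p" J] w by auto
      have "(w p)\<^sup>2 < (2 ^ Suc j)\<^sup>2" using j w by (intro power_strict_mono) auto
      also have "(2 ^ Suc j)\<^sup>2 = (4 ^ Suc j :: real)"
        unfolding power2_eq_square power_mult_distrib[symmetric] by simp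
      finally have "\<bar>X p - x\<bar> < 4 ^ Suc j" using p by (simp add: barrier_def)
      then have "p \<in> A j" using j by (auto simp: A_def abs_less_iff)
      then show ?thesis by blast
    qed simp
  qed
  then have "prob (barrier L x) \<le> prob (\<Union>j. A j)" by (rule prob_le_outside) auto
  also have "\<dots> \<le> (\<Sum>j. prob (A j))" using smA by (intro finite_measure_subadditive_countably) auto
  finally have "c * prob (barrier L x) \<le> c * (\<Sum>j. prob (A j))" using c_pos by simp
  also have "\<dots> = (\<Sum>j. c * prob (A j))" using smA by (rule suminf_mult[symmetric])
  also have "\<dots> \<le> (\<Sum>j. 8 * \<kappa> * (4 powr (1 - \<alpha>)) ^ j)"
    by (intro suminf_le Ale summable_mult smA sm)
  also have "\<dots> = barrier_rate"
  proof -
    have n: "norm (4 powr (1 - \<alpha>)) < 1" using ratio by (simp only: real_norm_def abs_of_pos)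
    show ?thesis
      by (simp add: suminf_mult[OF summable_geometric[OF n]] suminf_geometric[OF n] barrier_rate_def)
  qed
  finally show ?thesis .
qed

text \<open>Truncation at \<open>L\<close> and spacing 3 L make the barriers disjoint, so they are
  occupied independently, each with probability at most 1 - exp (- rate).\<close>

lemma prob_no_cut:
  assumes "0 < L"
  shows "Om.prob {\<omega>\<in>space \<Omega>. \<forall>i\<in>{i0..<i0 + M}. occupied (barrier L (3 * L * real i)) \<omega>}
    \<le> exp (- real M * exp (- barrier_rate))"
proof -
  let ?B = "\<lambda>i. barrier L (3 * L * real i)" and ?I = "{i0..<i0 + M}"
  have "disjoint_family_on ?B (?I \<union> {})"
    unfolding disjoint_family_on_def
  proof (intro ballI impI equals0I)
    fix i j p assume "i \<noteq> j" "p \<in> ?B i \<inter> ?B j"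
    then have "\<bar>3 * L * real i - 3 * L * real j\<bar> \<le> 2 * L" by (auto simp: barrier_def)
    then have "3 * L * \<bar>real i - real j\<bar> \<le> 3 * L * (2 / 3)"
      using assms by (simp add: right_diff_distrib[symmetric] abs_mult)
    then have "\<bar>real i - real j\<bar> \<le> 2 / 3" using assms by (simp only: mult_le_cancel_left_pos)
    then show False using \<open>i \<noteq> j\<close> by linarith
  qed
  then have "Om.prob {\<omega>\<in>space \<Omega>. (\<forall>i\<in>?I. occupied (?B i) \<omega>) \<and> (\<forall>i\<in>{}. \<not> occupied (?B i) \<omega>)}
    = (\<Prod>i\<in>?I. 1 - exp (- c * prob (?B i))) * (\<Prod>i\<in>{}. exp (- c * prob (?B i)))"
    by (intro prob_occupation_pattern) auto
  then have "Om.prob {\<omega>\<in>space \<Omega>. \<forall>i\<in>?I. occupied (?B i) \<omega>} = (\<Prod>i\<in>?I. 1 - exp (- c * prob (?B i)))"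
    by simp
  also have "\<dots> \<le> (\<Prod>i\<in>?I. exp (- exp (- barrier_rate)))"
  proof (intro prod_mono conjI)
    fix i
    show "0 \<le> 1 - exp (- c * prob (?B i))" using c_pos by simp
    have "exp (- barrier_rate) \<le> exp (- c * prob (?B i))" using intensity_barrier[of L "3 * L * real i"] by simp
    then show "1 - exp (- c * prob (?B i)) \<le> exp (- exp (- barrier_rate))"
      using exp_ge_add_one_self[of "- exp (- barrier_rate)"] by linarith
  qed
  also have "\<dots> = exp (- real M * exp (- barrier_rate))"
    by (simp add: exp_of_nat_mult[symmetric])
  finally show ?thesis .
qed

section \<open>Subcritical clusters of heavy sites\<close>

lemma site_sets [measurable]: "site X w H b \<in> sets D"
  unfolding site_def by (rule sets_D_Collect) measurable

lemma sites_disjoint: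
  assumes "0 < H"
  shows "disjoint_family_on (site X w H) V"
  unfolding disjoint_family_on_def
proof (intro ballI impI equals0I)
  fix b b' p assume ne: "b \<noteq> b'" and "p \<in> site X w H b \<inter> site X w H b'"
  then have p: "real (fst b) \<le> X p" "X p < real (fst b) + 1" "real (fst b') \<le> X p" "X p < real (fst b') + 1"
    "H * 2 ^ snd b \<le> w p" "w p < H * 2 ^ Suc (snd b)" "H * 2 ^ snd b' \<le> w p" "w p < H * 2 ^ Suc (snd b')"
    by (auto simp: site_def)
  have 1: "fst b = fst b'" using p(1-4) by linarith
  have lt: "i < Suc j" if "H * 2 ^ i \<le> w p" "w p < H * 2 ^ Suc j" for i j
  proof -
    have "H * 2 ^ i < H * 2 ^ Suc j" using that by linarith
    then have "(2::real) ^ i < 2 ^ Suc j" using assms by (simp only: mult_less_cancel_left_pos)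
    then show ?thesis by (simp only: power_strict_increasing_iff[of 2]) 
  qed
  have "snd b = snd b'" using lt[OF p(5,8)] lt[OF p(7,6)] by simp
  then show False using 1 ne by (simp add: prod_eq_iff)
qed

lemma prob_heavy_cluster:
  fixes M J :: nat and H s \<theta> :: real
  assumes H: "1 \<le> H" and M: "1 \<le> M" and th: "0 < \<theta>" "2 * \<theta> * (H * 2 ^ J) \<le> 1"
    and sub: "300 * \<kappa> * M * H powr (2 - 2 * \<alpha>) \<le> 1 - 4 powr (1 - \<alpha>)"
    and b0: "b0 \<in> {..<K} \<times> {..<J}"
  shows "Om.prob {\<omega>\<in>space \<Omega>. \<theta> * s \<le> (\<Sum>b\<in>cluster (near_site (37 * M * H\<^sup>2))
      {b\<in>{..<K} \<times> {..<J}. occupied (site X w H b) \<omega>} {b0}. \<theta> * (H * 2 ^ snd b))} \<le> exp (1 - \<theta> * s)" (is ?th1)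
    and "{\<omega>\<in>space \<Omega>. \<theta> * s \<le> (\<Sum>b\<in>cluster (near_site (37 * M * H\<^sup>2))
      {b\<in>{..<K} \<times> {..<J}. occupied (site X w H b) \<omega>} {b0}. \<theta> * (H * 2 ^ snd b))} \<in> Om.events" (is ?th2)
proof -
  let ?V = "{..<K} \<times> {..<J}" and ?E = "near_site (37 * M * H\<^sup>2)"
  \<comment> \<open>Twice the mass \<theta> w of a site: one half pays for the site itself, the
    other half for its offspring.\<close>
  define a where "a = (\<lambda>b::nat\<times>nat. 2 * \<theta> * (H * 2 ^ snd b))"
  have a1: "a b \<le> 1" if "b \<in> ?V" for b
  proof -
    have "(2::real) ^ snd b \<le> 2 ^ J" using that by (intro power_increasing) auto
    then have "2 * \<theta> * (H * 2 ^ snd b) \<le> 2 * \<theta> * (H * 2 ^ J)" using H th by (intro mult_left_mono) auto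
    then show ?thesis using th unfolding a_def by linarith
  qed
  have a0: "0 \<le> a b" for b using H th by (simp add: a_def)
  have site_rate: "c * prob (site X w H b) \<le> \<kappa> * (H * 2 ^ snd b) powr (- 2 * \<alpha>)" for b
  proof -
    have "prob (site X w H b) \<le> prob {p. real (fst b) \<le> X p \<and> X p < real (fst b) + 1 \<and> H * 2 ^ snd b \<le> w p}"
      by (intro finite_measure_mono sets_D_Collect) (auto simp: site_def)
    then have "c * prob (site X w H b)
        \<le> c * prob {p. real (fst b) \<le> X p \<and> X p < real (fst b) + 1 \<and> H * 2 ^ snd b \<le> w p}"
      using c_pos by simp
    also have "\<dots> \<le> \<kappa> * ((real (fst b) + 1) - real (fst b)) * (H * 2 ^ snd b) powr (- 2 * \<alpha>)"
      using H by (intro intensity mult_ge1_I) auto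
    finally show ?thesis by simp
  qed
  have cond: "\<theta> * (H * 2 ^ snd b) + (\<Sum>b'\<in>{b'\<in>?V. ?E b b'}. c * prob (site X w H b') * (exp (a b') - 1)) \<le> a b"
    for b
  proof -
    let ?N = "\<lambda>j'. {c'::nat. \<bar>real c' - real (fst b)\<bar> \<le> 37 * M * H\<^sup>2 * 2 ^ snd b * 2 ^ j'}"
    \<comment> \<open>Bounds the contribution of one site at level \<open>j'\<close>: its intensity
      times 2 a, where 2 a bounds exp a - 1 because a <= 1.\<close>
    define g where "g = (\<lambda>j'::nat. \<kappa> * (H * 2 ^ j') powr (- 2 * \<alpha>) * (4 * \<theta> * (H * 2 ^ j')))"
    have g0: "0 \<le> g j'" for j' using H th kappa by (simp add: g_def)
    have fN: "finite (?N j')" for j' by (intro card_nat_near(1)) auto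
    have "(\<Sum>b'\<in>{b'\<in>?V. ?E b b'}. c * prob (site X w H b') * (exp (a b') - 1))
       \<le> (\<Sum>b'\<in>{b'\<in>?V. ?E b b'}. g (snd b'))"
    proof (intro sum_mono)
      fix b' assume b': "b' \<in> {b'\<in>?V. ?E b b'}"
      have "exp (a b') \<le> 1 + a b' + (a b')\<^sup>2" using a0 a1 b' by (intro exp_bound) auto
      moreover have "(a b')\<^sup>2 \<le> a b'" using a0[of b'] a1[of b'] b' 
        by (auto simp: power2_eq_square intro: mult_left_le)
      ultimately have "exp (a b') - 1 \<le> 4 * \<theta> * (H * 2 ^ snd b')" by (simp add: a_def)
      then show "c * prob (site X w H b') * (exp (a b') - 1) \<le> g (snd b')"
        unfolding g_def using site_rate[of b'] a0[of b'] kappa by (rule_tac mult_mono) auto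
    qed
    \<comment> \<open>Regrouping by level; cells beyond \<open>K\<close> may be added since
      \<open>g\<close> is nonnegative.\<close>
    also have "\<dots> \<le> (\<Sum>b'\<in>(SIGMA j':{..<J}. ?N j'). g (fst b'))"
    proof (rule sum_le_included[where i = "\<lambda>b'. (snd b', fst b')"])
      show "finite {b'\<in>?V. ?E b b'}" by (rule finite_subset[of _ ?V]) auto
      show "finite (SIGMA j':{..<J}. ?N j')" using fN by (intro finite_SigmaI) auto
      show "\<forall>x\<in>{b'\<in>?V. ?E b b'}. \<exists>y\<in>(SIGMA j':{..<J}. ?N j'). (snd y, fst y) = x \<and> g (snd x) \<le> g (fst y)"
        by (force simp: near_site_def abs_minus_commute)
    qed (use g0 in auto)
    also have "\<dots> = (\<Sum>j'<J. card (?N j') * g j')"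
      using sum.Sigma[of "{..<J}" ?N "\<lambda>j' _. g j'"] fN by (simp add: split_def)
    also have "\<dots> \<le> (\<Sum>j'<J. (75 * (M * H\<^sup>2 * 2 ^ snd b * 2 ^ j')) * g j')"
    proof (intro sum_mono mult_right_mono)
      fix j'
      \<comment> \<open>The count 2 * 37 x + 1 is at most 75 x, as x >= 1. Together with the 4 in
        \<open>g\<close> this explains the 300 in the hypothesis \<open>sub\<close>.\<close>
      have "1 \<le> M * H\<^sup>2 * 2 ^ snd b * 2 ^ j'"
        using M H by (intro mult_ge1_I) (auto simp: one_le_power)
      moreover have "real (card (?N j')) \<le> 2 * (37 * M * H\<^sup>2 * 2 ^ snd b * 2 ^ j') + 1"
        by (intro card_nat_near(2)) auto
      ultimately show "real (card (?N j')) \<le> 75 * (M * H\<^sup>2 * 2 ^ snd b * 2 ^ j')" by simp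
    qed (use g0 in auto)
    also have "\<dots> = (\<Sum>j'<J. (300 * \<kappa> * M * H powr (2 - 2 * \<alpha>)) * (\<theta> * (H * 2 ^ snd b)) * (4 powr (1 - \<alpha>)) ^ j')"
    proof (intro sum.cong refl)
      fix j'
      have "(H * 2 ^ j') powr (- 2 * \<alpha>) * (H * 2 ^ j')\<^sup>2 = (H * 2 ^ j') powr (2 - 2 * \<alpha>)"
        using H powr_add[of "H * 2 ^ j'" "- 2 * \<alpha>" 2] by simp
      also have "\<dots> = H powr (2 - 2 * \<alpha>) * (4 powr (1 - \<alpha>)) ^ j'"
        using H by (simp add: powr_mult powr_dyadic)
      finally have e: "(H * 2 ^ j') powr (- 2 * \<alpha>) * (H * 2 ^ j')\<^sup>2 = H powr (2 - 2 * \<alpha>) * (4 powr (1 - \<alpha>)) ^ j'" .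
      have "(75 * (M * H\<^sup>2 * 2 ^ snd b * 2 ^ j')) * g j'
         = 300 * \<kappa> * M * (\<theta> * (H * 2 ^ snd b)) * ((H * 2 ^ j') powr (- 2 * \<alpha>) * (H * 2 ^ j')\<^sup>2)"
        by (simp add: g_def power2_eq_square mult_ac)
      then show "(75 * (M * H\<^sup>2 * 2 ^ snd b * 2 ^ j')) * g j'
         = (300 * \<kappa> * M * H powr (2 - 2 * \<alpha>)) * (\<theta> * (H * 2 ^ snd b)) * (4 powr (1 - \<alpha>)) ^ j'"
        unfolding e by (simp add: mult_ac)
    qed
    \<comment> \<open>\<open>sub\<close> cancels the sum of the geometric series, so the offspring
      sum is at most \<theta> times the weight of \<open>b\<close>.\<close>
    also have "\<dots> \<le> (1 - 4 powr (1 - \<alpha>)) * (\<theta> * (H * 2 ^ snd b)) * (\<Sum>j'<J. (4 powr (1 - \<alpha>)) ^ j')"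
      unfolding sum_distrib_left[symmetric] using sub H th ratio
      by (intro mult_right_mono sum_nonneg) auto
    also have "\<dots> = (\<theta> * (H * 2 ^ snd b)) * (1 - (4 powr (1 - \<alpha>)) ^ J)"
      using one_diff_power_eq[of "4 powr (1 - \<alpha>)" J] by (simp add: mult_ac)
    also have "\<dots> \<le> (\<theta> * (H * 2 ^ snd b)) * 1" using th H by (intro mult_left_mono) auto
    moreover have "a b = \<theta> * (H * 2 ^ snd b) + \<theta> * (H * 2 ^ snd b)" by (simp add: a_def)
    ultimately show ?thesis by linarith
  qed
  note main = prob_cluster_sum_ge[of ?V "site X w H" a "\<lambda>b. \<theta> * (H * 2 ^ snd b)" ?E b0 "\<theta> * s",
      OF _ site_sets sites_disjoint a0 _ cond b0]
  show ?th2 using H th by (intro main(2)) auto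
  have "Om.prob {\<omega>\<in>space \<Omega>. \<theta> * s \<le> (\<Sum>b\<in>cluster ?E {b\<in>?V. occupied (site X w H b) \<omega>} {b0}. \<theta> * (H * 2 ^ snd b))}
      \<le> exp (a b0 - \<theta> * s)" using H th by (intro main(1)) auto
  also have "\<dots> \<le> exp (1 - \<theta> * s)" using a1[OF b0] by simp
  finally show ?th1 .
qed

text \<open>The four error terms bound, in this order: a point too heavy or out of range, a run of
  \<open>M\<close> occupied barriers, a crowded cell, a heavy cluster of large weight. The event
  \<open>G\<close> is fixed before the graph, so the bound holds on it for every symmetric graph
  that obeys the distance condition.\<close>

lemma component_bound_event:
  fixes M J m :: nat and H s \<theta> :: real
  assumes H: "1 \<le> H" and M: "1 \<le> M" and th: "0 < \<theta>" "2 * \<theta> * (H * 2 ^ J) \<le> 1" and s: "H \<le> s"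
    and sub: "300 * \<kappa> * M * H powr (2 - 2 * \<alpha>) \<le> 1 - 4 powr (1 - \<alpha>)"
  obtains G where "G \<in> Om.events"
    and "1 - (\<kappa> * K * (H * 2 ^ J) powr (- 2 * \<alpha>) + K * exp (- real M * exp (- barrier_rate))
        + K * (exp \<kappa> / 2 ^ m) + (K * J) * exp (1 - \<theta> * s)) \<le> Om.prob G"
    and "\<And>\<omega> i. \<omega> \<in> G \<Longrightarrow> i < fst \<omega> \<Longrightarrow>
        0 \<le> X (snd \<omega> i) \<and> X (snd \<omega> i) < K \<and> 1 \<le> w (snd \<omega> i) \<and> w (snd \<omega> i) < H * 2 ^ J"
    and "\<And>\<omega> adj v. \<omega> \<in> G \<Longrightarrow> (\<And>i j. adj i j \<Longrightarrow> adj j i) \<Longrightarrow>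
        (\<And>i j. adj i j \<Longrightarrow> i < fst \<omega> \<and> j < fst \<omega> \<and>
            \<bar>X (snd \<omega> i) - X (snd \<omega> j)\<bar> \<le> w (snd \<omega> i) * w (snd \<omega> j)) \<Longrightarrow>
        real (card (component_of (fst \<omega>) adj v)) \<le> 45 * m * M * H * s"
proof -
  let ?V = "{..<K} \<times> {..<J}"
  define far where "far = {p. \<not> (0 \<le> X p \<and> X p < real K \<and> 1 \<le> w p \<and> w p < H * 2 ^ J)}"
  have far [measurable]: "far \<in> sets D" unfolding far_def by (rule sets_D_Collect) measurable
  have cell [measurable]: "{p. real a \<le> X p \<and> X p < real a + 1} \<in> sets D" for a
    by (rule sets_D_Collect) measurable
  have H2: "0 < H\<^sup>2" using H by simp
  define B1 where "B1 = {\<omega>\<in>space \<Omega>. occupied far \<omega>}"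
  define B2 where "B2 = (\<lambda>i0. {\<omega>\<in>space \<Omega>. \<forall>i\<in>{i0..<i0 + M}. occupied (barrier (H\<^sup>2) (3 * H\<^sup>2 * real i)) \<omega>})"
  define B3 where "B3 = (\<lambda>a. {\<omega>\<in>space \<Omega>. m \<le> count_in {p. real a \<le> X p \<and> X p < real a + 1} \<omega>})"
  define B4 where "B4 = (\<lambda>b0. {\<omega>\<in>space \<Omega>. \<theta> * s \<le> (\<Sum>b\<in>cluster (near_site (37 * M * H\<^sup>2))
      {b\<in>?V. occupied (site X w H b) \<omega>} {b0}. \<theta> * (H * 2 ^ snd b))})"
  have B4_event: "B4 b0 \<in> Om.events" and B4_prob: "Om.prob (B4 b0) \<le> exp (1 - \<theta> * s)"
    if "b0 \<in> ?V" for b0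
    unfolding B4_def using prob_heavy_cluster[OF H M th sub that] by blast+
  have ev1: "B1 \<in> Om.events" unfolding B1_def by measurable
  have ev2: "B2 i0 \<in> Om.events" for i0
  proof -
    have "{\<omega>\<in>space \<Omega>. occupied (barrier (H\<^sup>2) (3 * H\<^sup>2 * real i)) \<omega>} \<in> Om.events" for i
      by measurable
    then show ?thesis unfolding B2_def by (intro sets.sets_Collect_finite_All) auto
  qed
  have ev3: "B3 a \<in> Om.events" for a unfolding B3_def by measurable
  define U where "U = B1 \<union> ((\<Union>i0\<in>{..<K}. B2 i0) \<union> ((\<Union>a\<in>{..<K}. B3 a) \<union> (\<Union>b0\<in>?V. B4 b0)))"
  have evs: "(\<Union>i0\<in>{..<K}. B2 i0) \<in> Om.events" "(\<Union>a\<in>{..<K}. B3 a) \<in> Om.events"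
    "(\<Union>b0\<in>?V. B4 b0) \<in> Om.events"
    using ev2 ev3 B4_event by (auto intro!: sets.finite_UN)
  have evU: "U \<in> Om.events" unfolding U_def using ev1 evs by (intro sets.Un)
  have p1: "Om.prob B1 \<le> \<kappa> * K * (H * 2 ^ J) powr (- 2 * \<alpha>)"
  proof -
    have "prob far \<le> prob {p. 0 \<le> X p \<and> X p < real K \<and> H * 2 ^ J \<le> w p}"
      by (rule prob_le_outside) (auto simp: far_def intro: sets_D_Collect)
    then have "c * prob far \<le> c * prob {p. 0 \<le> X p \<and> X p < real K \<and> H * 2 ^ J \<le> w p}"
      using c_pos by simp
    also have "\<dots> \<le> \<kappa> * (real K - 0) * (H * 2 ^ J) powr (- 2 * \<alpha>)"
      using H by (intro intensity mult_ge1_I) auto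
    finally show ?thesis using prob_occupied_le[OF far] by (simp add: B1_def)
  qed
  have p2: "Om.prob (\<Union>i0\<in>{..<K}. B2 i0) \<le> K * exp (- real M * exp (- barrier_rate))"
  proof -
    have "Om.prob (\<Union>i0\<in>{..<K}. B2 i0) \<le> (\<Sum>i0<K. Om.prob (B2 i0))"
      using ev2 by (intro Om.finite_measure_subadditive_finite) auto
    also have "\<dots> \<le> (\<Sum>i0<K. exp (- real M * exp (- barrier_rate)))"
      unfolding B2_def by (intro sum_mono prob_no_cut H2)
    finally show ?thesis by simp
  qed
  have p3: "Om.prob (\<Union>a\<in>{..<K}. B3 a) \<le> K * (exp \<kappa> / 2 ^ m)"
  proof -
    have "Om.prob (\<Union>a\<in>{..<K}. B3 a) \<le> (\<Sum>a<K. Om.prob (B3 a))"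
      using ev3 by (intro Om.finite_measure_subadditive_finite) auto
    also have "\<dots> \<le> (\<Sum>a<K. exp \<kappa> / 2 ^ m)"
    proof (intro sum_mono)
      fix a
      have "Om.prob (B3 a) \<le> exp (c * prob {p. real a \<le> X p \<and> X p < real a + 1}) / 2 ^ m"
        unfolding B3_def by (rule prob_count_in_ge[OF cell])
      also have "\<dots> \<le> exp \<kappa> / 2 ^ m" using intensity_cell by (intro divide_right_mono) auto
      finally show "Om.prob (B3 a) \<le> exp \<kappa> / 2 ^ m" .
    qed
    finally show ?thesis by simp
  qed
  have p4: "Om.prob (\<Union>b0\<in>?V. B4 b0) \<le> (K * J) * exp (1 - \<theta> * s)"
  proof -
    have "Om.prob (\<Union>b0\<in>?V. B4 b0) \<le> (\<Sum>b0\<in>?V. Om.prob (B4 b0))"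
      using B4_event by (intro Om.finite_measure_subadditive_finite) auto
    also have "\<dots> \<le> (\<Sum>b0\<in>?V. exp (1 - \<theta> * s))" by (intro sum_mono B4_prob)
    finally show ?thesis by simp
  qed
  have "Om.prob U \<le> \<kappa> * K * (H * 2 ^ J) powr (- 2 * \<alpha>) + K * exp (- real M * exp (- barrier_rate))
        + K * (exp \<kappa> / 2 ^ m) + (K * J) * exp (1 - \<theta> * s)"
  proof -
    have "Om.prob U \<le> Om.prob B1 + Om.prob ((\<Union>i0\<in>{..<K}. B2 i0) \<union> ((\<Union>a\<in>{..<K}. B3 a) \<union> (\<Union>b0\<in>?V. B4 b0)))"
      unfolding U_def using ev1 evs by (intro measure_subadditive sets.Un) auto
    moreover have "Om.prob ((\<Union>i0\<in>{..<K}. B2 i0) \<union> ((\<Union>a\<in>{..<K}. B3 a) \<union> (\<Union>b0\<in>?V. B4 b0)))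
       \<le> Om.prob (\<Union>i0\<in>{..<K}. B2 i0) + Om.prob ((\<Union>a\<in>{..<K}. B3 a) \<union> (\<Union>b0\<in>?V. B4 b0))"
      using evs by (intro measure_subadditive sets.Un) auto
    moreover have "Om.prob ((\<Union>a\<in>{..<K}. B3 a) \<union> (\<Union>b0\<in>?V. B4 b0))
       \<le> Om.prob (\<Union>a\<in>{..<K}. B3 a) + Om.prob (\<Union>b0\<in>?V. B4 b0)"
      using evs by (intro measure_subadditive sets.Un) auto
    ultimately show ?thesis using p1 p2 p3 p4 by linarith
  qed
  moreover have "Om.prob (space \<Omega> - U) = 1 - Om.prob U" using evU by (rule Om.prob_compl)
  ultimately have pG: "1 - (\<kappa> * K * (H * 2 ^ J) powr (- 2 * \<alpha>) + K * exp (- real M * exp (- barrier_rate))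
        + K * (exp \<kappa> / 2 ^ m) + (K * J) * exp (1 - \<theta> * s)) \<le> Om.prob (space \<Omega> - U)"
    by linarith
  have rng: "0 \<le> X (snd \<omega> i) \<and> X (snd \<omega> i) < K \<and> 1 \<le> w (snd \<omega> i) \<and> w (snd \<omega> i) < H * 2 ^ J"
    if "\<omega> \<in> space \<Omega> - U" "i < fst \<omega>" for \<omega> i
    using that by (auto simp: U_def B1_def occupied_def far_def)
  show ?thesis
  proof (rule that[of "space \<Omega> - U"])
    show "space \<Omega> - U \<in> Om.events" using evU by auto
    fix \<omega> and adj :: "nat \<Rightarrow> nat \<Rightarrow> bool" and v
    assume w: "\<omega> \<in> space \<Omega> - U" and sym: "\<And>i j. adj i j \<Longrightarrow> adj j i"
      and adj: "\<And>i j. adj i j \<Longrightarrow> i < fst \<omega> \<and> j < fst \<omega> \<and>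
            \<bar>X (snd \<omega> i) - X (snd \<omega> j)\<bar> \<le> w (snd \<omega> i) * w (snd \<omega> j)"
    interpret weighted_graph "\<lambda>i. X (snd \<omega> i)" "\<lambda>i. w (snd \<omega> i)" "fst \<omega>" adj H M K J m s
    proof
      fix i0 assume "i0 < K"
      then have "\<omega> \<notin> B2 i0" using w by (auto simp: U_def)
      then show "\<exists>i\<in>{i0..<i0 + M}. \<forall>v<fst \<omega>. \<not> (\<bar>X (snd \<omega> v) - 3 * H\<^sup>2 * real i\<bar> \<le> H\<^sup>2 \<and>
          \<bar>X (snd \<omega> v) - 3 * H\<^sup>2 * real i\<bar> \<le> (w (snd \<omega> v))\<^sup>2)"
        using w by (auto simp: B2_def occupied_def barrier_def)
    next
      fix a assume "a < K"
      then have "\<omega> \<notin> B3 a" using w by (auto simp: U_def)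
      then show "card {v. v < fst \<omega> \<and> real a \<le> X (snd \<omega> v) \<and> X (snd \<omega> v) < real a + 1} \<le> m"
        using w by (auto simp: B3_def count_in_def)
    next
      fix b0 assume "b0 \<in> ?V"
      then have "\<omega> \<notin> B4 b0" using w by (auto simp: U_def)
      \<comment> \<open>Change from sites as sets of points to sites as sets of indices.\<close>
      moreover have "{b\<in>?V. occupied (site X w H b) \<omega>}
        = {b\<in>?V. \<exists>v<fst \<omega>. v \<in> site (\<lambda>i. X (snd \<omega> i)) (\<lambda>i. w (snd \<omega> i)) H b}"
        by (auto simp: occupied_def site_def)
      ultimately show "(\<Sum>b\<in>cluster (near_site (37 * M * H\<^sup>2))
           {b\<in>?V. \<exists>v<fst \<omega>. v \<in> site (\<lambda>i. X (snd \<omega> i)) (\<lambda>i. w (snd \<omega> i)) H b} {b0}. H * 2 ^ snd b) \<le> s"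
        using w th by (simp add: B4_def sum_distrib_left[symmetric])
    qed (use rng[OF w] sym adj H M s in blast)+
    show "real (card (component_of (fst \<omega>) adj v)) \<le> 45 * m * M * H * s"
      by (rule component_bound)
  qed (use pG rng in auto)
qed

end

section \<open>The point distribution\<close>

lemma nn_integral_product_lborel:
  fixes F G :: "real \<Rightarrow> ennreal"
  assumes [measurable]: "F \<in> borel_measurable borel" "G \<in> borel_measurable borel"
  shows "(\<integral>\<^sup>+p. F (fst p) * G (snd p) \<partial>lborel) = (\<integral>\<^sup>+x. F x \<partial>lborel) * (\<integral>\<^sup>+y. G y \<partial>lborel)"
proof -
  have "(\<integral>\<^sup>+p. F (fst p) * G (snd p) \<partial>lborel) = (\<integral>\<^sup>+p. F (fst p) * G (snd p) \<partial>(lborel \<Otimes>\<^sub>M lborel))"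
    by (simp add: lborel_prod)
  also have "\<dots> = (\<integral>\<^sup>+x. (\<integral>\<^sup>+y. F x * G y \<partial>lborel) \<partial>lborel)"
    by (subst lborel.nn_integral_fst[symmetric]) simp_all
  also have "\<dots> = (\<integral>\<^sup>+x. F x * (\<integral>\<^sup>+y. G y \<partial>lborel) \<partial>lborel)"
    by (simp add: nn_integral_cmult)
  also have "\<dots> = (\<integral>\<^sup>+x. F x \<partial>lborel) * (\<integral>\<^sup>+y. G y \<partial>lborel)"
    by (simp add: nn_integral_multc)
  finally show ?thesis .
qed

text \<open>Separates the exponential growth from a bounded correction; in the quotient
  \<open>radial\<close> it leaves exp (- \<alpha> (R - \<rho>)) times a factor that lies between 1/4
  and 1 for 1 <= \<rho> <= R.\<close>

lemma cosh_minus_one: "cosh x - 1 = exp x * (1 - exp (- x))\<^sup>2 / 2" for x :: real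
proof -
  have "exp x * (1 - exp (- x))\<^sup>2 = exp x - 2 * (exp x * exp (- x)) + (exp x * exp (- x)) * exp (- x)"
    by (simp only: power2_eq_square algebra_simps)
  also have "exp x * exp (- x) = 1" by (simp add: exp_minus)
  finally show ?thesis by (simp add: cosh_def field_simps)
qed

lemma sets_borel_pairI:
  "Measurable.pred (borel \<Otimes>\<^sub>M borel) P \<Longrightarrow> {p :: real \<times> real. P p} \<in> sets borel"
  by (simp add: pred_def borel_prod)

lemma sinh_measurable [measurable]: "(sinh :: real \<Rightarrow> real) \<in> borel_measurable borel"
  by (intro borel_measurable_continuous_onI continuous_intros)

section \<open>Law of a single vertex\<close>

locale hrg =
  fixes \<alpha> \<nu> :: real and n :: nat
  assumes alpha: "1 < \<alpha>" and nu: "0 < \<nu>" and n: "0 < n" and R: "0 < hrg_R \<nu> n"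
begin

abbreviation "R \<equiv> hrg_R \<nu> n"
abbreviation "D \<equiv> hrg_point_dist \<alpha> \<nu> n"

lemma exp_half_R: "exp (R / 2) = real n / \<nu>"
  using n nu by (simp add: hrg_R_def)

lemma cosh_R: "1 < cosh (\<alpha> * R)"
  using cosh_real_nonneg_less_iff[of 0 "\<alpha> * R"] R alpha by simp

text \<open>The distribution function of the radius of a random point, for arguments between 0 and
  R.\<close>

definition radial :: "real \<Rightarrow> real" where
  "radial \<rho> = (cosh (\<alpha> * \<rho>) - 1) / (cosh (\<alpha> * R) - 1)"

lemma radial_eq:
  "radial \<rho> = exp (- \<alpha> * (R - \<rho>)) * ((1 - exp (- \<alpha> * \<rho>)) / (1 - exp (- \<alpha> * R)))\<^sup>2"
proof -
  have "exp (- \<alpha> * (R - \<rho>)) = exp (\<alpha> * \<rho>) / exp (\<alpha> * R)"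
    by (simp add: exp_diff[symmetric] algebra_simps)
  then show ?thesis
    unfolding radial_def cosh_minus_one power_divide by simp
qed

lemma radial_le:
  assumes "0 \<le> \<rho>" "\<rho> \<le> R"
  shows "radial \<rho> \<le> exp (- \<alpha> * (R - \<rho>))"
proof -
  have "\<alpha> * \<rho> \<le> \<alpha> * R" "0 < \<alpha> * R" "0 \<le> \<alpha> * \<rho>" using assms alpha R by (auto intro: mult_left_mono)
  then have "((1 - exp (- \<alpha> * \<rho>)) / (1 - exp (- \<alpha> * R)))\<^sup>2 \<le> 1"
    by (intro power_le_one divide_nonneg_nonneg) (auto simp: divide_le_eq_1)
  then have "exp (- \<alpha> * (R - \<rho>)) * ((1 - exp (- \<alpha> * \<rho>)) / (1 - exp (- \<alpha> * R)))\<^sup>2 \<le> exp (- \<alpha> * (R - \<rho>)) * 1"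
    by (intro mult_left_mono) auto
  then show ?thesis unfolding radial_eq by simp
qed

lemma radial_ge:
  assumes "1 \<le> \<rho>" "\<rho> \<le> R"
  shows "exp (- \<alpha> * (R - \<rho>)) / 4 \<le> radial \<rho>"
proof -
  have a: "1 * 1 \<le> \<alpha> * \<rho>" using assms alpha by (intro mult_mono) auto
  have "exp 1 \<ge> (2::real)" using exp_ge_add_one_self[of 1] by simp
  then have "exp (- 1) \<le> (1 / 2 :: real)" by (simp add: exp_minus field_simps)
  moreover have "exp (- \<alpha> * \<rho>) \<le> exp (- 1)" using a by simp
  ultimately have h: "1 / 2 \<le> 1 - exp (- \<alpha> * \<rho>)" by linarith
  have d: "0 < 1 - exp (- \<alpha> * R)" "1 - exp (- \<alpha> * R) \<le> 1" using alpha R by auto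
  have "1 / 2 * (1 - exp (- \<alpha> * R)) \<le> 1 / 2 * 1" by (intro mult_left_mono d(2)) simp
  then have "1 / 2 * (1 - exp (- \<alpha> * R)) \<le> 1 - exp (- \<alpha> * \<rho>)" using h by (simp only: mult_1_right)
  then have "1 / 2 \<le> (1 - exp (- \<alpha> * \<rho>)) / (1 - exp (- \<alpha> * R))"
    by (subst pos_le_divide_eq[OF d(1)])
  then have "(1 / 2)\<^sup>2 \<le> ((1 - exp (- \<alpha> * \<rho>)) / (1 - exp (- \<alpha> * R)))\<^sup>2"
    by (intro power_mono) auto
  then have "exp (- \<alpha> * (R - \<rho>)) * (1 / 2)\<^sup>2
      \<le> exp (- \<alpha> * (R - \<rho>)) * ((1 - exp (- \<alpha> * \<rho>)) / (1 - exp (- \<alpha> * R)))\<^sup>2"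
    by (intro mult_left_mono) auto
  then show ?thesis unfolding radial_eq by (simp add: power2_eq_square)
qed

lemma radial_R: "radial R = 1"
  unfolding radial_def by (rule divide_self) (use cosh_R in linarith)

lemma radial_0: "radial 0 = 0"
  by (simp add: radial_def)

lemma density_measurable [measurable]: "hrg_density \<alpha> \<nu> n \<in> borel_measurable borel"
proof -
  have "hrg_density \<alpha> \<nu> n \<in> borel_measurable (borel \<Otimes>\<^sub>M borel)"
    unfolding hrg_density_def[abs_def] by measurable
  then show ?thesis by (simp only: borel_prod)
qed

lemma emeasure_D:
  "A \<in> sets borel \<Longrightarrow> emeasure D A = (\<integral>\<^sup>+p. ennreal (hrg_density \<alpha> \<nu> n p) * indicator A p \<partial>lborel)"
  unfolding hrg_point_dist_def by (rule emeasure_density) auto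

lemma sets_D [measurable_cong]: "sets D = sets borel"
  by (simp add: hrg_point_dist_def)

lemma space_D: "space D = UNIV"
  by (simp add: hrg_point_dist_def)

lemma nn_integral_radial:
  assumes "0 \<le> \<rho>" "\<rho> \<le> R"
  shows "(\<integral>\<^sup>+r. ennreal (\<alpha> * sinh (\<alpha> * r) / (cosh (\<alpha> * R) - 1)) * indicator ({0..<R} \<inter> {..\<rho>}) r \<partial>lborel)
    = ennreal (radial \<rho>)"
proof -
  \<comment> \<open>The density vanishes at R, whereas the fundamental theorem of calculus is
    applied on a closed interval; the two differ only for \<rho> = R, on a null set.\<close>
  have "AE r in lborel. r \<noteq> R" by (rule AE_lborel_singleton)
  then have "(\<integral>\<^sup>+r. ennreal (\<alpha> * sinh (\<alpha> * r) / (cosh (\<alpha> * R) - 1)) * indicator ({0..<R} \<inter> {..\<rho>}) r \<partial>lborel)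
    = (\<integral>\<^sup>+r. ennreal (\<alpha> * sinh (\<alpha> * r) / (cosh (\<alpha> * R) - 1)) * indicator {0..\<rho>} r \<partial>lborel)"
    using assms by (intro nn_integral_cong_AE) (auto simp: indicator_def elim!: eventually_mono)
  also have "\<dots> = ennreal (radial \<rho> - radial 0)"
  proof (rule nn_integral_FTC_Icc)
    show "(radial has_real_derivative \<alpha> * sinh (\<alpha> * x) / (cosh (\<alpha> * R) - 1)) (at x)" for x
      unfolding radial_def[abs_def] using cosh_R
      by (auto intro!: derivative_eq_intros)
  qed (use assms alpha cosh_R in \<open>auto intro!: divide_nonneg_nonneg mult_nonneg_nonneg\<close>)
  finally show ?thesis by (simp add: radial_0)
qed

lemma emeasure_sector:
  assumes "0 \<le> \<rho>" "\<rho> \<le> R" and [measurable]: "S \<in> sets borel"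
  shows "emeasure D {p. fst p \<le> \<rho> \<and> snd p \<in> S}
    = ennreal (radial \<rho>) * (ennreal (1 / (2 * pi)) * emeasure lborel (S \<inter> {0..<2 * pi}))"
proof -
  let ?A = "{p :: real \<times> real. fst p \<le> \<rho> \<and> snd p \<in> S}"
  let ?F = "\<lambda>r. ennreal (\<alpha> * sinh (\<alpha> * r) / (cosh (\<alpha> * R) - 1)) * indicator ({0..<R} \<inter> {..\<rho>}) r"
  let ?G = "\<lambda>t. ennreal (1 / (2 * pi)) * indicator (S \<inter> {0..<2 * pi}) t"
  have A: "?A \<in> sets borel"
    by (rule sets_borel_pairI) measurable
  have "emeasure D ?A = (\<integral>\<^sup>+p. ennreal (hrg_density \<alpha> \<nu> n p) * indicator ?A p \<partial>lborel)"
    by (rule emeasure_D[OF A])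
  also have "\<dots> = (\<integral>\<^sup>+p. ?F (fst p) * ?G (snd p) \<partial>lborel)"
  proof (intro nn_integral_cong)
    fix p :: "real \<times> real"
    show "ennreal (hrg_density \<alpha> \<nu> n p) * indicator ?A p = ?F (fst p) * ?G (snd p)"
    proof (cases "p \<in> ?A \<and> 0 \<le> fst p \<and> fst p < R \<and> 0 \<le> snd p \<and> snd p < 2 * pi")
      case True
      then have "hrg_density \<alpha> \<nu> n p = \<alpha> * sinh (\<alpha> * fst p) / (cosh (\<alpha> * R) - 1) * (1 / (2 * pi))"
        by (simp add: hrg_density_def)
      moreover have "0 \<le> \<alpha> * sinh (\<alpha> * fst p) / (cosh (\<alpha> * R) - 1)"
        using True alpha cosh_R by (intro divide_nonneg_nonneg mult_nonneg_nonneg) auto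
      ultimately show ?thesis using True by (simp add: ennreal_mult'[symmetric])
    next
      case False
      then show ?thesis by (auto simp: hrg_density_def indicator_def)
    qed
  qed
  also have "\<dots> = (\<integral>\<^sup>+r. ?F r \<partial>lborel) * (\<integral>\<^sup>+t. ?G t \<partial>lborel)"
    by (intro nn_integral_product_lborel) measurable
  also have "(\<integral>\<^sup>+t. ?G t \<partial>lborel) = ennreal (1 / (2 * pi)) * emeasure lborel (S \<inter> {0..<2 * pi})"
    by (subst nn_integral_cmult_indicator) auto
  finally show ?thesis unfolding nn_integral_radial[OF assms(1,2)] .
qed

lemma emeasure_support:
  "emeasure D {p. 0 \<le> fst p \<and> fst p < R \<and> 0 \<le> snd p \<and> snd p < 2 * pi} = emeasure D UNIV"
proof -
  have A: "{p :: real \<times> real. 0 \<le> fst p \<and> fst p < R \<and> 0 \<le> snd p \<and> snd p < 2 * pi} \<in> sets borel"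
    by (rule sets_borel_pairI) measurable
  have U: "(UNIV :: (real \<times> real) set) \<in> sets borel" by simp
  show ?thesis
    unfolding emeasure_D[OF A] emeasure_D[OF U]
    by (intro nn_integral_cong) (auto simp: hrg_density_def indicator_def)
qed

lemma prob_space_D: "prob_space D"
proof
  have "emeasure D {p. fst p \<le> R \<and> snd p \<in> UNIV} = 1"
    using R by (subst emeasure_sector)
      (auto simp: radial_R ennreal_mult'[symmetric])
  moreover have "emeasure D {p. fst p \<le> R \<and> snd p \<in> UNIV} = emeasure D UNIV"
  proof (rule antisym)
    have B: "{p :: real \<times> real. fst p \<le> R \<and> snd p \<in> UNIV} \<in> sets D"
      unfolding sets_D by (rule sets_borel_pairI) measurable
    have "emeasure D {p. 0 \<le> fst p \<and> fst p < R \<and> 0 \<le> snd p \<and> snd p < 2 * pi}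
        \<le> emeasure D {p. fst p \<le> R \<and> snd p \<in> UNIV}" using B by (intro emeasure_mono) auto
    then show "emeasure D UNIV \<le> emeasure D {p. fst p \<le> R \<and> snd p \<in> UNIV}"
      by (simp only: emeasure_support)
    show "emeasure D {p. fst p \<le> R \<and> snd p \<in> UNIV} \<le> emeasure D UNIV"
      using space_D by (intro emeasure_mono) (auto simp: sets_D)
  qed
  ultimately show "emeasure D (space D) = 1" by (simp add: space_D)
qed

sublocale D: prob_space D by (rule prob_space_D)

sublocale P: poisson_sample D "real n"
  using n by unfold_locales simp

lemma measure_sector:
  assumes "0 \<le> \<rho>" "\<rho> \<le> R" and [measurable]: "S \<in> sets borel"
  shows "D.prob {p. fst p \<le> \<rho> \<and> snd p \<in> S}
    = radial \<rho> * (measure lborel (S \<inter> {0..<2 * pi}) / (2 * pi))"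
proof -
  have "emeasure lborel (S \<inter> {0..<2 * pi}) \<le> emeasure lborel {0..<2 * pi}" by (intro emeasure_mono) auto
  also have "\<dots> < \<infinity>" by simp
  finally have "emeasure lborel (S \<inter> {0..<2 * pi}) = ennreal (measure lborel (S \<inter> {0..<2 * pi}))"
    by (intro emeasure_eq_ennreal_measure) auto
  moreover have "0 \<le> radial \<rho>"
    unfolding radial_eq by (intro mult_nonneg_nonneg) auto
  ultimately show ?thesis
    using emeasure_sector[OF assms] unfolding D.emeasure_eq_measure
    by (simp add: ennreal_mult'[symmetric])
qed

lemma prob_support:
  "D.prob {p. \<not> (0 \<le> fst p \<and> fst p < R \<and> 0 \<le> snd p \<and> snd p < 2 * pi)} = 0"
proof -
  let ?A = "{p :: real \<times> real. 0 \<le> fst p \<and> fst p < R \<and> 0 \<le> snd p \<and> snd p < 2 * pi}"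
  have A: "?A \<in> sets D"
    unfolding sets_D by (rule sets_borel_pairI) measurable
  have "D.prob ?A = 1"
    using emeasure_support D.emeasure_space_1 by (simp add: D.emeasure_eq_measure space_D)
  moreover have "{p. \<not> (0 \<le> fst p \<and> fst p < R \<and> 0 \<le> snd p \<and> snd p < 2 * pi)} = space D - ?A"
    by (auto simp: space_D)
  ultimately show ?thesis using D.prob_compl[OF A] by simp
qed

lemma measure_sector_le:
  assumes "\<rho> \<le> R" and [measurable]: "S \<in> sets borel"
  shows "D.prob {p. fst p \<le> \<rho> \<and> snd p \<in> S}
    \<le> exp (- \<alpha> * (R - \<rho>)) * (measure lborel (S \<inter> {0..<2 * pi}) / (2 * pi))"
proof (cases "0 \<le> \<rho>")
  case True
  then show ?thesis
    using radial_le[OF True assms(1)] unfolding measure_sector[OF True assms]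
    by (intro mult_right_mono) auto
next
  case False
  have "{p :: real \<times> real. \<not> (0 \<le> fst p \<and> fst p < R \<and> 0 \<le> snd p \<and> snd p < 2 * pi)} \<in> sets D"
    unfolding sets_D by (rule sets_borel_pairI) measurable
  then have "D.prob {p. fst p \<le> \<rho> \<and> snd p \<in> S}
      \<le> D.prob {p. \<not> (0 \<le> fst p \<and> fst p < R \<and> 0 \<le> snd p \<and> snd p < 2 * pi)}"
    using False by (intro D.finite_measure_mono) auto
  then show ?thesis using prob_support by (simp add: mult_nonneg_nonneg order_trans[of _ 0])
qed

end

section \<open>Hyperbolic geometry\<close>

text \<open>With u = y / 2, the mean value theorem gives u cos u <= sin u. Doubling the angle turns
  this into u (1 + cos y) <= sin y, and cos y is nonnegative here.\<close>

lemma half_le_sin: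
  fixes y :: real
  assumes "0 \<le> y" "y \<le> pi / 2"
  shows "y / 2 \<le> sin y"
proof -
  define u where "u = y / 2"
  have u: "0 \<le> u" "u \<le> pi / 4" using assms by (auto simp: u_def)
  have c0: "0 \<le> cos u" using u pi_gt_zero by (intro cos_ge_zero) linarith+
  have "u * cos u \<le> sin u"
  proof (cases "u = 0")
    case False
    then have "0 < u" using u by simp
    then obtain z where z: "0 < z" "z < u" "sin u - sin 0 = (u - 0) * cos z"
      using MVT2[of 0 u sin cos] by (auto intro: DERIV_sin)
    have "cos u \<le> cos z" using z u pi_gt_zero by (intro cos_monotone_0_pi_le) linarith+
    then show ?thesis using z u by (auto intro: mult_left_mono)
  qed simp
  then have "2 * (u * cos u) * cos u \<le> 2 * sin u * cos u"
    using c0 by (intro mult_right_mono) auto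
  also have "\<dots> = sin y" using sin_double[of u] by (simp add: u_def)
  also have "2 * (u * cos u) * cos u = u * (1 + cos y)"
    using cos_double_cos[of u] by (simp add: u_def power2_eq_square field_simps)
  finally have "u * (1 + cos y) \<le> sin y" .
  moreover have "u * 1 \<le> u * (1 + cos y)"
    using u assms pi_gt_zero by (intro mult_left_mono) (auto intro!: cos_ge_zero)
  ultimately show ?thesis by (simp add: u_def)
qed

lemma one_minus_cos: "1 - cos x = 2 * (sin (x / 2))\<^sup>2" for x :: real
  using cos_double_sin[of "x / 2"] by simp

lemma one_minus_cos_ge:
  fixes x :: real
  assumes "\<bar>x\<bar> \<le> pi"
  shows "x\<^sup>2 / 8 \<le> 1 - cos x"
proof -
  have "\<bar>x\<bar> / 2 / 2 \<le> sin (\<bar>x\<bar> / 2)" using assms by (intro half_le_sin) auto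
  then have "(\<bar>x\<bar> / 2 / 2)\<^sup>2 \<le> (sin (\<bar>x\<bar> / 2))\<^sup>2" by (intro power_mono) auto
  moreover have "1 - cos x = 2 * (sin (\<bar>x\<bar> / 2))\<^sup>2"
    using one_minus_cos[of "\<bar>x\<bar>"] by simp
  ultimately show ?thesis by (simp add: power_divide)
qed

lemma one_minus_cos_le: "1 - cos x \<le> x\<^sup>2 / 2" for x :: real
proof -
  have "\<bar>sin (x / 2)\<bar>\<^sup>2 \<le> \<bar>x / 2\<bar>\<^sup>2" by (intro power_mono abs_sin_x_le_abs_x) auto
  then show ?thesis using one_minus_cos[of x] by (simp add: power_divide)
qed

text \<open>Folding the circle at angle \<open>pi\<close> onto an interval does not increase angular distances.\<close>

lemma cos_diff_le_fold:
  fixes t u :: real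
  assumes "0 \<le> t" "t < 2 * pi" "0 \<le> u" "u < 2 * pi"
  shows "cos (t - u) \<le> cos (\<bar>t - pi\<bar> - \<bar>u - pi\<bar>)"
proof -
  have s: "\<bar>sin x\<bar> = sin \<bar>x\<bar>" if "\<bar>x\<bar> \<le> pi" for x :: real
    using sin_ge_zero[of "\<bar>x\<bar>"] that by (cases "0 \<le> x") auto
  have "cos (t - u) = cos ((t - pi) - (u - pi))" by simp
  also have "\<dots> = cos (t - pi) * cos (u - pi) + sin (t - pi) * sin (u - pi)" by (rule cos_diff)
  \<comment> \<open>Folding keeps both cosines and replaces both sines by their absolute
    values.\<close>
  also have "\<dots> \<le> cos (t - pi) * cos (u - pi) + \<bar>sin (t - pi)\<bar> * \<bar>sin (u - pi)\<bar>"
    by (simp add: abs_mult[symmetric])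
  also have "\<dots> = cos \<bar>t - pi\<bar> * cos \<bar>u - pi\<bar> + sin \<bar>t - pi\<bar> * sin \<bar>u - pi\<bar>"
    using s[of "t - pi"] s[of "u - pi"] assms by (simp add: abs_le_iff)
  also have "\<dots> = cos (\<bar>t - pi\<bar> - \<bar>u - pi\<bar>)" by (rule cos_diff[symmetric])
  finally show ?thesis .
qed

definition hyp_arg :: "real \<times> real \<Rightarrow> real \<times> real \<Rightarrow> real" where
  "hyp_arg u v = cosh (fst u) * cosh (fst v) - sinh (fst u) * sinh (fst v) * cos (snd u - snd v)"

text \<open>Splits cosh of the distance into a radial part and a nonnegative angular part, which are
  estimated separately.\<close>

lemma hyp_arg_eq:
  "hyp_arg u v = cosh (fst u - fst v) + sinh (fst u) * sinh (fst v) * (1 - cos (snd u - snd v))"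
  by (simp add: hyp_arg_def cosh_diff algebra_simps)

text \<open>Removes \<open>arcosh\<close>, which inverts cosh only at arguments of at least 1;
  nonnegative radii guarantee this.\<close>

lemma hyp_dist_le_iff:
  assumes "0 \<le> fst u" "0 \<le> fst v" "0 \<le> r"
  shows "hyp_dist u v \<le> r \<longleftrightarrow> hyp_arg u v \<le> cosh r"
proof -
  have "0 \<le> sinh (fst u) * sinh (fst v) * (1 - cos (snd u - snd v))"
    using assms by (intro mult_nonneg_nonneg) auto
  then have 1: "1 \<le> hyp_arg u v" unfolding hyp_arg_eq using cosh_real_ge_1[of "fst u - fst v"] by linarith
  have "hyp_dist u v = arcosh (hyp_arg u v)" by (simp add: hyp_dist_def hyp_arg_def)
  then show ?thesis
    using cosh_real_nonneg_le_iff[of "arcosh (hyp_arg u v)" r] 1 assms(3) by simp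
qed

lemma cosh_le_exp: "0 \<le> x \<Longrightarrow> cosh x \<le> exp x" for x :: real
  by (simp add: cosh_def)

lemma exp_le_cosh: "exp x \<le> 2 * cosh x" for x :: real
  by (simp add: cosh_def)

lemma sinh_le_exp: "sinh x \<le> exp x / 2" for x :: real
  by (simp add: sinh_def)

lemma two_le_exp_one: "2 \<le> exp (1::real)"
  using exp_ge_add_one_self[of "1::real"] by simp

lemma sinh_ge_exp:
  assumes "1 \<le> x"
  shows "exp x / 4 \<le> sinh (x::real)"
proof -
  have "exp 1 \<le> exp x" using assms by simp
  then have e: "2 \<le> exp x" using two_le_exp_one by linarith
  then have "exp (- x) \<le> 1 / 2" by (simp add: exp_minus field_simps)
  then show ?thesis using e by (simp add: sinh_def)
qed

section \<open>Folded positions and weights\<close>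

context hrg
begin

text \<open>The scale is exp (R / 2) / 12. The 12 makes adjacency imply |X - X'| <= w w' with
  constant 1.\<close>

definition proj :: "real \<times> real \<Rightarrow> real" where
  "proj p = \<bar>snd p - pi\<bar> * (real n / (12 * \<nu>))"

definition wt :: "real \<times> real \<Rightarrow> real" where
  "wt p = exp ((R - fst p) / 2)"

text \<open>The extra 1 keeps \<open>proj p < real cells\<close> strict at angle 0, where
  \<open>proj\<close> is largest.\<close>

definition cells :: nat where
  "cells = nat \<lceil>pi * (real n / (12 * \<nu>))\<rceil> + 1"

text \<open>Only the angular part of cosh of the distance is used. Radii of at least 1 give sinh r
  >= exp r / 4; smaller radii are excluded later, since they would mean too large a weight.\<close>

lemma adj_imp_proj_close:
  assumes u: "1 \<le> fst u" "0 \<le> snd u" "snd u < 2 * pi"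
    and v: "1 \<le> fst v" "0 \<le> snd v" "snd v < 2 * pi"
    and d: "hyp_dist u v \<le> R"
  shows "\<bar>proj u - proj v\<bar> \<le> wt u * wt v"
proof -
  define x where "x = \<bar>snd u - pi\<bar> - \<bar>snd v - pi\<bar>"
  have x: "\<bar>x\<bar> \<le> pi" using u v by (auto simp: x_def)
  define e where "e = exp (fst u) * exp (fst v)"
  have e: "0 < e" by (simp add: e_def)
  have "hyp_arg u v \<le> cosh R" using d u v R by (subst hyp_dist_le_iff[symmetric]) auto
  then have 1: "sinh (fst u) * sinh (fst v) * (1 - cos (snd u - snd v)) \<le> exp R"
    unfolding hyp_arg_eq using cosh_le_exp[of R] R cosh_real_ge_1[of "fst u - fst v"] by linarith
  have "e / 16 * (x\<^sup>2 / 8) \<le> sinh (fst u) * sinh (fst v) * (1 - cos (snd u - snd v))"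
  proof (intro mult_mono)
    have "(exp (fst u) / 4) * (exp (fst v) / 4) \<le> sinh (fst u) * sinh (fst v)"
      using u v by (intro mult_mono sinh_ge_exp) auto
    then show "e / 16 \<le> sinh (fst u) * sinh (fst v)" by (simp add: e_def)
    show "x\<^sup>2 / 8 \<le> 1 - cos (snd u - snd v)"
      using one_minus_cos_ge[OF x] cos_diff_le_fold[of "snd u" "snd v"] u v by (simp add: x_def)
  qed (use u v in auto)
  then have "e * x\<^sup>2 \<le> 128 * exp R" using 1 by simp
  then have "x\<^sup>2 \<le> 128 * (exp R / e)" using e by (simp add: field_simps)
  \<comment> \<open>128 = 16 * 8 from the bounds on sinh and cosine is rounded up to the square
    12^2.\<close>
  also have "\<dots> \<le> 144 * (exp R / e)" using e by (intro mult_right_mono) auto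
  also have "\<dots> = (12 * exp ((R - fst u - fst v) / 2))\<^sup>2"
    by (simp add: power_mult_distrib e_def power2_eq_square exp_add[symmetric] exp_diff)
  finally have x12: "\<bar>x\<bar> \<le> 12 * exp ((R - fst u - fst v) / 2)"
    by (subst (asm) abs_le_square_iff[symmetric]) auto
  have "proj u - proj v = x * (real n / (12 * \<nu>))"
    by (simp only: proj_def x_def left_diff_distrib)
  then have "\<bar>proj u - proj v\<bar> = \<bar>x\<bar> * (real n / (12 * \<nu>))"
    using nu by (simp add: abs_mult)
  also have "\<dots> \<le> (12 * exp ((R - fst u - fst v) / 2)) * (real n / (12 * \<nu>))"
    using x12 nu by (intro mult_right_mono) auto
  also have "\<dots> = exp (R / 2) * exp ((R - fst u - fst v) / 2)"
    using nu by (simp add: exp_half_R)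
  also have "\<dots> = wt u * wt v"
    by (simp add: wt_def exp_add[symmetric] add_divide_distrib[symmetric] diff_divide_distrib)
  finally show ?thesis .
qed

lemma wt_ge_iff: "0 < t \<Longrightarrow> t \<le> wt p \<longleftrightarrow> fst p \<le> R - 2 * ln t"
proof -
  assume t: "0 < t"
  have "t \<le> wt p \<longleftrightarrow> exp (ln t) \<le> exp ((R - fst p) / 2)" unfolding wt_def using t by simp
  also have "\<dots> \<longleftrightarrow> ln t \<le> (R - fst p) / 2" by (simp only: exp_le_cancel_iff)
  also have "\<dots> \<longleftrightarrow> fst p \<le> R - 2 * ln t" by auto
  finally show ?thesis .
qed

lemma proj_measurable: "proj \<in> borel_measurable D"
proof -
  have "proj \<in> borel_measurable (borel \<Otimes>\<^sub>M borel)" unfolding proj_def[abs_def] by measurable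
  then show ?thesis by (simp add: borel_prod measurable_cong_sets[OF sets_D refl])
qed

lemma wt_measurable: "wt \<in> borel_measurable D"
proof -
  have "wt \<in> borel_measurable (borel \<Otimes>\<^sub>M borel)" unfolding wt_def[abs_def] by measurable
  then show ?thesis by (simp add: borel_prod measurable_cong_sets[OF sets_D refl])
qed

lemma support_proj_wt: "D.prob {p. \<not> (0 \<le> proj p \<and> proj p < real cells \<and> 1 \<le> wt p)} = 0"
proof -
  let ?N = "{p :: real \<times> real. \<not> (0 \<le> fst p \<and> fst p < R \<and> 0 \<le> snd p \<and> snd p < 2 * pi)}"
  have N: "?N \<in> sets D" unfolding sets_D by (rule sets_borel_pairI) measurable
  have "0 \<le> proj p \<and> proj p < real cells \<and> 1 \<le> wt p"
    if *: "0 \<le> fst p \<and> fst p < R \<and> 0 \<le> snd p \<and> snd p < 2 * pi" for p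
  proof -
    have "\<bar>snd p - pi\<bar> \<le> pi" using * by auto
    then have "proj p \<le> pi * (real n / (12 * \<nu>))"
      unfolding proj_def using nu by (intro mult_right_mono) auto
    then have "proj p < real cells" unfolding cells_def by linarith
    moreover have "0 \<le> proj p" using nu by (simp add: proj_def)
    moreover have "1 \<le> wt p" using * by (simp add: wt_def)
    ultimately show ?thesis by blast
  qed
  then have "{p. \<not> (0 \<le> proj p \<and> proj p < real cells \<and> 1 \<le> wt p)} \<subseteq> ?N" by blast
  then have "D.prob {p. \<not> (0 \<le> proj p \<and> proj p < real cells \<and> 1 \<le> wt p)} \<le> D.prob ?N"
    using N by (intro D.finite_measure_mono)
  then show ?thesis using prob_support by (simp add: order_antisym)
qed

text \<open>Weight at least t means radius at most R - 2 ln t, which has probability at most t^(-2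
  \<alpha>). Two arcs fold onto one interval, so a unit of length carries at most n * 2 * (12 \<nu>
  / n) / (2 pi) = 12 \<nu> / pi points on average.\<close>

lemma intensity_proj_wt:
  assumes "a \<le> b" "1 \<le> t"
  shows "real n * D.prob {p. a \<le> proj p \<and> proj p < b \<and> t \<le> wt p} \<le> 12 * \<nu> / pi * (b - a) * t powr (- 2 * \<alpha>)"
proof -
  define q where "q = 12 * \<nu> / real n"
  have q: "0 < q" "real n * q = 12 * \<nu>" using n nu by (auto simp: q_def)
  define S where "S = {\<theta>. a * q \<le> \<bar>\<theta> - pi\<bar> \<and> \<bar>\<theta> - pi\<bar> < b * q}"
  have S [measurable]: "S \<in> sets borel" unfolding S_def by measurable
  have pq: "proj p * q = \<bar>snd p - pi\<bar>" for p using n nu by (simp add: proj_def q_def)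
  have "{p. a \<le> proj p \<and> proj p < b \<and> t \<le> wt p} = {p. fst p \<le> R - 2 * ln t \<and> snd p \<in> S}"
  proof -
    have "a \<le> proj p \<longleftrightarrow> a * q \<le> \<bar>snd p - pi\<bar>" for p using q by (simp flip: pq)
    moreover have "proj p < b \<longleftrightarrow> \<bar>snd p - pi\<bar> < b * q" for p using q by (simp flip: pq)
    ultimately show ?thesis using assms by (auto simp: S_def wt_ge_iff)
  qed
  also have "D.prob \<dots> \<le> exp (- \<alpha> * (R - (R - 2 * ln t))) * (measure lborel (S \<inter> {0..<2 * pi}) / (2 * pi))"
    using assms by (intro measure_sector_le) auto
  also have "exp (- \<alpha> * (R - (R - 2 * ln t))) = t powr (- 2 * \<alpha>)"
    using assms by (simp add: powr_def mult_ac)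
  also have "measure lborel (S \<inter> {0..<2 * pi}) / (2 * pi) \<le> (2 * (b * q - a * q)) / (2 * pi)"
  proof (intro divide_right_mono)
    \<comment> \<open>The two arcs that fold onto the interval from \<open>a\<close> to
      \<open>b\<close>.\<close>
    let ?I = "{pi + a * q..pi + b * q}" and ?J = "{pi - b * q..pi - a * q}"
    have ab: "a * q \<le> b * q" using assms q by (intro mult_right_mono) auto
    have "measure lborel (S \<inter> {0..<2 * pi}) \<le> measure lborel (?I \<union> ?J)"
    proof (rule measure_mono_fmeasurable)
      show "?I \<union> ?J \<in> fmeasurable lborel"
        by (intro fmeasurable.Un fmeasurableI emeasure_bounded_finite) auto
    qed (auto simp: S_def)
    also have "\<dots> \<le> measure lborel ?I + measure lborel ?J"
      by (intro measure_Un_le) auto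
    also have "\<dots> = 2 * (b * q - a * q)" using ab by simp
    finally show "measure lborel (S \<inter> {0..<2 * pi}) \<le> 2 * (b * q - a * q)" .
  qed simp
  finally have "D.prob {p. a \<le> proj p \<and> proj p < b \<and> t \<le> wt p}
      \<le> t powr (- 2 * \<alpha>) * ((2 * (b * q - a * q)) / (2 * pi))" by (simp add: mult_left_mono)
  then have "real n * D.prob {p. a \<le> proj p \<and> proj p < b \<and> t \<le> wt p}
      \<le> real n * (t powr (- 2 * \<alpha>) * ((2 * (b * q - a * q)) / (2 * pi)))"
    by (intro mult_left_mono) auto
  also have "\<dots> = (real n * q) / pi * (b - a) * t powr (- 2 * \<alpha>)"
    by (simp add: field_simps)
  finally show ?thesis unfolding q(2) .
qed

sublocale W: poisson_weighted D "real n" proj wt cells \<alpha> "12 * \<nu> / pi"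
  using proj_measurable wt_measurable space_D alpha nu support_proj_wt intensity_proj_wt
  by unfold_locales auto

text \<open>Each part of \<open>hyp_arg\<close> takes half of cosh R. The radii differ by at most R
  - 2, and exp 2 >= 4 handles the radial part; in the angular part the squared angle exp (- r0)
  cancels exp r0.\<close>

lemma hyp_dist_le_if_close:
  assumes "2 \<le> R" "0 \<le> fst u" "fst u \<le> r0" "r0 \<le> R - 2" "0 \<le> fst v" "fst v \<le> R - 2"
    and c: "\<bar>snd u - snd v\<bar> \<le> exp (- r0 / 2)"
  shows "hyp_dist u v \<le> R"
proof -
  have e2: "4 \<le> exp (2::real)"
  proof -
    have "(2::real) * 2 \<le> exp 1 * exp 1" using two_le_exp_one by (intro mult_mono) auto
    then show ?thesis by (simp add: exp_add[symmetric])
  qed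
  have c1: "cosh (fst u - fst v) \<le> cosh R / 2"
  proof -
    have "cosh (fst u - fst v) \<le> cosh (R - 2)"
      using assms cosh_real_nonneg_le_iff[of "\<bar>fst u - fst v\<bar>" "R - 2"] by simp
    moreover define a where "a = exp (R - 2)"
    moreover have "4 * a \<le> exp R"
      using mult_right_mono[OF e2, of a] by (simp add: a_def exp_add[symmetric])
    moreover define b where "b = exp (- (R - 2))"
    moreover have "b \<le> a" using assms(1) by (simp add: a_def b_def)
    moreover have "exp R \<le> 2 * cosh R" by (rule exp_le_cosh)
    moreover have "cosh (R - 2) = (a + b) / 2" by (simp add: cosh_def a_def b_def)
    ultimately show ?thesis by argo
  qed
  have "sinh (fst u) * sinh (fst v) * (1 - cos (snd u - snd v)) \<le> (exp r0 / 2) * (exp R / 2) * (exp (- r0) / 2)"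
  proof (intro mult_mono)
    have "sinh (fst u) \<le> exp (fst u) / 2" "exp (fst u) \<le> exp r0" using assms sinh_le_exp by auto
    then show "sinh (fst u) \<le> exp r0 / 2" by linarith
    have "sinh (fst v) \<le> exp (fst v) / 2" "exp (fst v) \<le> exp R" using assms sinh_le_exp by auto
    then show "sinh (fst v) \<le> exp R / 2" by linarith
    have "\<bar>snd u - snd v\<bar>\<^sup>2 \<le> (exp (- r0 / 2))\<^sup>2" using c by (intro power_mono) auto
    also have "\<dots> = exp (- r0)" by (simp add: power2_eq_square exp_add[symmetric])
    finally show "1 - cos (snd u - snd v) \<le> exp (- r0) / 2"
      using one_minus_cos_le[of "snd u - snd v"] by simp
  qed (use assms in auto)
  also have "\<dots> = exp R / 8 * (exp r0 * exp (- r0))" by simp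
  also have "\<dots> = exp R / 8" by (simp add: exp_minus)
  also have "\<dots> \<le> cosh R / 2" using exp_le_cosh[of R] cosh_real_ge_1[of R] by linarith
  finally have "hyp_arg u v \<le> cosh R" unfolding hyp_arg_eq using c1 by linarith
  then show ?thesis using assms by (subst hyp_dist_le_iff) auto
qed

end

section \<open>The largest component with high probability\<close>

lemma cosh_measurable [measurable]: "(cosh :: real \<Rightarrow> real) \<in> borel_measurable borel"
  by (intro borel_measurable_continuous_onI continuous_intros)

lemma le_largest_component_size:
  "v < k \<Longrightarrow> s \<le> card (component_of k adj v) \<Longrightarrow> s \<le> largest_component_size k adj"
  by (auto simp: largest_component_size_def intro!: order_trans[OF _ Max_ge])

lemma largest_component_size_le:
  assumes "\<And>v. real (card (component_of k adj v)) \<le> b" "0 \<le> b"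
  shows "real (largest_component_size k adj) \<le> b"
proof (cases "k = 0")
  case False
  then have "largest_component_size k adj \<in> (\<lambda>v. card (component_of k adj v)) ` {..<k}"
    unfolding largest_component_size_def by (auto intro!: Max_in)
  then show ?thesis using assms by auto
qed (use assms in \<open>simp add: largest_component_size_def\<close>)

section \<open>Events of the random graph\<close>

context hrg
begin

lemma hyp_dist_measurable:
  assumes "i < k" "j < k"
  shows "(\<lambda>x. hyp_dist (x i) (x j)) \<in> borel_measurable (PiM {..<k} (\<lambda>_. D))"
proof -
  have m: "(\<lambda>x. x i) \<in> measurable (PiM {..<k} (\<lambda>_. D)) (borel \<Otimes>\<^sub>M borel)" if "i < k" for i
  proof -
    have "(\<lambda>x. x i) \<in> measurable (PiM {..<k} (\<lambda>_. D)) D"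
      using that by (intro measurable_component_singleton) simp
    then show ?thesis by (simp add: borel_prod measurable_cong_sets[OF refl sets_D])
  qed
  note [measurable] = m[OF assms(1)] m[OF assms(2)]
  show ?thesis unfolding hyp_dist_def arcosh_def by measurable
qed

text \<open>There are finitely many graphs on \<open>k\<close> vertices, so an arbitrary property
  \<Psi> of the graph is a finite union of events that prescribe the graph. No measurability of
  component sizes has to be shown.\<close>

lemma adjacency_event:
  "{x\<in>space (PiM {..<k} (\<lambda>_. D)). \<Psi> (hrg_adj \<nu> n k x)} \<in> sets (PiM {..<k} (\<lambda>_. D))"
proof -
  let ?M = "PiM {..<k} (\<lambda>_. D)" and ?P = "{..<k} \<times> {..<k}"
  define graph where "graph x = {p \<in> ?P. hrg_adj \<nu> n k x (fst p) (snd p)}" for x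
  have adj: "hrg_adj \<nu> n k x = (\<lambda>i j. (i, j) \<in> graph x)" for x
    by (auto simp: fun_eq_iff graph_def hrg_adj_def)
  have "{x\<in>space ?M. hrg_adj \<nu> n k x (fst p) (snd p)} \<in> sets ?M" if "p \<in> ?P" for p
  proof -
    have [measurable]: "(\<lambda>x. hyp_dist (x (fst p)) (x (snd p))) \<in> borel_measurable ?M"
      using that by (intro hyp_dist_measurable) auto
    show ?thesis unfolding hrg_adj_def by measurable
  qed
  then have "{x\<in>space ?M. \<forall>p\<in>?P. hrg_adj \<nu> n k x (fst p) (snd p) = (p \<in> S)} \<in> sets ?M" for S
    by (intro sets.sets_Collect_finite_All) (auto simp: eq_commute[of _ "_ \<in> S"])
  moreover have "graph x = S \<longleftrightarrow> (\<forall>p\<in>?P. hrg_adj \<nu> n k x (fst p) (snd p) = (p \<in> S))"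
    if "S \<subseteq> ?P" for S x using that by (auto simp: graph_def)
  ultimately have g: "{x\<in>space ?M. graph x = S} \<in> sets ?M" if "S \<subseteq> ?P" for S
    using that by simp
  have "{x\<in>space ?M. \<Psi> (hrg_adj \<nu> n k x)}
     = (\<Union>S\<in>{S \<in> Pow ?P. \<Psi> (\<lambda>i j. (i, j) \<in> S)}. {x\<in>space ?M. graph x = S})"
    unfolding adj by (auto simp: graph_def)
  also have "\<dots> \<in> sets ?M"
    using g by (intro sets.finite_UN) auto
  finally show ?thesis .
qed

lemma poi_prob_eq:
  fixes Q :: "nat \<Rightarrow> (nat \<Rightarrow> nat \<Rightarrow> bool) \<Rightarrow> bool"
  shows "poi_prob \<alpha> \<nu> n (\<lambda>k x. Q k (hrg_adj \<nu> n k x))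
    = P.Om.prob {\<omega>\<in>space P.sample_space. Q (fst \<omega>) (hrg_adj \<nu> n (fst \<omega>) (snd \<omega>))}" (is ?th1)
    and "{\<omega>\<in>space P.sample_space. Q (fst \<omega>) (hrg_adj \<nu> n (fst \<omega>) (snd \<omega>))} \<in> P.Om.events" (is ?th2)
proof -
  have loc: "hrg_adj \<nu> n k (restrict x {..<k}) = hrg_adj \<nu> n k x" for k x
    by (auto simp: fun_eq_iff hrg_adj_def)
  note * = P.prob_sample_space[of "\<lambda>k x. Q k (hrg_adj \<nu> n k x)", OF adjacency_event, unfolded loc, OF refl]
  show ?th1 unfolding poi_prob_def hrg_config_space_def *(1) ..
  show ?th2 by (rule *(2))
qed

lemma poi_prob_le_1: "poi_prob \<alpha> \<nu> n (\<lambda>k x. Q k (hrg_adj \<nu> n k x)) \<le> 1"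
  unfolding poi_prob_eq by (rule P.Om.prob_le_1)

text \<open>The circle is divided into \<open>G\<close> arcs of angle at most exp (- r0 / 2), and
  each arc into \<open>s\<close> boxes of points with radius at most R - 2. If some point has radius
  at most \<open>r0\<close> and all boxes are occupied, that point is adjacent to, or equal to, one
  point in each box of its own arc. Asking for all boxes avoids conditioning on the place of the
  central point.\<close>

lemma large_component_event:
  fixes G s :: nat
  assumes r0: "1 \<le> r0" "r0 \<le> R - 2" and G: "1 \<le> G" "2 * pi / G \<le> exp (- r0 / 2)" and s: "1 \<le> s"
  obtains L where "L \<in> P.Om.events"
    and "1 - (exp (- real n * exp (- \<alpha> * (R - r0)) / 4)
          + real (G * s) * exp (- real n * exp (- 2 * \<alpha>) / (4 * real (G * s)))) \<le> P.Om.prob L"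
    and "\<And>\<omega> i. \<omega> \<in> L \<Longrightarrow> i < fst \<omega> \<Longrightarrow> 0 \<le> fst (snd \<omega> i) \<and> fst (snd \<omega> i) < R \<and>
          0 \<le> snd (snd \<omega> i) \<and> snd (snd \<omega> i) < 2 * pi"
    and "\<And>\<omega>. \<omega> \<in> L \<Longrightarrow> s \<le> largest_component_size (fst \<omega>) (hrg_adj \<nu> n (fst \<omega>) (snd \<omega>))"
proof -
  let ?B = "real (G * s)"
  have B: "0 < ?B" using G s by simp
  define null where "null = {p. \<not> (0 \<le> fst p \<and> fst p < R \<and> 0 \<le> snd p \<and> snd p < 2 * pi)}"
  have null [measurable]: "null \<in> sets D"
    unfolding null_def sets_D by (rule sets_borel_pairI) measurable
  define core where "core = {p :: real \<times> real. fst p \<le> r0 \<and> snd p \<in> {0..<2 * pi}}"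
  have core [measurable]: "core \<in> sets D"
    unfolding core_def sets_D by (rule sets_borel_pairI) measurable
  define box where "box t = {p :: real \<times> real. fst p \<le> R - 2 \<and>
      snd p \<in> {real t * (2 * pi / ?B)..<real (Suc t) * (2 * pi / ?B)}}" for t
  have box [measurable]: "box t \<in> sets D" for t
    unfolding box_def sets_D by (rule sets_borel_pairI) measurable
  define U where "U = {\<omega>\<in>space P.sample_space. P.occupied null \<omega>}"
  define V where "V = {\<omega>\<in>space P.sample_space. \<not> P.occupied core \<omega>}"
  define W where "W t = {\<omega>\<in>space P.sample_space. \<not> P.occupied (box t) \<omega>}" for t
  have ev: "U \<in> P.Om.events" "V \<in> P.Om.events" "W t \<in> P.Om.events" for t
    unfolding U_def V_def W_def by measurable
  then have evW: "(\<Union>t\<in>{..<G * s}. W t) \<in> P.Om.events" by (intro sets.finite_UN) auto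
  have pU: "P.Om.prob U = 0"
    unfolding U_def using P.prob_occupied[OF null] prob_support by (simp add: null_def)
  have pV: "P.Om.prob V \<le> exp (- real n * exp (- \<alpha> * (R - r0)) / 4)"
  proof -
    have "D.prob core = radial r0 * (measure lborel ({0..<2 * pi} \<inter> {0..<2 * pi}) / (2 * pi))"
      unfolding core_def using r0 by (intro measure_sector) auto
    then have "exp (- \<alpha> * (R - r0)) / 4 \<le> D.prob core" using radial_ge[of r0] r0 by simp
    then have "real n * (exp (- \<alpha> * (R - r0)) / 4) \<le> real n * D.prob core"
      by (intro mult_left_mono) auto
    moreover have "P.Om.prob V = exp (- real n * D.prob core)"
      unfolding V_def by (rule P.prob_not_occupied[OF core])
    ultimately show ?thesis by simp
  qed
  have pW: "P.Om.prob (W t) \<le> exp (- real n * exp (- 2 * \<alpha>) / (4 * ?B))" if t: "t < G * s" for t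
  proof -
    let ?I = "{real t * (2 * pi / ?B)..<real (Suc t) * (2 * pi / ?B)}"
    have "real (Suc t) * (2 * pi / ?B) \<le> ?B * (2 * pi / ?B)"
      using t by (intro mult_right_mono) (auto simp del: of_nat_Suc of_nat_mult)
    also have "\<dots> = 2 * pi" using B by (simp del: of_nat_mult)
    finally have top: "real (Suc t) * (2 * pi / ?B) \<le> 2 * pi" .
    have bot: "0 \<le> real t * (2 * pi / ?B)" by simp
    have "?I \<inter> {0..<2 * pi} = ?I"
    proof (intro equalityI subsetI IntI)
      fix x assume x: "x \<in> ?I"
      then show "x \<in> {0..<2 * pi}" using top bot
        by (meson atLeastLessThan_iff order_trans less_le_trans)
    qed auto
    moreover have "real t * (2 * pi / ?B) \<le> real (Suc t) * (2 * pi / ?B)"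
      by (intro mult_right_mono) auto
    moreover have "real (Suc t) * (2 * pi / ?B) - real t * (2 * pi / ?B) = 2 * pi / ?B"
      by (simp add: algebra_simps add_divide_distrib)
    ultimately have "measure lborel (?I \<inter> {0..<2 * pi}) = 2 * pi / ?B" by simp
    then have "D.prob (box t) = radial (R - 2) * ((2 * pi / ?B) / (2 * pi))"
      unfolding box_def using r0 by (subst measure_sector) auto
    also have "\<dots> = radial (R - 2) / ?B" by simp
    finally have "D.prob (box t) = radial (R - 2) / ?B" .
    moreover have "exp (- 2 * \<alpha>) / 4 \<le> radial (R - 2)"
      using radial_ge[of "R - 2"] r0 by (simp add: mult.commute)
    ultimately have "exp (- 2 * \<alpha>) / 4 / ?B \<le> D.prob (box t)"
      using B by (metis divide_right_mono less_imp_le)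
    then have "real n * (exp (- 2 * \<alpha>) / 4 / ?B) \<le> real n * D.prob (box t)"
      by (intro mult_left_mono) auto
    moreover have "P.Om.prob (W t) = exp (- real n * D.prob (box t))"
      unfolding W_def by (rule P.prob_not_occupied[OF box])
    ultimately show ?thesis by simp
  qed
  define bad where "bad = U \<union> (V \<union> (\<Union>t\<in>{..<G * s}. W t))"
  have ev_bad: "bad \<in> P.Om.events" unfolding bad_def using ev evW by (intro sets.Un)
  have "P.Om.prob bad \<le> exp (- real n * exp (- \<alpha> * (R - r0)) / 4)
          + ?B * exp (- real n * exp (- 2 * \<alpha>) / (4 * ?B))"
  proof -
    have "P.Om.prob bad \<le> P.Om.prob U + P.Om.prob (V \<union> (\<Union>t\<in>{..<G * s}. W t))"
      unfolding bad_def using ev evW by (intro measure_subadditive sets.Un) auto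
    moreover have "P.Om.prob (V \<union> (\<Union>t\<in>{..<G * s}. W t)) \<le> P.Om.prob V + P.Om.prob (\<Union>t\<in>{..<G * s}. W t)"
      using ev evW by (intro measure_subadditive) auto
    moreover have "P.Om.prob (\<Union>t\<in>{..<G * s}. W t) \<le> (\<Sum>t\<in>{..<G * s}. P.Om.prob (W t))"
      using ev by (intro P.Om.finite_measure_subadditive_finite) auto
    moreover have "(\<Sum>t\<in>{..<G * s}. P.Om.prob (W t))
        \<le> (\<Sum>t\<in>{..<G * s}. exp (- real n * exp (- 2 * \<alpha>) / (4 * ?B)))"
      using pW by (intro sum_mono) auto
    ultimately show ?thesis using pU pV by simp
  qed
  moreover have "P.Om.prob (space P.sample_space - bad) = 1 - P.Om.prob bad"
    using ev_bad by (rule P.Om.prob_compl)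
  ultimately have prob: "1 - (exp (- real n * exp (- \<alpha> * (R - r0)) / 4)
          + ?B * exp (- real n * exp (- 2 * \<alpha>) / (4 * ?B))) \<le> P.Om.prob (space P.sample_space - bad)"
    by linarith
  have supp: "0 \<le> fst (snd \<omega> i) \<and> fst (snd \<omega> i) < R \<and> 0 \<le> snd (snd \<omega> i) \<and> snd (snd \<omega> i) < 2 * pi"
    if "\<omega> \<in> space P.sample_space - bad" "i < fst \<omega>" for \<omega> i
    using that unfolding bad_def U_def P.occupied_def null_def by blast
  have large: "s \<le> largest_component_size (fst \<omega>) (hrg_adj \<nu> n (fst \<omega>) (snd \<omega>))"
    if w: "\<omega> \<in> space P.sample_space - bad" for \<omega>
  proof -
    define k where "k = fst \<omega>"
    define x where "x = snd \<omega>"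
    note sup = supp[OF w, folded k_def x_def]
    have "P.occupied core \<omega>" using w by (auto simp: bad_def V_def)
    then obtain v where v: "v < k" "fst (x v) \<le> r0" "0 \<le> snd (x v)" "snd (x v) < 2 * pi"
      by (auto simp: P.occupied_def core_def k_def x_def)
    have "\<forall>t. \<exists>i. t < G * s \<longrightarrow> i < k \<and> x i \<in> box t"
      using w by (auto simp: bad_def W_def P.occupied_def k_def x_def)
    then obtain f where f: "\<And>t. t < G * s \<Longrightarrow> f t < k" "\<And>t. t < G * s \<Longrightarrow> x (f t) \<in> box t"
      by metis
    define d where "d = 2 * pi / ?B"
    have d: "0 < d" using B by (simp add: d_def)
    have ds: "real s * d * real G = 2 * pi" using G s by (simp add: d_def)
    \<comment> \<open>The arc that contains \<open>v\<close>; its boxes are numbered g s, ..., g s +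
      s - 1.\<close>
    define g where "g = nat \<lfloor>snd (x v) / (s * d)\<rfloor>"
    have sd: "0 < s * d" using d s by simp
    have "0 \<le> snd (x v) / (s * d)" using v sd by simp
    then have "real g \<le> snd (x v) / (s * d)" "snd (x v) / (s * d) < real g + 1"
      unfolding g_def by linarith+
    then have g: "real g * (s * d) \<le> snd (x v)" "snd (x v) < (real g + 1) * (s * d)"
      using sd by (simp_all add: pos_le_divide_eq pos_divide_less_eq)
    have gG: "g < G"
    proof -
      have "real g * (s * d) < real G * (s * d)" using g(1) v(4) ds by (simp add: mult_ac)
      then show ?thesis using sd by (simp only: mult_less_cancel_right_pos of_nat_less_iff)
    qed
    have T: "t < G * s" if "g * s \<le> t" "t < g * s + s" for t
    proof -
      have "g * s + s = (g + 1) * s" by simp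
      also have "\<dots> \<le> G * s" using gG by (intro mult_right_mono) auto
      finally show ?thesis using that by simp
    qed
    \<comment> \<open>The point chosen in a box can be \<open>v\<close> itself, which lies in the
      component anyway.\<close>
    have adj: "f t = v \<or> hrg_adj \<nu> n k x v (f t)" if t: "g * s \<le> t" "t < g * s + s" for t
    proof (cases "f t = v")
      case False
      have ft: "f t < k" "x (f t) \<in> box t" using f T[OF t] by auto
      have b: "fst (x (f t)) \<le> R - 2" "real t * d \<le> snd (x (f t))" "snd (x (f t)) < real (Suc t) * d"
        using ft(2) by (auto simp: box_def d_def simp del: of_nat_Suc of_nat_mult)
      have "real (g * s) * d \<le> real t * d" "real (Suc t) * d \<le> real (g * s + s) * d"
        using t d by (intro mult_right_mono of_nat_mono; simp)+
      moreover have "real (g * s) * d = real g * (s * d)" "real (g * s + s) * d = (real g + 1) * (s * d)"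
        by (simp_all add: algebra_simps)
      ultimately have "real g * (s * d) \<le> snd (x (f t))" "snd (x (f t)) < (real g + 1) * (s * d)"
        using b by linarith+
      then have "\<bar>snd (x v) - snd (x (f t))\<bar> \<le> s * d" using g by (simp add: algebra_simps abs_le_iff)
      also have "s * d = 2 * pi / G" using ds G by (simp add: field_simps)
      also have "\<dots> \<le> exp (- r0 / 2)" by (rule G)
      finally have "hyp_dist (x v) (x (f t)) \<le> R"
        using r0 v b sup[OF ft(1)] sup[OF v(1)] by (intro hyp_dist_le_if_close[of _ r0]) auto
      then show ?thesis using False ft v by (simp add: hrg_adj_def)
    qed simp
    have "f ` {g * s..<g * s + s} \<subseteq> component_of k (hrg_adj \<nu> n k x) v"
    proof
      fix u assume "u \<in> f ` {g * s..<g * s + s}"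
      then obtain t where t: "u = f t" "g * s \<le> t" "t < g * s + s" by auto
      then have "u < k" using f T by auto
      then show "u \<in> component_of k (hrg_adj \<nu> n k x) v"
        using adj[OF t(2,3)] t(1) by (auto simp: component_of_def)
    qed
    then have "card (f ` {g * s..<g * s + s}) \<le> card (component_of k (hrg_adj \<nu> n k x) v)"
      by (intro card_mono) (auto simp: component_of_def)
    moreover have "inj_on f {g * s..<g * s + s}"
    proof (intro inj_onI)
      fix t t' assume t: "t \<in> {g * s..<g * s + s}" "t' \<in> {g * s..<g * s + s}" "f t = f t'"
      have "x (f t) \<in> box t" "x (f t') \<in> box t'" using f(2)[OF T] t(1,2) by auto
      then have "x (f t) \<in> box t" "x (f t) \<in> box t'" using t(3) by auto
      then have "real t * d \<le> snd (x (f t))" "snd (x (f t)) < real (Suc t) * d"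
        "real t' * d \<le> snd (x (f t))" "snd (x (f t)) < real (Suc t') * d"
        by (auto simp: box_def d_def simp del: of_nat_Suc of_nat_mult)
      then have "real t * d < real (Suc t') * d" "real t' * d < real (Suc t) * d" by linarith+
      then have "t < Suc t'" "t' < Suc t" using d by (simp_all only: mult_less_cancel_right_pos of_nat_less_iff)
      then show "t = t'" by simp
    qed
    ultimately have "s \<le> card (component_of k (hrg_adj \<nu> n k x) v)" by (simp add: card_image)
    then show ?thesis using v(1) le_largest_component_size by (simp add: k_def x_def)
  qed
  show ?thesis
    by (rule that[of "space P.sample_space - bad"]) (use ev_bad prob supp large in auto)
qed

text \<open>The two good events are not independent; they are joined by P(U and L) >= P(U) + P(L) -
  1.\<close>

lemma poi_prob_largest_component:
  fixes M J m G s :: nat and H \<sigma> \<theta> r0 a b :: real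
  assumes up: "1 \<le> H" "1 \<le> M" "0 < \<theta>" "2 * \<theta> * (H * 2 ^ J) \<le> 1" "H \<le> \<sigma>"
      "300 * (12 * \<nu> / pi) * M * H powr (2 - 2 * \<alpha>) \<le> 1 - 4 powr (1 - \<alpha>)"
    and wmax: "1 \<le> R - 2 * ln (H * 2 ^ J)"
    and low: "1 \<le> r0" "r0 \<le> R - 2" "1 \<le> G" "2 * pi / G \<le> exp (- r0 / 2)" "1 \<le> s"
    and ab: "a \<le> s" "45 * m * M * H * \<sigma> \<le> b"
  shows "1 - ((12 * \<nu> / pi) * cells * (H * 2 ^ J) powr (- 2 * \<alpha>)
        + cells * exp (- real M * exp (- W.barrier_rate))
        + cells * (exp (12 * \<nu> / pi) / 2 ^ m) + (cells * J) * exp (1 - \<theta> * \<sigma>))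
      - (exp (- real n * exp (- \<alpha> * (R - r0)) / 4)
          + real (G * s) * exp (- real n * exp (- 2 * \<alpha>) / (4 * real (G * s))))
    \<le> poi_prob \<alpha> \<nu> n (\<lambda>k x. a \<le> real (largest_component_size k (hrg_adj \<nu> n k x)) \<and>
         real (largest_component_size k (hrg_adj \<nu> n k x)) \<le> b)" (is "1 - ?e1 - ?e2 \<le> ?p")
proof -
  let ?Q = "\<lambda>k adj. a \<le> real (largest_component_size k adj) \<and> real (largest_component_size k adj) \<le> b"
  let ?E = "{\<omega>\<in>space P.sample_space. ?Q (fst \<omega>) (hrg_adj \<nu> n (fst \<omega>) (snd \<omega>))}"
  have p: "?p = P.Om.prob ?E" and E: "?E \<in> P.Om.events" by (rule poi_prob_eq[of ?Q])+
  obtain U where U: "U \<in> P.Om.events" "1 - ?e1 \<le> P.Om.prob U"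
    "\<And>\<omega> i. \<omega> \<in> U \<Longrightarrow> i < fst \<omega> \<Longrightarrow>
        0 \<le> proj (snd \<omega> i) \<and> proj (snd \<omega> i) < cells \<and> 1 \<le> wt (snd \<omega> i) \<and> wt (snd \<omega> i) < H * 2 ^ J"
    "\<And>\<omega> adj v. \<omega> \<in> U \<Longrightarrow> (\<And>i j. adj i j \<Longrightarrow> adj j i) \<Longrightarrow>
        (\<And>i j. adj i j \<Longrightarrow> i < fst \<omega> \<and> j < fst \<omega> \<and>
            \<bar>proj (snd \<omega> i) - proj (snd \<omega> j)\<bar> \<le> wt (snd \<omega> i) * wt (snd \<omega> j)) \<Longrightarrow>
        real (card (component_of (fst \<omega>) adj v)) \<le> 45 * m * M * H * \<sigma>"
    using W.component_bound_event[OF up(1-5) up(6), of m] by blast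
  obtain L where L: "L \<in> P.Om.events" "1 - ?e2 \<le> P.Om.prob L"
    "\<And>\<omega> i. \<omega> \<in> L \<Longrightarrow> i < fst \<omega> \<Longrightarrow> 0 \<le> fst (snd \<omega> i) \<and> fst (snd \<omega> i) < R \<and>
          0 \<le> snd (snd \<omega> i) \<and> snd (snd \<omega> i) < 2 * pi"
    "\<And>\<omega>. \<omega> \<in> L \<Longrightarrow> s \<le> largest_component_size (fst \<omega>) (hrg_adj \<nu> n (fst \<omega>) (snd \<omega>))"
    using large_component_event[OF low] by blast
  have "U \<inter> L \<subseteq> ?E"
  proof
    fix \<omega> assume w: "\<omega> \<in> U \<inter> L"
    let ?adj = "hrg_adj \<nu> n (fst \<omega>) (snd \<omega>)"
    have r1: "1 \<le> fst (snd \<omega> i)" if i: "i < fst \<omega>" for i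
    proof -
      \<comment> \<open>The bound on the weights forces radii of at least 1, as
        \<open>adj_imp_proj_close\<close> requires.\<close>
      have "0 < H * 2 ^ J" using up(1) by simp
      from wt_ge_iff[OF this, of "snd \<omega> i"] have "R - 2 * ln (H * 2 ^ J) < fst (snd \<omega> i)"
        using U(3)[of \<omega> i] w i by force
      then show ?thesis using wmax by linarith
    qed
    have sym: "?adj j i" if "?adj i j" for i j
      using that by (auto simp: hrg_adj_def hyp_dist_def mult_ac cos_diff)
    have close: "i < fst \<omega> \<and> j < fst \<omega> \<and>
            \<bar>proj (snd \<omega> i) - proj (snd \<omega> j)\<bar> \<le> wt (snd \<omega> i) * wt (snd \<omega> j)" if "?adj i j" for i j
      using that r1 L(3)[of \<omega>] w by (auto simp: hrg_adj_def intro!: adj_imp_proj_close)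
    have "real (card (component_of (fst \<omega>) ?adj v)) \<le> b" for v
      using U(4)[of \<omega> ?adj v, OF _ sym close] w ab(2) by auto
    moreover have "0 \<le> 45 * m * M * H * \<sigma>" using up by auto
    then have "0 \<le> b" using ab(2) by (rule order_trans)
    ultimately have "real (largest_component_size (fst \<omega>) ?adj) \<le> b"
      by (intro largest_component_size_le)
    moreover have "s \<le> largest_component_size (fst \<omega>) ?adj" using L(4) w by auto
    moreover have "\<omega> \<in> space P.sample_space" using w sets.sets_into_space[OF U(1)] by auto
    ultimately show "\<omega> \<in> ?E" using ab(1) by auto
  qed
  then have "P.Om.prob (U \<inter> L) \<le> ?p" unfolding p using E by (intro P.Om.finite_measure_mono)
  moreover have "P.Om.prob U + P.Om.prob L - 1 \<le> P.Om.prob (U \<inter> L)"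
  proof -
    have "P.Om.prob (U \<union> L) = P.Om.prob U + P.Om.prob L - P.Om.prob (U \<inter> L)"
      using U(1) L(1) P.Om.finite_measure_Union'[of U L] P.Om.finite_measure_Diff'[of L U]
      by (simp add: Int_commute)
    then show ?thesis using P.Om.prob_le_1[of "U \<union> L"] by linarith
  qed
  ultimately show "1 - ?e1 - ?e2 \<le> ?p" using U(2) L(2) by linarith
qed

end

section \<open>Asymptotics\<close>

text \<open>The requirements of \<open>poi_prob_lower_bound\<close> on \<open>n\<close>, with
  \<beta> = 1 / (2 \<alpha>); \<alpha> > 1 gives \<beta> < 1/2.\<close>

lemma asymptotic_conditions:
  fixes \<beta> \<nu> a \<delta> c :: real
  assumes "0 < \<beta>" "\<beta> < 1 / 2" "0 < \<nu>" "0 < a" "0 < \<delta>" "0 < c"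
  shows "\<forall>\<^sub>F n::nat in sequentially.
      1 \<le> ln (real n) \<and>
      1 \<le> 2 * ln (real n / \<nu>) \<and>
      c * ((ln (real n))\<^sup>2 + 1) * ln (real n) powr (- 3) \<le> \<delta> \<and>
      ln (real n) powr a \<le> real n powr \<beta> * ln (real n) \<and>
      1 \<le> 2 * ln (real n / \<nu>) - 2 * ln (2 * (real n powr \<beta> * ln (real n))) \<and>
      1 \<le> 2 * ln (real n / \<nu>) - 2 * \<beta> * (ln (real n) - ln (ln (real n))) \<and>
      2 \<le> 2 * \<beta> * (ln (real n) - ln (ln (real n))) \<and>
      1 \<le> real n / ((2 * pi * (real n / \<nu> * real n powr (- \<beta>) * ln (real n) powr \<beta>) + 1) * (ln (real n))\<^sup>2) - 1 \<and>
      real n powr \<beta> * ln (real n) powr (- 3)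
        \<le> real n / ((2 * pi * (real n / \<nu> * real n powr (- \<beta>) * ln (real n) powr \<beta>) + 1) * (ln (real n))\<^sup>2) - 1 \<and>
      log 2 (real n powr \<beta> * ln (real n)) + 1 \<le> real n \<and>
      540 * ((ln (real n))\<^sup>2 + 1)\<^sup>2 * (ln (real n))\<^sup>2 \<le> ln (real n) ^ 8"
proof (intro eventually_conj)
  have "(\<lambda>n::nat. c * ((ln (real n))\<^sup>2 + 1) * ln (real n) powr (- 3)) \<longlonglongrightarrow> 0"
    by real_asymp
  from order_tendstoD(2)[OF this assms(5)]
  show "\<forall>\<^sub>F n in sequentially. c * ((ln (real n))\<^sup>2 + 1) * ln (real n) powr (- 3) \<le> \<delta>"
    by (rule eventually_mono) simp
  show "\<forall>\<^sub>F n in sequentially. ln (real n) powr a \<le> real n powr \<beta> * ln (real n)"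
    using assms by real_asymp
  have "filterlim (\<lambda>n::nat. 2 * ln (real n / \<nu>) - 2 * ln (2 * (real n powr \<beta> * ln (real n)))) at_top sequentially"
    using assms by real_asymp
  then show "\<forall>\<^sub>F n in sequentially. 1 \<le> 2 * ln (real n / \<nu>) - 2 * ln (2 * (real n powr \<beta> * ln (real n)))"
    unfolding filterlim_at_top by blast
  have "filterlim (\<lambda>n::nat. 2 * ln (real n / \<nu>) - 2 * \<beta> * (ln (real n) - ln (ln (real n)))) at_top sequentially"
    using assms by real_asymp
  then show "\<forall>\<^sub>F n in sequentially. 1 \<le> 2 * ln (real n / \<nu>) - 2 * \<beta> * (ln (real n) - ln (ln (real n)))"
    unfolding filterlim_at_top by blast
  have "filterlim (\<lambda>n::nat. 2 * \<beta> * (ln (real n) - ln (ln (real n)))) at_top sequentially"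
    using assms by real_asymp
  then show "\<forall>\<^sub>F n in sequentially. 2 \<le> 2 * \<beta> * (ln (real n) - ln (ln (real n)))"
    unfolding filterlim_at_top by blast
  have "filterlim (\<lambda>n::nat. real n / ((2 * pi * (real n / \<nu> * real n powr (- \<beta>) * ln (real n) powr \<beta>) + 1) * (ln (real n))\<^sup>2) - 1)
      at_top sequentially"
    using assms by real_asymp
  then show "\<forall>\<^sub>F n in sequentially. 1 \<le> real n / ((2 * pi * (real n / \<nu> * real n powr (- \<beta>) * ln (real n) powr \<beta>) + 1) * (ln (real n))\<^sup>2) - 1"
    unfolding filterlim_at_top by blast
  \<comment> \<open>The right side has order n^\<beta> (log n)^(- 2 - \<beta>), which exceeds the
    left side because \<beta> < 1.\<close>
  show "\<forall>\<^sub>F n in sequentially. real n powr \<beta> * ln (real n) powr (- 3)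
        \<le> real n / ((2 * pi * (real n / \<nu> * real n powr (- \<beta>) * ln (real n) powr \<beta>) + 1) * (ln (real n))\<^sup>2) - 1"
    using assms by real_asymp
  show "\<forall>\<^sub>F n in sequentially. log 2 (real n powr \<beta> * ln (real n)) + 1 \<le> real n"
    using assms by real_asymp
  have "filterlim (\<lambda>n::nat. 2 * ln (real n / \<nu>)) at_top sequentially"
    using assms by real_asymp
  then show "\<forall>\<^sub>F n in sequentially. 1 \<le> 2 * ln (real n / \<nu>)"
    unfolding filterlim_at_top by blast
qed real_asymp+

text \<open>Exponents of order (log n)^2 beat every power of \<open>n\<close> whatever the constants
  \<open>p\<close> and \<open>q\<close>, and exp (- 3 log n) beats n^2. The slowest terms are (log
  n)^(- 2 \<alpha>) and n^(- 1/4).\<close>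

lemma failure_bound_tendsto_0:
  fixes \<alpha> \<kappa> c p q :: real
  assumes "1 < \<alpha>" "0 < p" "0 < q"
  shows "(\<lambda>n::nat. \<kappa> * (c * real n + 2) * (1 / real n * ln (real n) powr (- 2 * \<alpha>))
      + (c * real n + 2) * exp (- ((ln (real n))\<^sup>2) * p)
      + (c * real n + 2) * (exp \<kappa> / 2 powr ((ln (real n))\<^sup>2))
      + ((c * real n + 2) * real n) * exp (1 - 3 * ln (real n))
      + (exp (- ln (real n) / 4) + real n * exp (- ((ln (real n))\<^sup>2) * q))) \<longlonglongrightarrow> 0"
proof -
  have "(\<lambda>n::nat. \<kappa> * (c * real n + 2) * (1 / real n * ln (real n) powr (- 2 * \<alpha>))) \<longlonglongrightarrow> 0"
    using assms by real_asymp
  moreover have "(\<lambda>n::nat. (c * real n + 2) * exp (- ((ln (real n))\<^sup>2) * p)) \<longlonglongrightarrow> 0"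
    using assms by real_asymp
  moreover have "(\<lambda>n::nat. (c * real n + 2) * (exp \<kappa> / 2 powr ((ln (real n))\<^sup>2))) \<longlonglongrightarrow> 0"
    using assms by real_asymp
  moreover have "(\<lambda>n::nat. ((c * real n + 2) * real n) * exp (1 - 3 * ln (real n))) \<longlonglongrightarrow> 0"
    by real_asymp
  moreover have "(\<lambda>n::nat. exp (- ln (real n) / 4)) \<longlonglongrightarrow> 0"
    by real_asymp
  moreover have "(\<lambda>n::nat. real n * exp (- ((ln (real n))\<^sup>2) * q)) \<longlonglongrightarrow> 0"
    using assms by real_asymp
  ultimately show ?thesis by (auto intro!: tendsto_add_zero)
qed

text \<open>Here all parameters receive their values; each of the six error terms is then compared
  with one that is explicit in \<open>n\<close>.\<close>

lemma poi_prob_lower_bound: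
  fixes \<alpha> \<nu> a \<beta> l :: real and n :: nat
  defines "\<beta> \<equiv> 1 / (2 * \<alpha>)" and "a \<equiv> 3 / (2 * \<alpha> - 2)" and "l \<equiv> ln (real n)"
    and "\<kappa> \<equiv> 12 * \<nu> / pi"
  assumes "1 < \<alpha>" "0 < \<nu>" "0 < n" and l1: "1 \<le> l"
    and R1: "1 \<le> 2 * ln (real n / \<nu>)"
    and sub: "300 * \<kappa> * (l\<^sup>2 + 1) * l powr (- 3) \<le> 1 - 4 powr (1 - \<alpha>)"
    and HW: "l powr a \<le> real n powr \<beta> * l"
    and wmax: "1 \<le> 2 * ln (real n / \<nu>) - 2 * ln (2 * (real n powr \<beta> * l))"
    and r0: "1 \<le> 2 * ln (real n / \<nu>) - 2 * \<beta> * (l - ln l)" "2 \<le> 2 * \<beta> * (l - ln l)"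
    and s1: "1 \<le> real n / ((2 * pi * (real n / \<nu> * real n powr (- \<beta>) * l powr \<beta>) + 1) * l\<^sup>2) - 1"
    and s2: "real n powr \<beta> * l powr (- 3)
        \<le> real n / ((2 * pi * (real n / \<nu> * real n powr (- \<beta>) * l powr \<beta>) + 1) * l\<^sup>2) - 1"
    and J: "log 2 (real n powr \<beta> * l) + 1 \<le> real n"
    and poly: "540 * (l\<^sup>2 + 1)\<^sup>2 * l\<^sup>2 \<le> l ^ 8"
  shows "1 - (\<kappa> * (pi / (12 * \<nu>) * real n + 2) * (1 / real n * l powr (- 2 * \<alpha>))
      + (pi / (12 * \<nu>) * real n + 2) * exp (- (l\<^sup>2) * exp (- (8 * \<kappa> / (1 - 4 powr (1 - \<alpha>)))))
      + (pi / (12 * \<nu>) * real n + 2) * (exp \<kappa> / 2 powr (l\<^sup>2))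
      + ((pi / (12 * \<nu>) * real n + 2) * real n) * exp (1 - 3 * l)
      + (exp (- l / 4) + real n * exp (- (l\<^sup>2) * (exp (- 2 * \<alpha>) / 4))))
    \<le> poi_prob \<alpha> \<nu> n (\<lambda>k x.
        real n powr \<beta> * l powr (- (a + 8)) \<le> real (largest_component_size k (hrg_adj \<nu> n k x)) \<and>
        real (largest_component_size k (hrg_adj \<nu> n k x)) \<le> real n powr \<beta> * l powr (a + 8))"
proof -
  have "0 < hrg_R \<nu> n" unfolding hrg_R_def using R1 by linarith
  then interpret hrg \<alpha> \<nu> n
    using assms by unfold_locales
  have R: "R = 2 * ln (real n / \<nu>)" by (simp add: hrg_R_def)
  have a0: "0 < a" using \<open>1 < \<alpha>\<close> by (simp add: a_def)
  have ab: "2 * \<alpha> * \<beta> = 1" "a * (2 - 2 * \<alpha>) = - 3" "0 < \<beta>"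
    using \<open>1 < \<alpha>\<close> by (auto simp: \<beta>_def a_def field_simps)
  have n1: "1 \<le> real n" using n by simp
  have kappa: "0 < \<kappa>" using nu by (simp add: \<kappa>_def)
  have el: "exp l = real n" using n by (simp add: l_def)
  \<comment> \<open>Cutoff for the largest weight: n W0^(- 2 \<alpha>) = (log n)^(- 2 \<alpha>)
    tends to 0.\<close>
  define W0 where "W0 = real n powr \<beta> * l"
  have W0: "1 \<le> W0" unfolding W0_def using n1 l1 ab(3) by (intro mult_ge1_I ge_one_powr_ge_zero) auto
  \<comment> \<open>The exponent \<open>a\<close> gives H^(2 - 2 \<alpha>) = l^(-3), which beats M,
    of order l^2.\<close>
  define H where "H = l powr a"
  have H1: "1 \<le> H" unfolding H_def using l1 a0 by (intro ge_one_powr_ge_zero) auto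
  have HW0: "H \<le> W0" using HW by (simp add: H_def W0_def)
  \<comment> \<open>Serves both as the number of candidate cuts and as the bound on the points of a
    cell.\<close>
  define M where "M = nat \<lceil>l\<^sup>2\<rceil>"
  have l2: "1 \<le> l\<^sup>2" using l1 by (simp add: one_le_power)
  have M: "l\<^sup>2 \<le> real M" "real M \<le> l\<^sup>2 + 1" "1 \<le> M"
    unfolding M_def using l2 by linarith+
  \<comment> \<open>Places \<open>H * 2 ^ J\<close> between W0 and 2 W0: the lower bound makes
    heavier points unlikely, the upper one is needed for \<theta> and for radii of at least
    1.\<close>
  define J where "J = nat \<lceil>log 2 (W0 / H)\<rceil>"
  have WH: "1 \<le> W0 / H" using HW0 H1 by simp
  then have lg0: "0 \<le> log 2 (W0 / H)" by simp
  have Jr: "log 2 (W0 / H) \<le> real J" "real J \<le> log 2 (W0 / H) + 1"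
    unfolding J_def using lg0 by linarith+
  have top: "W0 \<le> H * 2 ^ J" "H * 2 ^ J \<le> 2 * W0"
  proof -
    have e: "2 powr log 2 (W0 / H) = W0 / H" using WH by (intro powr_log_cancel) auto
    have "2 powr log 2 (W0 / H) \<le> 2 powr real J" using Jr by (intro powr_mono) auto
    then show "W0 \<le> H * 2 ^ J" unfolding e using H1 by (simp add: powr_realpow divide_le_eq mult.commute)
    have "2 powr real J \<le> 2 powr (log 2 (W0 / H) + 1)" using Jr by (intro powr_mono) auto
    also have "\<dots> = 2 * (W0 / H)" by (simp add: powr_add e)
    finally show "H * 2 ^ J \<le> 2 * W0" using H1 by (simp add: powr_realpow le_divide_eq mult.commute)
  qed
  have Jn: "real J \<le> real n"
  proof -
    have "W0 / H \<le> W0" using H1 W0 by (simp add: divide_le_eq)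
    then have "log 2 (W0 / H) \<le> log 2 W0" using WH W0 by (subst log_le_cancel_iff) auto
    then show ?thesis using Jr J by (simp add: W0_def)
  qed
  \<comment> \<open>The largest \<theta> with 2 \<theta> (2 W0) <= 1; \<sigma> is then chosen so
    that \<theta> \<sigma> = 3 l, which pays for the union bound over \<open>cells * J\<close>
    sites.\<close>
  define \<theta> where "\<theta> = 1 / (4 * W0)"
  define \<sigma> where "\<sigma> = 12 * l * W0"
  have th: "0 < \<theta>" "\<theta> * \<sigma> = 3 * l" using W0 by (auto simp: \<theta>_def \<sigma>_def)
  have thJ: "2 * \<theta> * (H * 2 ^ J) \<le> 1"
  proof -
    have "2 * \<theta> * (H * 2 ^ J) \<le> 2 * \<theta> * (2 * W0)" using th top by (intro mult_left_mono) auto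
    also have "\<dots> = 1" using W0 by (simp add: \<theta>_def)
    finally show ?thesis .
  qed
  have Hs: "H \<le> \<sigma>"
  proof -
    have "1 * W0 \<le> 12 * l * W0" using l1 W0 by (intro mult_right_mono) auto
    then show ?thesis using HW0 by (simp add: \<sigma>_def)
  qed
  have subM: "300 * (12 * \<nu> / pi) * M * H powr (2 - 2 * \<alpha>) \<le> 1 - 4 powr (1 - \<alpha>)"
  proof -
    have "H powr (2 - 2 * \<alpha>) = l powr (- 3)" unfolding H_def powr_powr ab(2) ..
    moreover have "300 * \<kappa> * M * l powr (- 3) \<le> 300 * \<kappa> * (l\<^sup>2 + 1) * l powr (- 3)"
      using kappa M by (intro mult_right_mono mult_left_mono) auto
    ultimately show ?thesis using sub by (simp add: \<kappa>_def)
  qed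
  have wm: "1 \<le> R - 2 * ln (H * 2 ^ J)"
  proof -
    have "ln (H * 2 ^ J) \<le> ln (2 * W0)" using top W0 by (subst ln_le_cancel_iff) auto
    then show ?thesis using wmax by (simp add: R W0_def)
  qed
  \<comment> \<open>Makes n exp (- \<alpha> (R - r0)) equal to l, so a point of radius at most r0 is
    missing with probability at most n^(- 1/4).\<close>
  define r0 where "r0 = R - 2 * \<beta> * (l - ln l)"
  have r0': "1 \<le> r0" "r0 \<le> R - 2" using r0 by (auto simp: r0_def R)
  define Z where "Z = real n / \<nu> * real n powr (- \<beta>) * l powr \<beta>"
  have Z: "exp (r0 / 2) = Z"
  proof -
    have "r0 / 2 = R / 2 + ((- \<beta>) * l + \<beta> * ln l)" by (simp add: r0_def field_simps)
    then have "exp (r0 / 2) = exp (R / 2) * (exp ((- \<beta>) * l) * exp (\<beta> * ln l))"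
      by (simp only: exp_add)
    moreover have "l powr \<beta> = exp (\<beta> * ln l)" using l1 by (simp add: powr_def)
    moreover have "real n powr (- \<beta>) = exp ((- \<beta>) * l)" using n by (simp add: powr_def l_def)
    ultimately show ?thesis by (simp add: exp_half_R Z_def)
  qed
  have Z0: "0 < Z" using Z by (metis exp_gt_zero)
  define G where "G = nat \<lceil>2 * pi * Z\<rceil>"
  have G: "2 * pi * Z \<le> real G" "real G \<le> 2 * pi * Z + 1" "1 \<le> G"
  proof -
    have "0 < 2 * pi * Z" using Z0 by simp
    then show "2 * pi * Z \<le> real G" "real G \<le> 2 * pi * Z + 1" "1 \<le> G"
      unfolding G_def by linarith+
  qed
  have Gexp: "2 * pi / G \<le> exp (- r0 / 2)"
  proof -
    have e: "exp (- r0 / 2) = 1 / Z" using Z by (simp add: exp_minus inverse_eq_divide)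
    show ?thesis unfolding e using G Z0 by (simp add: field_simps)
  qed
  \<comment> \<open>Leaves G s <= n / l^2 boxes, so each has a mean number of points of order at
    least l^2.\<close>
  define s where "s = nat \<lfloor>real n / (real G * l\<^sup>2)\<rfloor>"
  have Gl: "0 < real G * l\<^sup>2" using G l1 by auto
  have s_ge: "real n / ((2 * pi * Z + 1) * l\<^sup>2) - 1 \<le> real s" and s_le: "real s \<le> real n / (real G * l\<^sup>2)"
  proof -
    have "real n / ((2 * pi * Z + 1) * l\<^sup>2) \<le> real n / (real G * l\<^sup>2)"
      using G Gl l2 by (intro divide_left_mono mult_right_mono mult_pos_pos) auto
    moreover have "0 \<le> real n / (real G * l\<^sup>2)" by simp
    ultimately show "real n / ((2 * pi * Z + 1) * l\<^sup>2) - 1 \<le> real s" "real s \<le> real n / (real G * l\<^sup>2)"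
      unfolding s_def by linarith+
  qed
  have s1': "1 \<le> s" using s1 s_ge unfolding Z_def[symmetric] by linarith
  have Gs: "real (G * s) * l\<^sup>2 \<le> real n" using s_le Gl by (simp add: le_divide_eq mult_ac)
  have Gsn: "real (G * s) \<le> real n"
  proof -
    have "real (G * s) * 1 \<le> real (G * s) * l\<^sup>2" using l2 by (intro mult_left_mono) auto
    then show ?thesis using Gs by simp
  qed
  have low: "real n powr \<beta> * l powr (- (a + 8)) \<le> real s"
  proof -
    have "real n powr \<beta> * l powr (- (a + 8)) \<le> real n powr \<beta> * l powr (- 3)"
      using l1 a0 by (intro mult_left_mono powr_mono) auto
    then show ?thesis using s2 s_ge unfolding Z_def[symmetric] by linarith
  qed
  \<comment> \<open>540 = 45 * 12. The factors M, M and l W0 give a polynomial in l of degree 6,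
    which l^8 dominates.\<close>
  have high: "45 * M * M * H * \<sigma> \<le> real n powr \<beta> * l powr (a + 8)"
  proof -
    have "45 * M * M * H * \<sigma> = real M * real M * (540 * H * l * W0)" by (simp add: \<sigma>_def)
    also have "\<dots> \<le> (l\<^sup>2 + 1) * (l\<^sup>2 + 1) * (540 * H * l * W0)"
      using M H1 l1 W0 by (intro mult_right_mono mult_mono) auto
    also have "\<dots> = (540 * (l\<^sup>2 + 1)\<^sup>2 * l\<^sup>2) * (real n powr \<beta> * H)"
      by (simp add: W0_def power2_eq_square mult_ac)
    also have "\<dots> \<le> l ^ 8 * (real n powr \<beta> * H)"
      using poly H1 by (intro mult_right_mono) auto
    also have "\<dots> = real n powr \<beta> * l powr (a + 8)"
      using l1 by (simp add: H_def powr_add powr_numeral mult_ac)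
    finally show ?thesis .
  qed
  define c where "c = pi / (12 * \<nu>) * real n + 2"
  have cells_le: "real cells \<le> c"
  proof -
    have "0 \<le> pi * (real n / (12 * \<nu>))" using nu by simp
    then have "real cells \<le> pi * (real n / (12 * \<nu>)) + 2" unfolding cells_def by linarith
    then show ?thesis by (simp add: c_def)
  qed
  have c0: "0 \<le> c" using cells_le by linarith
  note main = poi_prob_largest_component[OF H1 M(3) th(1) thJ Hs subM wm r0' G(3) Gexp s1' low high]
  have e1: "(12 * \<nu> / pi) * cells * (H * 2 ^ J) powr (- 2 * \<alpha>) \<le> \<kappa> * c * (1 / real n * l powr (- 2 * \<alpha>))"
  proof -
    have "(H * 2 ^ J) powr (- 2 * \<alpha>) \<le> W0 powr (- 2 * \<alpha>)"
      using top W0 \<open>1 < \<alpha>\<close> by (intro powr_mono2') auto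
    also have "\<dots> = real n powr (- (2 * \<alpha> * \<beta>)) * l powr (- 2 * \<alpha>)"
      unfolding W0_def using l1 by (simp add: powr_mult powr_powr mult_ac)
    also have "real n powr (- (2 * \<alpha> * \<beta>)) = 1 / real n"
      unfolding ab(1) using n by (simp add: powr_minus_divide)
    finally have "(H * 2 ^ J) powr (- 2 * \<alpha>) \<le> 1 / real n * l powr (- 2 * \<alpha>)" .
    then show ?thesis unfolding \<kappa>_def using cells_le nu by (intro mult_mono) auto
  qed
  have e2: "cells * exp (- real M * exp (- W.barrier_rate))
      \<le> c * exp (- (l\<^sup>2) * exp (- (8 * \<kappa> / (1 - 4 powr (1 - \<alpha>)))))"
  proof -
    have "W.barrier_rate = 8 * \<kappa> / (1 - 4 powr (1 - \<alpha>))"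
      unfolding W.barrier_rate_def \<kappa>_def ..
    then show ?thesis using cells_le M c0 by (auto intro!: mult_mono)
  qed
  have e3: "cells * (exp (12 * \<nu> / pi) / 2 ^ M) \<le> c * (exp \<kappa> / 2 powr (l\<^sup>2))"
  proof -
    have "2 powr (l\<^sup>2) \<le> 2 powr (real M)" using M by (intro powr_mono) auto
    then have "2 powr (l\<^sup>2) \<le> (2::real) ^ M" by (simp add: powr_realpow)
    then show ?thesis unfolding \<kappa>_def using cells_le c0 by (intro mult_mono divide_left_mono) auto
  qed
  have e4: "real (cells * J) * exp (1 - \<theta> * \<sigma>) \<le> (c * real n) * exp (1 - 3 * l)"
    unfolding th(2) of_nat_mult using cells_le Jn c0 by (intro mult_right_mono mult_mono) auto
  have e5: "exp (- real n * exp (- \<alpha> * (R - r0)) / 4) \<le> exp (- l / 4)"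
  proof -
    have "- \<alpha> * (R - r0) = - (2 * \<alpha> * \<beta>) * (l - ln l)" by (simp add: r0_def)
    also have "\<dots> = ln l - l" unfolding ab(1) by simp
    finally have "exp (- \<alpha> * (R - r0)) = l / real n"
      using l1 el by (simp add: exp_diff)
    then show ?thesis using n by simp
  qed
  have e6: "real (G * s) * exp (- real n * exp (- 2 * \<alpha>) / (4 * real (G * s)))
      \<le> real n * exp (- (l\<^sup>2) * (exp (- 2 * \<alpha>) / 4))"
  proof (rule mult_mono)
    have p: "0 < real (G * s)" using G s1' by simp
    then have "l\<^sup>2 \<le> real n / real (G * s)" using Gs by (simp add: le_divide_eq mult.commute)
    then have "l\<^sup>2 * (exp (- 2 * \<alpha>) / 4) \<le> real n / real (G * s) * (exp (- 2 * \<alpha>) / 4)"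
      by (intro mult_right_mono) auto
    then show "exp (- real n * exp (- 2 * \<alpha>) / (4 * real (G * s))) \<le> exp (- (l\<^sup>2) * (exp (- 2 * \<alpha>) / 4))"
      by (simp add: mult_ac)
  qed (use Gsn in auto)
  show ?thesis
    using main e1 e2 e3 e4 e5 e6 unfolding c_def[symmetric] by linarith
qed

theorem theorem1:
  fixes \<alpha> \<nu> :: real
  assumes "\<alpha> > 1" and "\<nu> > 0"
  shows "\<exists>C > 0. (\<lambda>n. poi_prob \<alpha> \<nu> n (\<lambda>k x.
            real n powr (1 / (2 * \<alpha>)) * ln (real n) powr (- C)
              \<le> real (largest_component_size k (hrg_adj \<nu> n k x)) \<and>
            real (largest_component_size k (hrg_adj \<nu> n k x))
              \<le> real n powr (1 / (2 * \<alpha>)) * ln (real n) powr C))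
          \<longlonglongrightarrow> 1"
proof -
  define \<beta> where "\<beta> = 1 / (2 * \<alpha>)"
  define a where "a = 3 / (2 * \<alpha> - 2)"
  define \<kappa> where "\<kappa> = 12 * \<nu> / pi"
  have b: "0 < \<beta>" "\<beta> < 1 / 2" and a: "0 < a" and k: "0 < 300 * \<kappa>"
    using assms by (auto simp: \<beta>_def a_def \<kappa>_def field_simps)
  have d: "0 < 1 - 4 powr (1 - \<alpha>)"
    using powr_less_cancel_iff[of 4 "1 - \<alpha>" 0] assms by simp
  define p where "p = exp (- (8 * \<kappa> / (1 - 4 powr (1 - \<alpha>))))"
  define q where "q = exp (- 2 * \<alpha>) / 4"
  define c where "c = pi / (12 * \<nu>)"
  define err where "err = (\<lambda>n::nat. \<kappa> * (c * real n + 2) * (1 / real n * ln (real n) powr (- 2 * \<alpha>))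
      + (c * real n + 2) * exp (- ((ln (real n))\<^sup>2) * p)
      + (c * real n + 2) * (exp \<kappa> / 2 powr ((ln (real n))\<^sup>2))
      + ((c * real n + 2) * real n) * exp (1 - 3 * ln (real n))
      + (exp (- ln (real n) / 4) + real n * exp (- ((ln (real n))\<^sup>2) * q)))"
  have err: "err \<longlonglongrightarrow> 0"
    unfolding err_def using assms by (intro failure_bound_tendsto_0) (auto simp: p_def q_def)
  define pr where "pr = (\<lambda>n. poi_prob \<alpha> \<nu> n (\<lambda>k x.
        real n powr \<beta> * ln (real n) powr (- (a + 8)) \<le> real (largest_component_size k (hrg_adj \<nu> n k x)) \<and>
        real (largest_component_size k (hrg_adj \<nu> n k x)) \<le> real n powr \<beta> * ln (real n) powr (a + 8)))"
  have ev: "\<forall>\<^sub>F n in sequentially. 1 - err n \<le> pr n \<and> pr n \<le> 1"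
    using asymptotic_conditions[OF b assms(2) a d k] eventually_gt_at_top[of 0]
  proof eventually_elim
    case (elim n)
    have "0 < hrg_R \<nu> n" unfolding hrg_R_def using elim by linarith
    then interpret hrg \<alpha> \<nu> n
      using assms elim by unfold_locales
    have "1 - err n \<le> pr n"
      using poi_prob_lower_bound[of \<alpha> \<nu> n] assms elim
      unfolding err_def pr_def \<beta>_def a_def \<kappa>_def p_def q_def c_def by blast
    moreover have "pr n \<le> 1"
      unfolding pr_def by (rule poi_prob_le_1)
    ultimately show ?case ..
  qed
  have "pr \<longlonglongrightarrow> 1"
  proof (rule tendsto_sandwich[of "\<lambda>n. 1 - err n" pr sequentially "\<lambda>_. 1"])
    show "(\<lambda>n. 1 - err n) \<longlonglongrightarrow> 1" using tendsto_diff[OF tendsto_const[of 1] err] by simp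
  qed (use ev in \<open>auto elim: eventually_mono\<close>)
  \<comment> \<open>C = a + 8: the a comes from H, and the 8 bounds all other logarithmic
    factors.\<close>
  then show ?thesis
    unfolding pr_def \<beta>_def using a by (intro exI[of _ "a + 8"]) auto
qed

end
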